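(* Let $E\to B$ be a real vector bundle of rank $m$ over a Riemannian $n$-manifold, equipped with a fibre metric and compatible connection, and let $g=h^2\big(\sum_{i=1}^nb_i^2\big)+k^2\big(\sum_{\alpha=1}^m\zeta_\alpha^2\big)$ be the metric on the total space of $E$ determined by smooth positive functions $h,k$ of the fibre radius $r$. Assume that $g$ is Ricci-flat. Let $X=s(r)\frac{\partial}{\partial r}$. Then with respect to $g$, $$\begin{aligned}|\nabla X|^2&=-\frac{(m-1)s^2k''}{k}+(s')^2+\frac{2ss'k'}{k}+\frac{(2m-1)s^2(k')^2}{k^2}+\frac{(m-1)s^2k'}{kr}\\&\qquad+\frac{ns^2h'k'}{hk}+\frac{(m-1)s^2}{r^2}-\frac{ns^2h''}{h}+\frac{ns^2(h')^2}{h^2}.\end{aligned}$$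
   Context: Let $\pi:E\to B$ be a real vector bundle of rank $m$ over an $n$-manifold $B$ with Riemannian metric $\check g$; $E$ has a fibre metric and a compatible connection, so $TE$ splits into horizontal and vertical subbundles. Locally, $\{b_i\}_{i=1}^n$ is a $\check g$-orthonormal coframe on $B$, pulled back to $E$; $x_\alpha$ are the fibre coordinates on $E$ of a local orthonormal frame $\{\sigma_\alpha\}_{\alpha=1}^m$ of $E$; and $\zeta_\alpha=dx_\alpha+x_\beta\omega_{\alpha\beta}$ are the vertical 1-forms annihilating the horizontal distribution, with $\omega_{\alpha\beta}=-\omega_{\beta\alpha}$ (connection) 1-forms pulled back from $B$. The fibre radius is $r$, $r^2=\sum_\alpha x_\alpha^2$, and $\frac{\partial}{\partial r}=\frac{x_\alpha}{r}\mathsf{v}_\alpha$ is the vertical radial vector field, where $\mathsf{v}_\alpha$ is the vertical field $\partial/\partial x_\alpha$. The functions $h,k$ are smooth positive functions of $r\in[0,\infty)$, $s$ is a smooth function of $r$; $g$ does not depend on the choices of frames. $\nabla$ is the Levi-Civita connection of $g$, $|\cdot|$ is the $g$-norm, and prime denotes $d/dr$. Formulas are understood where $r>0$. *)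

theory Defs
  imports "HOL-Analysis.Analysis"
begin

text \<open>
  Manifolds, vector bundles and connections are not available in the library; this theory defines
  them on types. A manifold is a Hausdorff second countable type with a maximal smooth atlas,
  tangent vectors are derivations on real functions, and the two connections are operators on
  local sections satisfying the usual axioms.
\<close>


section \<open>Smooth maps between normed spaces\<close>

text \<open>For open \<open>S\<close> in finite dimension this is \<open>C^k\<close>: all iterated directional derivatives up to order
  \<open>k\<close> exist and are continuous.\<close>

primrec Ck_on :: "nat \<Rightarrow> 'a::real_normed_vector set \<Rightarrow> ('a \<Rightarrow> 'b::real_normed_vector) \<Rightarrow> bool" where
  "Ck_on 0 S f \<longleftrightarrow> continuous_on S f"
| "Ck_on (Suc k) S f \<longleftrightarrow>
     (\<forall>x\<in>S. f differentiable (at x)) \<and> (\<forall>v. Ck_on k S (\<lambda>x. frechet_derivative f (at x) v))"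

text \<open>On an arbitrary set (such as \<open>[0,\<infinity>)\<close>) smooth means having a smooth extension to an open
  neighbourhood; on an open set the extension is the function itself.\<close>

definition smooth_on :: "'a::real_normed_vector set \<Rightarrow> ('a \<Rightarrow> 'b::real_normed_vector) \<Rightarrow> bool" where
  "smooth_on S f \<longleftrightarrow>
     (\<exists>T F. open T \<and> S \<subseteq> T \<and> (\<forall>k. Ck_on k T F) \<and> (\<forall>x\<in>S. F x = f x))"


section \<open>Smooth manifolds\<close>

text \<open>A chart is a pair of its open domain and its coordinate map (with irrelevant values outside
  the domain).\<close>

type_synonym ('p, 'v) chart = "'p set \<times> ('p \<Rightarrow> 'v)"

definition chart_inv :: "('p, 'v) chart \<Rightarrow> 'v \<Rightarrow> 'p" where
  "chart_inv c = inv_into (fst c) (snd c)"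

definition is_chart :: "('p::topological_space, 'v::euclidean_space) chart \<Rightarrow> bool" where
  "is_chart c \<longleftrightarrow> open (fst c) \<and> open (snd c ` fst c) \<and>
     (\<exists>\<psi>. homeomorphism (fst c) (snd c ` fst c) (snd c) \<psi>)"

definition compatible_charts ::
    "('p, 'v::euclidean_space) chart \<Rightarrow> ('p, 'v) chart \<Rightarrow> bool" where
  "compatible_charts c d \<longleftrightarrow>
     smooth_on (snd c ` (fst c \<inter> fst d)) (snd d \<circ> chart_inv c) \<and>
     smooth_on (snd d ` (fst c \<inter> fst d)) (snd c \<circ> chart_inv d)"

definition smooth_structure ::
    "('p::{t2_space, second_countable_topology}, 'v::euclidean_space) chart set \<Rightarrow> bool" where
  "smooth_structure M \<longleftrightarrow>
     (\<forall>c\<in>M. is_chart c) \<and> (\<Union>c\<in>M. fst c) = UNIV \<and>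
     (\<forall>c\<in>M. \<forall>d\<in>M. compatible_charts c d) \<and>
     (\<forall>c. is_chart c \<and> (\<forall>d\<in>M. compatible_charts c d) \<longrightarrow> c \<in> M)"

definition smooth_fun_on ::
    "('p, 'v::euclidean_space) chart set \<Rightarrow> 'p set \<Rightarrow> ('p \<Rightarrow> real) \<Rightarrow> bool" where
  "smooth_fun_on M W f \<longleftrightarrow>
     (\<forall>p\<in>W. \<exists>c\<in>M. p \<in> fst c \<and> smooth_on (snd c ` (fst c \<inter> W)) (f \<circ> chart_inv c))"

text \<open>
  Tangent vectors act on real functions; a function counts only through its germ, so it may be
  given locally. The vector \<open>tangent c p v\<close> is the derivation with coordinates \<open>v\<close> in the chart \<open>c\<close>.
  It is set to \<open>0\<close> on functions that are not differentiable at \<open>p\<close>, which makes equality of tangent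
  vectors independent of charts.
\<close>

type_synonym 'p tvec = "('p \<Rightarrow> real) \<Rightarrow> real"

definition tangent :: "('p, 'v::euclidean_space) chart \<Rightarrow> 'p \<Rightarrow> 'v \<Rightarrow> 'p tvec" where
  "tangent c p v = (\<lambda>f. if (f \<circ> chart_inv c) differentiable (at (snd c p))
                        then frechet_derivative (f \<circ> chart_inv c) (at (snd c p)) v else 0)"

definition tangent_space :: "('p, 'v::euclidean_space) chart set \<Rightarrow> 'p \<Rightarrow> 'p tvec set" where
  "tangent_space M p = {tangent c p v |c v. c \<in> M \<and> p \<in> fst c}"

definition pushforward :: "('p \<Rightarrow> 'q) \<Rightarrow> 'p tvec \<Rightarrow> 'q tvec" where
  "pushforward F w = (\<lambda>f. w (f \<circ> F))"

text \<open>The component of a tangent vector \<open>w\<close> along \<open>b \<in> Basis\<close> in the chart \<open>c\<close> is its value on the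
  coordinate function \<open>\<lambda>q. snd c q \<bullet> b\<close>.\<close>

definition vector_field_on ::
    "('p, 'v::euclidean_space) chart set \<Rightarrow> 'p set \<Rightarrow> ('p \<Rightarrow> 'p tvec) \<Rightarrow> bool" where
  "vector_field_on M W X \<longleftrightarrow>
     (\<forall>p\<in>W. X p \<in> tangent_space M p \<and>
        (\<exists>c\<in>M. p \<in> fst c \<and>
           (\<forall>b\<in>Basis. smooth_on (snd c ` (fst c \<inter> W))
              (\<lambda>y. X (chart_inv c y) (\<lambda>q. snd c q \<bullet> b)))))"

definition riemannian_metric ::
    "('p, 'v::euclidean_space) chart set \<Rightarrow> ('p \<Rightarrow> 'p tvec \<Rightarrow> 'p tvec \<Rightarrow> real) \<Rightarrow> bool" where
  "riemannian_metric M g \<longleftrightarrow>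
     (\<forall>c\<in>M.
        (\<forall>p\<in>fst c.
           bilinear (\<lambda>u v. g p (tangent c p u) (tangent c p v)) \<and>
           (\<forall>u v. g p (tangent c p u) (tangent c p v) = g p (tangent c p v) (tangent c p u)) \<and>
           (\<forall>u. u \<noteq> 0 \<longrightarrow> 0 < g p (tangent c p u) (tangent c p u))) \<and>
        (\<forall>u v. smooth_on (snd c ` fst c)
           (\<lambda>y. g (chart_inv c y) (tangent c (chart_inv c y) u) (tangent c (chart_inv c y) v))))"


section \<open>Levi-Civita connection and Ricci curvature\<close>

text \<open>
  An affine connection on the open set \<open>S\<close> of a manifold: \<open>nab p w X\<close> is the derivative at \<open>p\<close> in the
  direction \<open>w\<close> of a vector field \<open>X\<close> defined on some neighbourhood of \<open>p\<close>. Sums and multiples of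
  tangent vectors are pointwise.
\<close>

definition affine_connection_on ::
    "('p::topological_space, 'v::euclidean_space) chart set \<Rightarrow> 'p set \<Rightarrow>
     ('p \<Rightarrow> 'p tvec \<Rightarrow> ('p \<Rightarrow> 'p tvec) \<Rightarrow> 'p tvec) \<Rightarrow> bool" where
  "affine_connection_on M S nab \<longleftrightarrow>
     (\<forall>W X. open W \<and> W \<subseteq> S \<and> vector_field_on M W X \<longrightarrow>
        (\<forall>Y. vector_field_on M W Y \<longrightarrow> vector_field_on M W (\<lambda>p. nab p (Y p) X)) \<and>
        (\<forall>p\<in>W. \<forall>w\<in>tangent_space M p.
           nab p w X \<in> tangent_space M p \<and>
           (\<forall>a. \<forall>w'\<in>tangent_space M p.
              nab p (\<lambda>f. a * w f + w' f) X = (\<lambda>f. a * nab p w X f + nab p w' X f)) \<and>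
           (\<forall>Y. vector_field_on M W Y \<longrightarrow>
              nab p w (\<lambda>q f. X q f + Y q f) = (\<lambda>f. nab p w X f + nab p w Y f)) \<and>
           (\<forall>\<phi>. smooth_fun_on M W \<phi> \<longrightarrow>
              nab p w (\<lambda>q f. \<phi> q * X q f) = (\<lambda>f. w \<phi> * X p f + \<phi> p * nab p w X f)) \<and>
           (\<forall>Y. (\<forall>q\<in>W. Y q = X q) \<longrightarrow> nab p w Y = nab p w X)))"

text \<open>Torsion-freeness \<open>\<nabla>\<^sub>X Y - \<nabla>\<^sub>Y X = [X, Y]\<close> is an identity of derivations on smooth functions.\<close>

definition levi_civita_on ::
    "('p::topological_space, 'v::euclidean_space) chart set \<Rightarrow> 'p set \<Rightarrow>
     ('p \<Rightarrow> 'p tvec \<Rightarrow> 'p tvec \<Rightarrow> real) \<Rightarrow>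
     ('p \<Rightarrow> 'p tvec \<Rightarrow> ('p \<Rightarrow> 'p tvec) \<Rightarrow> 'p tvec) \<Rightarrow> bool" where
  "levi_civita_on M S g nab \<longleftrightarrow>
     affine_connection_on M S nab \<and>
     (\<forall>W X Y. open W \<and> W \<subseteq> S \<and> vector_field_on M W X \<and> vector_field_on M W Y \<longrightarrow>
        (\<forall>p\<in>W.
           (\<forall>f. smooth_fun_on M W f \<longrightarrow>
              nab p (X p) Y f - nab p (Y p) X f = X p (\<lambda>q. Y q f) - Y p (\<lambda>q. X q f)) \<and>
           (\<forall>w\<in>tangent_space M p.
              w (\<lambda>q. g q (X q) (Y q)) = g p (nab p w X) (Y p) + g p (X p) (nab p w Y))))"

text \<open>
  In a chart \<open>c\<close> the Ricci tensor \<open>Ric(u,v)\<close> is the trace of \<open>a \<mapsto> R(a,u)v\<close>, where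
  \<open>R(a,u)v = \<nabla>\<^sub>a\<nabla>\<^sub>u v - \<nabla>\<^sub>u\<nabla>\<^sub>a v\<close> is evaluated on coordinate vector fields, for which the term
  \<open>\<nabla>\<^bsub>[a,u]\<^esub> v\<close> vanishes.
\<close>

definition coord_field :: "('p, 'v::euclidean_space) chart \<Rightarrow> 'v \<Rightarrow> 'p \<Rightarrow> 'p tvec" where
  "coord_field c v = (\<lambda>p. tangent c p v)"

definition curvature ::
    "('p, 'v::euclidean_space) chart \<Rightarrow> ('p \<Rightarrow> 'p tvec \<Rightarrow> ('p \<Rightarrow> 'p tvec) \<Rightarrow> 'p tvec) \<Rightarrow>
     'p \<Rightarrow> 'v \<Rightarrow> 'v \<Rightarrow> 'v \<Rightarrow> 'p tvec" where
  "curvature c nab p a u v = (\<lambda>f.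
     nab p (tangent c p a) (\<lambda>q. nab q (tangent c q u) (coord_field c v)) f -
     nab p (tangent c p u) (\<lambda>q. nab q (tangent c q a) (coord_field c v)) f)"

definition ricci ::
    "('p, 'v::euclidean_space) chart \<Rightarrow> ('p \<Rightarrow> 'p tvec \<Rightarrow> ('p \<Rightarrow> 'p tvec) \<Rightarrow> 'p tvec) \<Rightarrow>
     'p \<Rightarrow> 'v \<Rightarrow> 'v \<Rightarrow> real" where
  "ricci c nab p u v = (\<Sum>b\<in>Basis. curvature c nab p b u v (\<lambda>q. snd c q \<bullet> b))"

definition ricci_flat_on ::
    "('p, 'v::euclidean_space) chart set \<Rightarrow> 'p set \<Rightarrow>
     ('p \<Rightarrow> 'p tvec \<Rightarrow> ('p \<Rightarrow> 'p tvec) \<Rightarrow> 'p tvec) \<Rightarrow> bool" where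
  "ricci_flat_on M S nab \<longleftrightarrow> (\<forall>c\<in>M. \<forall>p\<in>fst c \<inter> S. \<forall>u v. ricci c nab p u v = 0)"

text \<open>The squared \<open>g\<close>-norm at \<open>p\<close> of an endomorphism \<open>T\<close> of the tangent space, such as
  \<open>w \<mapsto> \<nabla>\<^sub>w X\<close>, is \<open>\<Sum>w\<in>F. g p (T w) (T w)\<close> for any orthonormal basis \<open>F\<close>.\<close>

definition orthonormal_basis_at ::
    "('p, 'v::euclidean_space) chart set \<Rightarrow> ('p \<Rightarrow> 'p tvec \<Rightarrow> 'p tvec \<Rightarrow> real) \<Rightarrow>
     'p \<Rightarrow> 'p tvec set \<Rightarrow> bool" where
  "orthonormal_basis_at M g p F \<longleftrightarrow>
     F \<subseteq> tangent_space M p \<and> card F = DIM('v) \<and>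
     (\<forall>w\<in>F. \<forall>w'\<in>F. g p w w' = (if w = w' then 1 else 0))"


section \<open>Vector bundles with fibre metric and connection\<close>

text \<open>
  The operations \<open>add\<close> and \<open>scale\<close> are the vector space operations of the fibres and are meaningful
  for arguments in a common fibre. The base has dimension \<open>CARD('n)\<close>, the bundle has rank \<open>CARD('m)\<close>.
\<close>

record ('b, 'e, 'n, 'm) vbundle =
  base :: "('b, real ^ 'n::finite) chart set"
  total :: "('e, (real ^ 'n::finite) \<times> (real ^ 'm::finite)) chart set"
  proj :: "'e \<Rightarrow> 'b"
  add :: "'e \<Rightarrow> 'e \<Rightarrow> 'e"
  scale :: "real \<Rightarrow> 'e \<Rightarrow> 'e"

text \<open>The chart of the total space given by a base chart \<open>c\<close> and fibre coordinates \<open>\<psi>\<close>.\<close>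

definition bundle_chart ::
    "('b, 'e, 'n::finite, 'm::finite) vbundle \<Rightarrow> ('b, real ^ 'n) chart \<Rightarrow> ('e \<Rightarrow> real ^ 'm) \<Rightarrow>
     ('e, (real ^ 'n) \<times> (real ^ 'm)) chart" where
  "bundle_chart B c \<psi> = (proj B -` fst c, \<lambda>e. (snd c (proj B e), \<psi> e))"

text \<open>A local trivialisation over \<open>U\<close>, given by its fibre component \<open>\<psi>\<close>: it is linear and bijective on
  fibres, and \<open>e \<mapsto> (proj B e, \<psi> e)\<close> is a diffeomorphism onto \<open>U \<times> \<real>\<^sup>m\<close>.\<close>

definition local_triv ::
    "('b::topological_space, 'e, 'n::finite, 'm::finite) vbundle \<Rightarrow> 'b set \<Rightarrow>
     ('e \<Rightarrow> real ^ 'm) \<Rightarrow> bool" where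
  "local_triv B U \<psi> \<longleftrightarrow>
     open U \<and>
     (\<forall>p\<in>U. bij_betw \<psi> (proj B -` {p}) UNIV) \<and>
     (\<forall>e e'. proj B e \<in> U \<and> proj B e' = proj B e \<longrightarrow> \<psi> (add B e e') = \<psi> e + \<psi> e') \<and>
     (\<forall>a e. proj B e \<in> U \<longrightarrow> \<psi> (scale B a e) = a *\<^sub>R \<psi> e) \<and>
     (\<forall>c\<in>base B. fst c \<subseteq> U \<longrightarrow> bundle_chart B c \<psi> \<in> total B)"

text \<open>The vector space axioms in the fibres follow from the existence of local trivialisations.\<close>

definition vector_bundle ::
    "('b::{t2_space, second_countable_topology}, 'e::{t2_space, second_countable_topology},
      'n::finite, 'm::finite) vbundle \<Rightarrow> bool" where
  "vector_bundle B \<longleftrightarrow>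
     smooth_structure (base B) \<and> smooth_structure (total B) \<and>
     (\<forall>e e'. proj B e' = proj B e \<longrightarrow> proj B (add B e e') = proj B e) \<and>
     (\<forall>a e. proj B (scale B a e) = proj B e) \<and>
     (\<forall>p. \<exists>U \<psi>. p \<in> U \<and> local_triv B U \<psi>)"

definition section_on ::
    "('b::topological_space, 'e, 'n::finite, 'm::finite) vbundle \<Rightarrow> 'b set \<Rightarrow>
     ('b \<Rightarrow> 'e) \<Rightarrow> bool" where
  "section_on B W \<sigma> \<longleftrightarrow>
     (\<forall>p\<in>W. proj B (\<sigma> p) = p \<and>
        (\<exists>U \<psi> c. local_triv B U \<psi> \<and> p \<in> U \<and> c \<in> base B \<and> p \<in> fst c \<and>
           smooth_on (snd c ` (fst c \<inter> U \<inter> W)) (\<lambda>y. \<psi> (\<sigma> (chart_inv c y)))))"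

definition fibre_metric ::
    "('b::topological_space, 'e, 'n::finite, 'm::finite) vbundle \<Rightarrow>
     ('e \<Rightarrow> 'e \<Rightarrow> real) \<Rightarrow> bool" where
  "fibre_metric B ip \<longleftrightarrow>
     (\<forall>e e' e'' a. proj B e' = proj B e \<and> proj B e'' = proj B e \<longrightarrow>
        ip (add B (scale B a e) e') e'' = a * ip e e'' + ip e' e'' \<and> ip e e' = ip e' e) \<and>
     (\<forall>e. e \<noteq> scale B 0 e \<longrightarrow> 0 < ip e e) \<and>
     (\<forall>W \<sigma> \<tau>. open W \<and> section_on B W \<sigma> \<and> section_on B W \<tau> \<longrightarrow>
        smooth_fun_on (base B) W (\<lambda>p. ip (\<sigma> p) (\<tau> p)))"

text \<open>\<open>D p w \<sigma>\<close> is the covariant derivative at \<open>p\<close> in the direction \<open>w\<close> of a section \<open>\<sigma>\<close> defined on some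
  neighbourhood of \<open>p\<close>.\<close>

definition bundle_connection ::
    "('b::topological_space, 'e, 'n::finite, 'm::finite) vbundle \<Rightarrow>
     ('b \<Rightarrow> 'b tvec \<Rightarrow> ('b \<Rightarrow> 'e) \<Rightarrow> 'e) \<Rightarrow> bool" where
  "bundle_connection B D \<longleftrightarrow>
     (\<forall>W \<sigma>. open W \<and> section_on B W \<sigma> \<longrightarrow>
        (\<forall>Y. vector_field_on (base B) W Y \<longrightarrow> section_on B W (\<lambda>p. D p (Y p) \<sigma>)) \<and>
        (\<forall>p\<in>W. \<forall>w\<in>tangent_space (base B) p.
           proj B (D p w \<sigma>) = p \<and>
           (\<forall>a. \<forall>w'\<in>tangent_space (base B) p.
              D p (\<lambda>f. a * w f + w' f) \<sigma> = add B (scale B a (D p w \<sigma>)) (D p w' \<sigma>)) \<and>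
           (\<forall>\<tau>. section_on B W \<tau> \<longrightarrow>
              D p w (\<lambda>q. add B (\<sigma> q) (\<tau> q)) = add B (D p w \<sigma>) (D p w \<tau>)) \<and>
           (\<forall>f. smooth_fun_on (base B) W f \<longrightarrow>
              D p w (\<lambda>q. scale B (f q) (\<sigma> q)) =
              add B (scale B (w f) (\<sigma> p)) (scale B (f p) (D p w \<sigma>))) \<and>
           (\<forall>\<tau>. (\<forall>q\<in>W. \<tau> q = \<sigma> q) \<longrightarrow> D p w \<tau> = D p w \<sigma>)))"

definition metric_compatible ::
    "('b::topological_space, 'e, 'n::finite, 'm::finite) vbundle \<Rightarrow> ('e \<Rightarrow> 'e \<Rightarrow> real) \<Rightarrow>
     ('b \<Rightarrow> 'b tvec \<Rightarrow> ('b \<Rightarrow> 'e) \<Rightarrow> 'e) \<Rightarrow> bool" where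
  "metric_compatible B ip D \<longleftrightarrow>
     (\<forall>W \<sigma> \<tau>. open W \<and> section_on B W \<sigma> \<and> section_on B W \<tau> \<longrightarrow>
        (\<forall>p\<in>W. \<forall>w\<in>tangent_space (base B) p.
           w (\<lambda>q. ip (\<sigma> q) (\<tau> q)) = ip (D p w \<sigma>) (\<tau> p) + ip (\<sigma> p) (D p w \<tau>)))"


section \<open>The metric on the total space\<close>

text \<open>
  A local orthonormal frame \<open>(\<sigma>\<^sub>\<alpha>)\<close> over \<open>U\<close> is given by the trivialisation \<open>\<psi>\<close> with components its
  fibre coordinates: \<open>\<psi> e $ \<alpha> = x\<^sub>\<alpha>(e)\<close>.
\<close>

definition orthonormal_triv ::
    "('b::topological_space, 'e, 'n::finite, 'm::finite) vbundle \<Rightarrow> ('e \<Rightarrow> 'e \<Rightarrow> real) \<Rightarrow>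
     'b set \<Rightarrow> ('e \<Rightarrow> real ^ 'm) \<Rightarrow> bool" where
  "orthonormal_triv B ip U \<psi> \<longleftrightarrow>
     local_triv B U \<psi> \<and>
     (\<forall>e e'. proj B e \<in> U \<and> proj B e' = proj B e \<longrightarrow> ip e e' = (\<Sum>\<alpha>\<in>UNIV. \<psi> e $ \<alpha> * \<psi> e' $ \<alpha>))"

definition frame ::
    "('b, 'e, 'n::finite, 'm::finite) vbundle \<Rightarrow> ('e \<Rightarrow> real ^ 'm) \<Rightarrow> 'm \<Rightarrow> 'b \<Rightarrow> 'e" where
  "frame B \<psi> \<alpha> p = inv_into (proj B -` {p}) \<psi> (axis \<alpha> 1)"

text \<open>The connection forms of an orthonormal frame, \<open>\<nabla>\<sigma>\<^sub>\<beta> = \<Sum>\<^sub>\<alpha> \<omega>\<^sub>\<alpha>\<^sub>\<beta> \<sigma>\<^sub>\<alpha>\<close>.\<close>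

definition conn_form ::
    "('b, 'e, 'n::finite, 'm::finite) vbundle \<Rightarrow> ('e \<Rightarrow> 'e \<Rightarrow> real) \<Rightarrow>
     ('b \<Rightarrow> 'b tvec \<Rightarrow> ('b \<Rightarrow> 'e) \<Rightarrow> 'e) \<Rightarrow> ('e \<Rightarrow> real ^ 'm) \<Rightarrow>
     'm \<Rightarrow> 'm \<Rightarrow> 'b \<Rightarrow> 'b tvec \<Rightarrow> real" where
  "conn_form B ip D \<psi> \<alpha> \<beta> p w = ip (frame B \<psi> \<alpha> p) (D p w (frame B \<psi> \<beta>))"

text \<open>\<open>\<zeta>\<^sub>\<alpha> = dx\<^sub>\<alpha> + \<Sum>\<^sub>\<beta> x\<^sub>\<beta> \<omega>\<^sub>\<alpha>\<^sub>\<beta>\<close>, with \<open>\<omega>\<^sub>\<alpha>\<^sub>\<beta>\<close> pulled back from the base.\<close>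

definition zeta ::
    "('b, 'e, 'n::finite, 'm::finite) vbundle \<Rightarrow> ('e \<Rightarrow> 'e \<Rightarrow> real) \<Rightarrow>
     ('b \<Rightarrow> 'b tvec \<Rightarrow> ('b \<Rightarrow> 'e) \<Rightarrow> 'e) \<Rightarrow> ('e \<Rightarrow> real ^ 'm) \<Rightarrow> 'm \<Rightarrow> 'e \<Rightarrow> 'e tvec \<Rightarrow> real" where
  "zeta B ip D \<psi> \<alpha> e w =
     w (\<lambda>q. \<psi> q $ \<alpha>) +
     (\<Sum>\<beta>\<in>UNIV. \<psi> e $ \<beta> * conn_form B ip D \<psi> \<alpha> \<beta> (proj B e) (pushforward (proj B) w))"

definition fibre_radius :: "('e \<Rightarrow> 'e \<Rightarrow> real) \<Rightarrow> 'e \<Rightarrow> real" where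
  "fibre_radius ip e = sqrt (ip e e)"

text \<open>
  \<open>g = h\<^sup>2 \<Sum>\<^sub>i b\<^sub>i\<^sup>2 + k\<^sup>2 \<Sum>\<^sub>\<alpha> \<zeta>\<^sub>\<alpha>\<^sup>2\<close>, in every orthonormal frame and polarised to a bilinear form. The sum
  \<open>\<Sum>\<^sub>i b\<^sub>i\<^sup>2\<close> over a \<open>gB\<close>-orthonormal coframe is \<open>gB\<close> itself, pulled back to the total space.
\<close>

definition bundle_metric ::
    "('b::topological_space, 'e, 'n::finite, 'm::finite) vbundle \<Rightarrow>
     ('b \<Rightarrow> 'b tvec \<Rightarrow> 'b tvec \<Rightarrow> real) \<Rightarrow> ('e \<Rightarrow> 'e \<Rightarrow> real) \<Rightarrow>
     ('b \<Rightarrow> 'b tvec \<Rightarrow> ('b \<Rightarrow> 'e) \<Rightarrow> 'e) \<Rightarrow> (real \<Rightarrow> real) \<Rightarrow> (real \<Rightarrow> real) \<Rightarrow>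
     ('e \<Rightarrow> 'e tvec \<Rightarrow> 'e tvec \<Rightarrow> real) \<Rightarrow> bool" where
  "bundle_metric B gB ip D h k g \<longleftrightarrow>
     (\<forall>U \<psi>. orthonormal_triv B ip U \<psi> \<longrightarrow>
        (\<forall>e. proj B e \<in> U \<longrightarrow>
           (\<forall>w\<in>tangent_space (total B) e. \<forall>w'\<in>tangent_space (total B) e.
              g e w w' =
                (h (fibre_radius ip e))\<^sup>2 *
                  gB (proj B e) (pushforward (proj B) w) (pushforward (proj B) w') +
                (k (fibre_radius ip e))\<^sup>2 *
                  (\<Sum>\<alpha>\<in>UNIV. zeta B ip D \<psi> \<alpha> e w * zeta B ip D \<psi> \<alpha> e w'))))"

text \<open>
  \<open>X = s(r) \<partial>/\<partial>r\<close> away from the zero section, where \<open>\<partial>/\<partial>r = \<Sum>\<^sub>\<alpha> (x\<^sub>\<alpha>/r) \<partial>/\<partial>x\<^sub>\<alpha>\<close> in every orthonormal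
  frame.
\<close>

definition radial_field ::
    "('b::topological_space, 'e, 'n::finite, 'm::finite) vbundle \<Rightarrow> ('e \<Rightarrow> 'e \<Rightarrow> real) \<Rightarrow>
     (real \<Rightarrow> real) \<Rightarrow> ('e \<Rightarrow> 'e tvec) \<Rightarrow> bool" where
  "radial_field B ip s X \<longleftrightarrow>
     (\<forall>U \<psi> c e. orthonormal_triv B ip U \<psi> \<and> c \<in> base B \<and> fst c \<subseteq> U \<and> proj B e \<in> fst c \<and>
        0 < fibre_radius ip e \<longrightarrow>
        X e = (\<lambda>f. s (fibre_radius ip e) *
          (\<Sum>\<alpha>\<in>UNIV. (\<psi> e $ \<alpha> / fibre_radius ip e) *
             tangent (bundle_chart B c \<psi>) e (0, axis \<alpha> 1) f)))"

end

theory Submission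
  imports Defs
begin

text \<open>
  Let \<open>R = r \<partial>/\<partial>r\<close> be the Euler field of the fibres, and let \<open>V\<close> and \<open>H = 1 - V\<close> be the projections of
  \<open>TE\<close> to vertical and horizontal vectors. The proof rests on the identity
  \<open>\<nabla>\<^sub>w R = \<mu> H w + \<lambda> V w\<close> with \<open>\<mu> = r h'/h\<close> and \<open>\<lambda> = 1 + r k'/k\<close> (\<open>nabla_radial\<close>).
  It holds because the 1-form dual to \<open>R\<close> is \<open>k\<^sup>2 r dr\<close>, which is closed, so \<open>\<nabla>R\<close> is self-adjoint and
  equals half of the Lie derivative of \<open>g\<close> along \<open>R\<close>. The flow of \<open>R\<close> scales the fibres, so this Lie
  derivative scales the horizontal part of \<open>g\<close> by \<open>2 r h'/h\<close> and the vertical part by \<open>2 + 2 r k'/k\<close>.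
  Its computation involves only derivatives along a ray in a single fibre.

  Two consequences are drawn. First, writing \<open>X = \<sigma> R\<close> with \<open>\<sigma> = s/r\<close> gives
  \<open>\<nabla>\<^sub>w X = d\<sigma>(w) R + \<sigma> (\<mu> H w + \<lambda> V w)\<close>, an explicit self-adjoint endomorphism \<open>T\<close>, and
  \<open>|\<nabla>X|\<^sup>2\<close> is the trace of \<open>T \<circ> T\<close> (\<open>sum_norm_rank_one_plus_A\<close>). Secondly, differentiating the
  identity for \<open>\<nabla>R\<close> once more and taking a trace gives (\<open>ricci_radial_eq\<close>)
  \<open>Ric(R,R) = r \<mu>' (1 - n - m) + r (\<lambda> - \<mu>)' (1 - m) + n (\<lambda> - \<mu>) \<mu>\<close>.
  The asserted formula is the first expression plus \<open>\<sigma>\<^sup>2 Ric(R,R)\<close>, and \<open>Ric(R,R) = 0\<close>.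

  All of this is carried out in the coordinates \<open>(y,x)\<close> of the chart of \<open>E\<close> given by a base chart and
  a local orthonormal frame. There \<open>R\<close> is the linear vector field \<open>(0,x)\<close>, the connection is given by
  its Christoffel symbols, and the axioms of the Levi-Civita connection become identities between
  functions on an open subset of \<open>\<real>\<^sup>n \<times> \<real>\<^sup>m\<close>.
\<close>

section \<open>Calculus of smooth maps\<close>

lemma has_derivative_eq_on_open:
  assumes "open S" "x \<in> S" "\<And>y. y \<in> S \<Longrightarrow> f y = g y"
  shows "(f has_derivative f') (at x) \<longleftrightarrow> (g has_derivative f') (at x)"
  using assms has_derivative_transform_within_open[of f f' x UNIV S g]
    has_derivative_transform_within_open[of g f' x UNIV S f] by auto

lemma frechet_derivative_eq_on_open:
  assumes "open S" "x \<in> S" "\<And>y. y \<in> S \<Longrightarrow> f y = g y"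
  shows "frechet_derivative f (at x) = frechet_derivative g (at x)"
  unfolding frechet_derivative_def using has_derivative_eq_on_open[OF assms] by simp

lemma differentiable_eq_on_open:
  assumes "open S" "x \<in> S" "\<And>y. y \<in> S \<Longrightarrow> f y = g y"
  shows "f differentiable (at x) \<longleftrightarrow> g differentiable (at x)"
  unfolding differentiable_def using has_derivative_eq_on_open[OF assms] by simp

lemma Ck_on_continuous: "Ck_on k S f \<Longrightarrow> continuous_on S f"
  by (cases k) (auto intro!: continuous_at_imp_continuous_on differentiable_imp_continuous_within)

lemma Ck_on_SucD: "Ck_on (Suc k) S f \<Longrightarrow> Ck_on k S f"
proof (induction k arbitrary: f)
  case 0
  then show ?case using Ck_on_continuous[of "Suc 0"] by auto
qed auto

lemma Ck_on_subset: "Ck_on k S f \<Longrightarrow> T \<subseteq> S \<Longrightarrow> Ck_on k T f"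
  by (induction k arbitrary: f) (auto intro: continuous_on_subset)

lemma Ck_on_cong:
  assumes "open S" "Ck_on k S f" "\<And>x. x \<in> S \<Longrightarrow> f x = g x"
  shows "Ck_on k S g"
  using assms(2,3)
proof (induction k arbitrary: f g)
  case 0
  then show ?case using continuous_on_cong[of S S f g] by simp
next
  case (Suc k)
  have "g differentiable (at x)" if "x \<in> S" for x
    using differentiable_eq_on_open[OF assms(1) that Suc.prems(2)] Suc.prems(1) that by auto
  moreover have "Ck_on k S (\<lambda>x. frechet_derivative g (at x) v)" for v
  proof (rule Suc.IH)
    show "Ck_on k S (\<lambda>x. frechet_derivative f (at x) v)" using Suc.prems(1) by simp
    show "frechet_derivative f (at x) v = frechet_derivative g (at x) v" if "x \<in> S" for x
      using frechet_derivative_eq_on_open[OF assms(1) that Suc.prems(2)] by auto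
  qed
  ultimately show ?case by simp
qed

text \<open>
  Differentiability at a point and derivatives depend only on germs, so the class can be tested on a
  neighbourhood of each point.
\<close>

lemma Ck_on_local:
  assumes "\<And>x. x \<in> S \<Longrightarrow> \<exists>T. open T \<and> x \<in> T \<and> Ck_on k T f"
  shows "Ck_on k S f"
  using assms
proof (induction k arbitrary: f)
  case 0
  show ?case
    unfolding Ck_on.simps
  proof (rule continuous_at_imp_continuous_on, rule ballI)
    fix x assume "x \<in> S"
    then obtain T where "open T" "x \<in> T" "Ck_on 0 T f" using 0 by blast
    then show "isCont f x" by (simp add: continuous_on_eq_continuous_at)
  qed
next
  case (Suc k)
  have "\<exists>T. open T \<and> x \<in> T \<and> Ck_on k T (\<lambda>x. frechet_derivative f (at x) v)" if x: "x \<in> S" for x v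
    using Suc.prems[OF x] by auto
  then have "Ck_on k S (\<lambda>x. frechet_derivative f (at x) v)" for v by (rule Suc.IH)
  moreover have "f differentiable (at x)" if "x \<in> S" for x using Suc.prems[OF that] by auto
  ultimately show ?case by simp
qed

text \<open>
  Any explicit derivative may replace the chosen one; this is how all concrete functions below are
  shown to be smooth.
\<close>

lemma Ck_on_SucI:
  assumes "open S" "\<And>x. x \<in> S \<Longrightarrow> (f has_derivative f' x) (at x)" "\<And>v. Ck_on k S (\<lambda>x. f' x v)"
  shows "Ck_on (Suc k) S f"
proof -
  have "Ck_on k S (\<lambda>x. frechet_derivative f (at x) v)" for v
    by (rule Ck_on_cong[OF assms(1) assms(3)[of v]]) (metis assms(2) frechet_derivative_at)
  then show ?thesis using assms(2) by (auto simp: differentiable_def)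
qed

lemma Ck_on_derivative:
  assumes "Ck_on (Suc k) S f" "x \<in> S"
  shows "(f has_derivative frechet_derivative f (at x)) (at x)"
  using assms by (simp add: frechet_derivative_works)

lemma Ck_on_const: "open S \<Longrightarrow> Ck_on k S (\<lambda>x. c)"
proof (induction k arbitrary: c)
  case (Suc k)
  show ?case by (rule Ck_on_SucI[where f' = "\<lambda>x v. 0"]) (use Suc in auto)
qed simp

lemma Ck_on_bounded_linear:
  assumes "open S" "bounded_linear L"
  shows "Ck_on k S L"
proof (cases k)
  case 0
  then show ?thesis using assms by (simp add: linear_continuous_on)
next
  case (Suc j)
  show ?thesis unfolding Suc
    by (rule Ck_on_SucI[where f' = "\<lambda>x v. L v"])
      (use assms in \<open>auto intro: Ck_on_const bounded_linear_imp_has_derivative\<close>)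
qed

lemma Ck_on_add:
  assumes "open S" "Ck_on k S f" "Ck_on k S g"
  shows "Ck_on k S (\<lambda>x. f x + g x)"
  using assms(2,3)
proof (induction k arbitrary: f g)
  case 0
  then show ?case by (simp add: continuous_on_add)
next
  case (Suc k)
  show ?case
    by (rule Ck_on_SucI[where f' = "\<lambda>x v. frechet_derivative f (at x) v + frechet_derivative g (at x) v"])
      (use Suc assms(1) in \<open>auto intro!: has_derivative_add simp: frechet_derivative_works\<close>)
qed

lemma Ck_on_bilinear:
  assumes "bounded_bilinear b" "open S" "Ck_on k S f" "Ck_on k S g"
  shows "Ck_on k S (\<lambda>x. b (f x) (g x))"
  using assms(3,4)
proof (induction k arbitrary: f g)
  case 0
  then show ?case by (simp add: bounded_bilinear.continuous_on[OF assms(1)])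
next
  case (Suc k)
  show ?case
  proof (rule Ck_on_SucI[where f' = "\<lambda>x v. b (f x) (frechet_derivative g (at x) v) +
      b (frechet_derivative f (at x) v) (g x)"])
    show "((\<lambda>x. b (f x) (g x)) has_derivative
        (\<lambda>v. b (f x) (frechet_derivative g (at x) v) + b (frechet_derivative f (at x) v) (g x))) (at x)"
      if "x \<in> S" for x
      by (rule bounded_bilinear.FDERIV[OF assms(1)]) (use Suc.prems that Ck_on_derivative in auto)
    show "Ck_on k S (\<lambda>x. b (f x) (frechet_derivative g (at x) v) +
        b (frechet_derivative f (at x) v) (g x))" for v
      by (intro Ck_on_add assms(2) Suc.IH)
        (use Suc.prems Ck_on_SucD[OF Suc.prems(1)] Ck_on_SucD[OF Suc.prems(2)] in auto)
  qed (rule assms(2))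
qed

lemma Ck_on_sum:
  assumes "open S" "\<And>i. i \<in> I \<Longrightarrow> Ck_on k S (f i)"
  shows "Ck_on k S (\<lambda>x. \<Sum>i\<in>I. f i x)"
  using assms(2)
  by (induction I rule: infinite_finite_induct) (simp_all add: Ck_on_const Ck_on_add assms(1))

lemma linear_sum_Basis:
  fixes L :: "'a::euclidean_space \<Rightarrow> 'b::real_vector"
  assumes "linear L"
  shows "L v = (\<Sum>b\<in>Basis. (v \<bullet> b) *\<^sub>R L b)"
  using linear_sum[OF assms, of "\<lambda>b. (v \<bullet> b) *\<^sub>R b" Basis]
  by (simp add: euclidean_representation linear_scale[OF assms])

text \<open>
  The chain rule expresses the derivative of \<open>g \<circ> f\<close> as a sum, over a basis of the intermediate space,
  of products of a component of \<open>Df\<close> with a directional derivative of \<open>g\<close> composed with \<open>f\<close>. Both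
  factors are one order less smooth, so induction on the order applies.
\<close>

lemma Ck_on_compose:
  fixes f :: "'a::real_normed_vector \<Rightarrow> 'b::euclidean_space"
  assumes "open S" "Ck_on k S f" "Ck_on k T g" "f ` S \<subseteq> T"
  shows "Ck_on k S (\<lambda>x. g (f x))"
  using assms(2,3)
proof (induction k arbitrary: g)
  case 0
  then show ?case using continuous_on_compose2[OF _ _ assms(4)] by simp
next
  case (Suc k)
  show ?case
  proof (rule Ck_on_SucI[where f' = "\<lambda>x v. \<Sum>b\<in>Basis.
      (frechet_derivative f (at x) v \<bullet> b) *\<^sub>R frechet_derivative g (at (f x)) b"])
    fix x assume x: "x \<in> S"
    have g: "(g has_derivative frechet_derivative g (at (f x))) (at (f x))"
      using Suc.prems(2) assms(4) x by (auto intro!: Ck_on_derivative)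
    have "(g \<circ> f has_derivative frechet_derivative g (at (f x)) \<circ> frechet_derivative f (at x)) (at x)"
      using Ck_on_derivative[OF Suc.prems(1) x] g by (rule diff_chain_at)
    then show "((\<lambda>x. g (f x)) has_derivative (\<lambda>v. \<Sum>b\<in>Basis.
      (frechet_derivative f (at x) v \<bullet> b) *\<^sub>R frechet_derivative g (at (f x)) b)) (at x)"
      unfolding o_def
      by (subst linear_sum_Basis[OF has_derivative_linear[OF g], symmetric])
  next
    fix v
    show "Ck_on k S (\<lambda>x. \<Sum>b\<in>Basis.
      (frechet_derivative f (at x) v \<bullet> b) *\<^sub>R frechet_derivative g (at (f x)) b)"
    proof (intro Ck_on_sum assms(1) Ck_on_bilinear[OF bounded_bilinear_scaleR])
      fix b :: 'b
      show "Ck_on k S (\<lambda>x. frechet_derivative f (at x) v \<bullet> b)"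
      proof (rule Ck_on_bilinear[OF bounded_bilinear_inner assms(1)])
        show "Ck_on k S (\<lambda>x. frechet_derivative f (at x) v)" using Suc.prems(1) by simp
        show "Ck_on k S (\<lambda>x. b)" by (rule Ck_on_const[OF assms(1)])
      qed
      show "Ck_on k S (\<lambda>x. frechet_derivative g (at (f x)) b)"
        by (rule Suc.IH) (use Suc.prems Ck_on_SucD[OF Suc.prems(1)] in auto)
    qed
  qed (rule assms(1))
qed

lemma Ck_on_inverse: "Ck_on k (- {0}) (inverse :: real \<Rightarrow> real)"
proof (induction k)
  case 0
  then show ?case by (auto intro!: continuous_on_inverse continuous_on_id)
next
  case (Suc k)
  show ?case
  proof (rule Ck_on_SucI[where f' = "\<lambda>x v. - (inverse x * v * inverse x)"])
    show "Ck_on k (- {0}) (\<lambda>x. - (inverse x * v * inverse x))" for v :: real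
    proof -
      have "Ck_on k (- {0}) (\<lambda>x. inverse x * ((- v) * inverse x))"
        by (intro Ck_on_bilinear[OF bounded_bilinear_mult] Suc Ck_on_const) auto
      then show ?thesis by (simp add: mult.assoc)
    qed
  qed (auto intro!: has_derivative_inverse')
qed

lemma Ck_on_sqrt: "Ck_on k {0<..} sqrt"
proof (induction k)
  case 0
  then show ?case by (auto intro!: continuous_intros)
next
  case (Suc k)
  show ?case
  proof (rule Ck_on_SucI[where f' = "\<lambda>x v. (v / 2) * inverse (sqrt x)"])
    show "(sqrt has_derivative (\<lambda>v. (v / 2) * inverse (sqrt x))) (at x)" if "x \<in> {0<..}" for x
    proof -
      have "(*) (inverse (sqrt x) / 2) = (\<lambda>v. (v / 2) * inverse (sqrt x))" by (simp add: fun_eq_iff)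
      then show ?thesis using DERIV_real_sqrt[of x] that by (simp add: has_field_derivative_def)
    qed
    show "Ck_on k {0<..} (\<lambda>x. (v / 2) * inverse (sqrt x))" for v
      by (intro Ck_on_bilinear[OF bounded_bilinear_mult] Ck_on_const
          Ck_on_compose[OF _ Suc Ck_on_inverse]) auto
  qed auto
qed

lemma Ck_on_norm: "Ck_on k (- {0}) (norm :: 'a::euclidean_space \<Rightarrow> real)"
proof -
  have o: "open (- {0::'a})" by auto
  have id: "Ck_on k (- {0}) (\<lambda>x::'a. x)" by (rule Ck_on_bounded_linear) (auto intro: bounded_linear_ident)
  have "Ck_on k (- {0}) (\<lambda>x::'a. sqrt (x \<bullet> x))"
    by (rule Ck_on_compose[OF o Ck_on_bilinear[OF bounded_bilinear_inner o id id] Ck_on_sqrt]) auto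
  then show ?thesis by (simp add: norm_eq_sqrt_inner[abs_def])
qed

lemma smooth_on_open_iff:
  assumes "open S"
  shows "smooth_on S f \<longleftrightarrow> (\<forall>k. Ck_on k S f)"
proof
  assume "smooth_on S f"
  then obtain T F where *: "S \<subseteq> T" "\<And>k. Ck_on k T F" "\<And>x. x \<in> S \<Longrightarrow> F x = f x"
    unfolding smooth_on_def by blast
  show "\<forall>k. Ck_on k S f" using Ck_on_cong[OF assms Ck_on_subset[OF *(2,1)] *(3)] by blast
next
  show "\<forall>k. Ck_on k S f \<Longrightarrow> smooth_on S f" unfolding smooth_on_def using assms by blast
qed

lemma smooth_on_subset: "smooth_on S f \<Longrightarrow> T \<subseteq> S \<Longrightarrow> smooth_on T f"
  unfolding smooth_on_def by blast

lemma smooth_on_cong: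
  assumes "smooth_on S f" "\<And>x. x \<in> S \<Longrightarrow> f x = g x"
  shows "smooth_on S g"
proof -
  obtain T F where "open T" "S \<subseteq> T" "\<forall>k. Ck_on k T F" "\<forall>x\<in>S. F x = f x"
    using assms(1) unfolding smooth_on_def by blast
  moreover from this(4) have "\<forall>x\<in>S. F x = g x" using assms(2) by simp
  ultimately show ?thesis unfolding smooth_on_def by blast
qed

lemma smooth_on_local:
  assumes "open S" "\<And>x. x \<in> S \<Longrightarrow> \<exists>T. open T \<and> x \<in> T \<and> smooth_on T f"
  shows "smooth_on S f"
  unfolding smooth_on_open_iff[OF assms(1)]
proof (intro allI Ck_on_local)
  fix k x assume "x \<in> S"
  then obtain T where T: "open T" "x \<in> T" "smooth_on T f" using assms(2) by blast
  then have "Ck_on k T f" using smooth_on_open_iff[of T f] by blast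
  then show "\<exists>T. open T \<and> x \<in> T \<and> Ck_on k T f" using T by blast
qed

lemma smooth_onI: "open S \<Longrightarrow> (\<And>k. Ck_on k S f) \<Longrightarrow> smooth_on S f"
  using smooth_on_open_iff by blast

lemma smooth_onD: "open S \<Longrightarrow> smooth_on S f \<Longrightarrow> Ck_on k S f"
  using smooth_on_open_iff by blast

lemma smooth_on_const: "open S \<Longrightarrow> smooth_on S (\<lambda>x. c)"
  by (intro smooth_onI Ck_on_const)

lemma smooth_on_bounded_linear:
  assumes "open S" "bounded_linear L"
  shows "smooth_on S L"
  by (rule smooth_onI[OF assms(1)], rule Ck_on_bounded_linear[OF assms])

lemma smooth_on_bilinear:
  assumes "bounded_bilinear b" "open S" "smooth_on S f" "smooth_on S g"
  shows "smooth_on S (\<lambda>x. b (f x) (g x))"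
  by (rule smooth_onI[OF assms(2)], rule Ck_on_bilinear[OF assms(1,2)]) (rule smooth_onD[OF assms(2)], rule assms)+

lemma smooth_on_sum:
  assumes "open S" "\<And>i. i \<in> I \<Longrightarrow> smooth_on S (f i)"
  shows "smooth_on S (\<lambda>x. \<Sum>i\<in>I. f i x)"
  by (rule smooth_onI[OF assms(1)], rule Ck_on_sum[OF assms(1)]) (rule smooth_onD[OF assms])

lemma smooth_on_compose:
  fixes f :: "'a::real_normed_vector \<Rightarrow> 'b::euclidean_space"
  assumes "open S" "open T" "smooth_on S f" "smooth_on T g" "f ` S \<subseteq> T"
  shows "smooth_on S (\<lambda>x. g (f x))"
  by (rule smooth_onI[OF assms(1)])
    (rule Ck_on_compose[OF assms(1) smooth_onD[OF assms(1,3)] smooth_onD[OF assms(2,4)] assms(5)])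

lemma smooth_on_derivative:
  assumes "open S" "smooth_on S f"
  shows "x \<in> S \<Longrightarrow> (f has_derivative frechet_derivative f (at x)) (at x)"
    and "smooth_on S (\<lambda>x. frechet_derivative f (at x) v)"
proof -
  have *: "Ck_on (Suc k) S f" for k using assms smooth_on_open_iff[OF assms(1)] by blast
  show "x \<in> S \<Longrightarrow> (f has_derivative frechet_derivative f (at x)) (at x)"
    using Ck_on_derivative[OF *[of 0]] .
  show "smooth_on S (\<lambda>x. frechet_derivative f (at x) v)"
    unfolding smooth_on_open_iff[OF assms(1)] using * by simp
qed

lemma smooth_on_differentiable:
  assumes "open S" "smooth_on S f" "x \<in> S"
  shows "f differentiable (at x)"
  using smooth_on_derivative(1)[OF assms] by (rule differentiableI)

lemma smooth_on_components:
  fixes f :: "'a::real_normed_vector \<Rightarrow> 'b::euclidean_space"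
  assumes "open S" "\<And>b. b \<in> Basis \<Longrightarrow> smooth_on S (\<lambda>x. f x \<bullet> b)"
  shows "smooth_on S f"
proof -
  have "smooth_on S (\<lambda>x. (f x \<bullet> b) *\<^sub>R b)" if "b \<in> Basis" for b
    by (rule smooth_on_bilinear[OF bounded_bilinear_scaleR assms(1) assms(2)[OF that]
          smooth_on_const[OF assms(1)]])
  then have "smooth_on S (\<lambda>x. \<Sum>b\<in>Basis. (f x \<bullet> b) *\<^sub>R b)" by (rule smooth_on_sum[OF assms(1)])
  then show ?thesis by (simp add: euclidean_representation)
qed

lemma smooth_on_component:
  assumes "open S" "smooth_on S f"
  shows "smooth_on S (\<lambda>x. f x \<bullet> b)"
  by (rule smooth_on_bilinear[OF bounded_bilinear_inner assms smooth_on_const[OF assms(1)]])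

lemma smooth_on_real_deriv:
  fixes f :: "real \<Rightarrow> real"
  assumes "open T" "smooth_on T f"
  shows "t \<in> T \<Longrightarrow> (f has_real_derivative deriv f t) (at t)"
    and "smooth_on T (deriv f)"
proof -
  have *: "frechet_derivative f (at t) = (\<lambda>v. deriv f t * v)" if "t \<in> T" for t
  proof -
    have "f field_differentiable at t"
      using smooth_on_differentiable[OF assms that] by (simp add: field_differentiable_def real_differentiable_def)
    then have "(f has_derivative (*) (deriv f t)) (at t)"
      by (simp add: field_differentiable_derivI has_field_derivative_def[symmetric])
    then show ?thesis by (rule frechet_derivative_at[symmetric])
  qed
  show "t \<in> T \<Longrightarrow> (f has_real_derivative deriv f t) (at t)"
    using smooth_on_derivative(1)[OF assms, of t] * by (simp add: has_field_derivative_def)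
  show "smooth_on T (deriv f)"
    by (rule smooth_on_cong[OF smooth_on_derivative(2)[OF assms, of 1]]) (simp add: *)
qed

section \<open>Traces and orthonormal bases\<close>

abbreviation endo_trace :: "('v::euclidean_space \<Rightarrow> 'v) \<Rightarrow> real" where
  "endo_trace L \<equiv> \<Sum>b\<in>Basis. L b \<bullet> b"

lemma sum_Basis_prod:
  fixes f :: "'a::euclidean_space \<times> 'b::euclidean_space \<Rightarrow> real"
  shows "sum f Basis = (\<Sum>i\<in>Basis. f (i, 0)) + (\<Sum>i\<in>Basis. f (0, i))"
proof -
  have "inj_on (\<lambda>u. (u::'a, 0::'b)) Basis" "inj_on (\<lambda>u. (0::'a, u::'b)) Basis"
    by (auto intro!: inj_onI)
  then show ?thesis
    unfolding Basis_prod_def by (subst sum.union_disjoint) (auto simp: Basis_prod_def sum.reindex)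
qed

lemma trace_rank_one:
  fixes p :: "'v::euclidean_space"
  assumes "linear f"
  shows "endo_trace (\<lambda>b. f b *\<^sub>R p) = f p"
  using linear_sum_Basis[OF assms, of p] by (simp add: inner_commute mult.commute)

text \<open>
  Expanding in a \<open>G\<close>-orthonormal basis \<open>F\<close> shows that the left-hand side is the trace of \<open>L\<close>, which may
  equally be computed in the standard basis. This turns the norm of an endomorphism, defined through
  a \<open>g\<close>-orthonormal basis, into a coordinate computation.
\<close>

lemma sum_orthonormal_eq_trace:
  fixes G :: "'v::euclidean_space \<Rightarrow> 'v \<Rightarrow> real"
  assumes G: "\<And>v. linear (\<lambda>u. G u v)"
    and F: "card F = DIM('v)" "\<And>v w. v \<in> F \<Longrightarrow> w \<in> F \<Longrightarrow> G v w = (if v = w then 1 else 0)"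
    and L: "linear L"
  shows "(\<Sum>w\<in>F. G (L w) w) = endo_trace L"
proof -
  have fin: "finite F" using F(1) DIM_positive[where 'a = 'v] card.infinite by fastforce
  have coeff: "G (\<Sum>v\<in>F. f v *\<^sub>R v) w = f w" if w: "w \<in> F" for f w
  proof -
    have "G (\<Sum>v\<in>F. f v *\<^sub>R v) w = (\<Sum>v\<in>F. f v * G v w)"
      by (simp add: linear_sum[OF G] linear_scale[OF G])
    also have "\<dots> = (\<Sum>v\<in>F. if v = w then f v else 0)" by (rule sum.cong) (use F(2) w in auto)
    finally show ?thesis using w fin by simp
  qed
  have "independent F"
  proof
    assume "dependent F"
    then obtain f v where "v \<in> F" "f v \<noteq> 0" "(\<Sum>v\<in>F. f v *\<^sub>R v) = 0"
      using dependent_finite[OF fin] by blast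
    then show False using coeff[of v f] linear_0[OF G] by simp
  qed
  then have "UNIV \<subseteq> span F"
    by (intro card_ge_dim_independent) (auto simp: F(1))
  then have expand: "v = (\<Sum>w\<in>F. G v w *\<^sub>R w)" for v
  proof -
    obtain f where f: "v = (\<Sum>w\<in>F. f w *\<^sub>R w)"
      using \<open>UNIV \<subseteq> span F\<close> span_finite[OF fin] by auto
    then show ?thesis using coeff[of _ f] by (metis (no_types, lifting) sum.cong)
  qed
  have "endo_trace L = (\<Sum>b\<in>Basis. (\<Sum>w\<in>F. G (L b) w *\<^sub>R w) \<bullet> b)"
    using expand[of "L b" for b] by metis
  also have "\<dots> = (\<Sum>w\<in>F. \<Sum>b\<in>Basis. (w \<bullet> b) * G (L b) w)"
    by (subst sum.swap) (simp add: inner_sum_left mult.commute)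
  also have "\<dots> = (\<Sum>w\<in>F. G (L w) w)"
  proof (rule sum.cong[OF refl])
    fix w
    have "G (L w) w = (\<Sum>b\<in>Basis. (w \<bullet> b) *\<^sub>R G (L b) w)"
      by (rule linear_sum_Basis[OF linear_compose[OF L G, unfolded o_def]])
    then show "(\<Sum>b\<in>Basis. (w \<bullet> b) * G (L b) w) = G (L w) w" by simp
  qed
  finally show ?thesis by simp
qed

section \<open>Tangent vectors, functions and vector fields in a chart\<close>

lemma tangent_eqI:
  assumes "(f \<circ> chart_inv c has_derivative f') (at (snd c p))"
  shows "tangent c p v f = f' v"
  using assms frechet_derivative_at[OF assms] by (auto simp: tangent_def differentiable_def)

lemma tangent_linear:
  "tangent c p (a *\<^sub>R v + w) = (\<lambda>f. a * tangent c p v f + tangent c p w f)"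
proof
  fix f :: "'a \<Rightarrow> real"
  show "tangent c p (a *\<^sub>R v + w) f = a * tangent c p v f + tangent c p w f"
  proof (cases "(f \<circ> chart_inv c) differentiable (at (snd c p))")
    case True
    then show ?thesis
      using linear_frechet_derivative[OF True] by (simp add: tangent_def linear_add linear_scale)
  qed (simp add: tangent_def)
qed

lemma tangent_zero: "tangent c p 0 = (\<lambda>f. 0)"
  using tangent_linear[of c p "-1" 0 0] by (auto simp: fun_eq_iff)

lemma tangent_scale: "tangent c p (a *\<^sub>R v) = (\<lambda>f. a * tangent c p v f)"
  using tangent_linear[of c p a v 0] by (simp add: tangent_zero)

lemma tangent_add: "tangent c p (v + w) = (\<lambda>f. tangent c p v f + tangent c p w f)"
  using tangent_linear[of c p 1 v w] by simp

locale manifold =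
  fixes M :: "('p::{t2_space, second_countable_topology}, 'v::euclidean_space) chart set"
  assumes smooth_structure: "smooth_structure M"
begin

lemma chart_inv_left: "c \<in> M \<Longrightarrow> p \<in> fst c \<Longrightarrow> chart_inv c (snd c p) = p"
  and open_chart: "c \<in> M \<Longrightarrow> open (fst c)"
  and open_chart_image: "c \<in> M \<Longrightarrow> open (snd c ` fst c)"
  and continuous_chart: "c \<in> M \<Longrightarrow> continuous_on (fst c) (snd c)"
  and open_image: "c \<in> M \<Longrightarrow> open W \<Longrightarrow> W \<subseteq> fst c \<Longrightarrow> open (snd c ` W)"
proof -
  assume c: "c \<in> M"
  then have ch: "is_chart c" using smooth_structure by (simp add: smooth_structure_def)
  then obtain \<psi> where hom: "homeomorphism (fst c) (snd c ` fst c) (snd c) \<psi>"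
    unfolding is_chart_def by blast
  then have inj: "inj_on (snd c) (fst c)" by (metis homeomorphism_apply1 inj_on_inverseI)
  show "p \<in> fst c \<Longrightarrow> chart_inv c (snd c p) = p" using inj by (simp add: chart_inv_def)
  show "open (fst c)" "open (snd c ` fst c)" using ch by (simp_all add: is_chart_def)
  show "continuous_on (fst c) (snd c)" using hom by (simp add: homeomorphism_def)
  assume "open W" "W \<subseteq> fst c"
  then have "openin (top_of_set (fst c)) W" using ch is_chart_def by (metis open_subset)
  then have "openin (top_of_set (snd c ` fst c)) (snd c ` W)"
    using hom by (simp add: homeomorphism_imp_open_map)
  then show "open (snd c ` W)" using ch is_chart_def openin_open_trans by blast
qed

lemma chart_inv_right:
  assumes "c \<in> M" "W \<subseteq> fst c" "y \<in> snd c ` W"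
  shows "chart_inv c y \<in> W" "snd c (chart_inv c y) = y"
  using assms(2,3) chart_inv_left[OF assms(1)] by auto

lemma open_chart_preimage:
  assumes "c \<in> M" "open T"
  shows "open {p \<in> fst c. snd c p \<in> T}"
  using continuous_on_open_vimage[OF open_chart[OF assms(1)], of "snd c"] continuous_chart[OF assms(1)] assms(2)
  by (auto simp: vimage_def Int_def conj_commute)

lemma open_overlap: "c \<in> M \<Longrightarrow> d \<in> M \<Longrightarrow> open (snd c ` (fst c \<inter> fst d))"
  by (rule open_image) (auto intro: open_chart)

lemma smooth_transition:
  "c \<in> M \<Longrightarrow> d \<in> M \<Longrightarrow> smooth_on (snd c ` (fst c \<inter> fst d)) (snd d \<circ> chart_inv c)"
  using smooth_structure by (simp add: smooth_structure_def compatible_charts_def)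

lemma chart_covers: "\<exists>c\<in>M. p \<in> fst c"
proof -
  have "(\<Union>c\<in>M. fst c) = UNIV" using smooth_structure unfolding smooth_structure_def by blast
  then show ?thesis by blast
qed

lemma has_derivative_transition:
  assumes "c \<in> M" "d \<in> M" "p \<in> fst c" "p \<in> fst d"
  shows "(snd d \<circ> chart_inv c has_derivative
    frechet_derivative (snd d \<circ> chart_inv c) (at (snd c p))) (at (snd c p))"
  by (rule smooth_on_derivative(1)[OF open_overlap[OF assms(1,2)] smooth_transition[OF assms(1,2)]])
    (use assms in auto)

lemma has_derivative_change_chart:
  assumes "c \<in> M" "d \<in> M" "p \<in> fst c" "p \<in> fst d"
    and f: "(f \<circ> chart_inv d has_derivative f') (at (snd d p))"
  shows "(f \<circ> chart_inv c has_derivative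
    (\<lambda>v. f' (frechet_derivative (snd d \<circ> chart_inv c) (at (snd c p)) v))) (at (snd c p))"
proof -
  have "((f \<circ> chart_inv d) \<circ> (snd d \<circ> chart_inv c) has_derivative
      f' \<circ> frechet_derivative (snd d \<circ> chart_inv c) (at (snd c p))) (at (snd c p))"
    using has_derivative_transition[OF assms(1-4)] f
    by (intro diff_chain_at) (simp_all add: chart_inv_left assms)
  then have "(f \<circ> chart_inv c has_derivative
      f' \<circ> frechet_derivative (snd d \<circ> chart_inv c) (at (snd c p))) (at (snd c p))"
    by (rule has_derivative_transform_within_open[OF _ open_overlap[OF assms(1,2)]])
      (use assms(3,4) chart_inv_left[OF assms(1)] chart_inv_left[OF assms(2)] in auto)
  then show ?thesis by (simp add: o_def)
qed

text \<open>
  On functions that are differentiable at \<open>p\<close> this is the chain rule. Elsewhere both sides take the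
  default value \<open>0\<close>, since differentiability at \<open>p\<close> is the same in either chart.
\<close>

lemma tangent_change_chart:
  assumes "c \<in> M" "d \<in> M" "p \<in> fst c" "p \<in> fst d"
  shows "tangent c p v = tangent d p (frechet_derivative (snd d \<circ> chart_inv c) (at (snd c p)) v)"
proof
  fix f :: "'p \<Rightarrow> real"
  show "tangent c p v f = tangent d p (frechet_derivative (snd d \<circ> chart_inv c) (at (snd c p)) v) f"
  proof (cases "(f \<circ> chart_inv d) differentiable (at (snd d p))")
    case True
    then have d: "(f \<circ> chart_inv d has_derivative frechet_derivative (f \<circ> chart_inv d) (at (snd d p)))
        (at (snd d p))" by (simp add: frechet_derivative_works)
    show ?thesis
      using tangent_eqI[OF has_derivative_change_chart[OF assms d]] tangent_eqI[OF d] by simp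
  next
    case False
    then have "\<not> (f \<circ> chart_inv c) differentiable (at (snd c p))"
      using has_derivative_change_chart[of d c p f] assms unfolding differentiable_def by blast
    then show ?thesis using False by (simp add: tangent_def)
  qed
qed

lemma chart_coordinate_germ:
  assumes "c \<in> M" "p \<in> fst c"
  shows "((\<lambda>q. snd c q \<bullet> b) \<circ> chart_inv c has_derivative (\<lambda>v. v \<bullet> b)) (at (snd c p))"
  by (rule has_derivative_transform_within_open[OF _ open_chart_image[OF assms(1)], of "\<lambda>y. y \<bullet> b"])
    (use assms(2) chart_inv_left[OF assms(1)] in \<open>auto intro!: derivative_eq_intros\<close>)

lemma tangent_coordinate:
  assumes "c \<in> M" "p \<in> fst c"
  shows "tangent c p v (\<lambda>q. snd c q \<bullet> b) = v \<bullet> b"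
  by (rule tangent_eqI[OF chart_coordinate_germ[OF assms]])

lemma tangent_inject:
  assumes "c \<in> M" "p \<in> fst c"
  shows "tangent c p v = tangent c p w \<longleftrightarrow> v = w"
  using tangent_coordinate[OF assms] by (metis euclidean_eq_iff)

lemma tangent_in_space: "c \<in> M \<Longrightarrow> p \<in> fst c \<Longrightarrow> tangent c p v \<in> tangent_space M p"
  unfolding tangent_space_def by blast

lemma tangent_space_eq:
  assumes "c \<in> M" "p \<in> fst c"
  shows "tangent_space M p = range (tangent c p)"
proof -
  have "tangent d p v \<in> range (tangent c p)" if "d \<in> M" "p \<in> fst d" for d v
    using tangent_change_chart[OF that(1) assms(1) that(2) assms(2)] by auto
  then show ?thesis using tangent_in_space[OF assms] unfolding tangent_space_def by blast
qed

definition components :: "('p, 'v) chart \<Rightarrow> 'p tvec \<Rightarrow> 'v" where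
  "components c w = (\<Sum>b\<in>Basis. w (\<lambda>q. snd c q \<bullet> b) *\<^sub>R b)"

lemma components_inner: "b \<in> Basis \<Longrightarrow> components c w \<bullet> b = w (\<lambda>q. snd c q \<bullet> b)"
  by (simp add: components_def inner_sum_left inner_Basis if_distrib cong: if_cong)

lemma components_tangent:
  assumes "c \<in> M" "p \<in> fst c"
  shows "components c (tangent c p v) = v"
  by (rule euclidean_eqI) (simp add: components_inner tangent_coordinate[OF assms])

lemma tangent_components:
  assumes "c \<in> M" "p \<in> fst c" "w \<in> tangent_space M p"
  shows "tangent c p (components c w) = w"
  using assms components_tangent[OF assms(1,2)] tangent_space_eq[OF assms(1,2)] by auto

lemma smooth_fun_on_chart_iff:
  assumes "c \<in> M" "open W" "W \<subseteq> fst c"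
  shows "smooth_fun_on M W f \<longleftrightarrow> smooth_on (snd c ` W) (f \<circ> chart_inv c)"
proof
  assume f: "smooth_fun_on M W f"
  show "smooth_on (snd c ` W) (f \<circ> chart_inv c)"
  proof (rule smooth_on_local)
    show "open (snd c ` W)" using open_image assms by blast
    fix y assume "y \<in> snd c ` W"
    then obtain p where p: "p \<in> W" "y = snd c p" by blast
    then obtain d where d: "d \<in> M" "p \<in> fst d" "smooth_on (snd d ` (fst d \<inter> W)) (f \<circ> chart_inv d)"
      using f unfolding smooth_fun_on_def by blast
    let ?T = "snd c ` (fst c \<inter> fst d \<inter> W)"
    have T: "open ?T" by (intro open_image open_Int open_chart assms d) auto
    have "smooth_on ?T (\<lambda>z. (f \<circ> chart_inv d) ((snd d \<circ> chart_inv c) z))"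
    proof (rule smooth_on_compose[OF T, where f = "snd d \<circ> chart_inv c" and g = "f \<circ> chart_inv d"])
      show "open (snd d ` (fst d \<inter> W))" by (intro open_image open_Int open_chart assms d) auto
      show "smooth_on ?T (snd d \<circ> chart_inv c)"
        by (rule smooth_on_subset[OF smooth_transition[OF assms(1) d(1)]]) auto
      show "(snd d \<circ> chart_inv c) ` ?T \<subseteq> snd d ` (fst d \<inter> W)"
        using chart_inv_left[OF assms(1)] by auto
    qed (rule d(3))
    then have "smooth_on ?T (f \<circ> chart_inv c)"
      by (rule smooth_on_cong)
        (use chart_inv_left[OF assms(1)] chart_inv_left[OF d(1)] in auto)
    then show "\<exists>T. open T \<and> y \<in> T \<and> smooth_on T (f \<circ> chart_inv c)"
      using T p d assms by (intro exI[of _ ?T]) auto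
  qed
next
  assume "smooth_on (snd c ` W) (f \<circ> chart_inv c)"
  moreover have "fst c \<inter> W = W" using assms by blast
  ultimately show "smooth_fun_on M W f"
    unfolding smooth_fun_on_def using assms(1,3) by (intro ballI bexI[of _ c]) auto
qed

lemma vector_field_in_chart:
  assumes "c \<in> M" "open W" "W \<subseteq> fst c" "smooth_on (snd c ` W) \<xi>"
    and "\<And>p. p \<in> W \<Longrightarrow> X p = tangent c p (\<xi> (snd c p))"
  shows "vector_field_on M W X"
proof -
  have W: "fst c \<inter> W = W" using assms by blast
  have "smooth_on (snd c ` W) (\<lambda>y. X (chart_inv c y) (\<lambda>q. snd c q \<bullet> b))" for b
    by (rule smooth_on_cong[OF smooth_on_component[OF open_image[OF assms(1-3)] assms(4), of b]])
      (use assms(3,5) chart_inv_left[OF assms(1)] tangent_coordinate[OF assms(1)] in \<open>auto simp: subset_iff\<close>)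
  then show ?thesis
    unfolding vector_field_on_def W using assms tangent_in_space[OF assms(1)]
    by (intro ballI conjI bexI[of _ c]) (auto simp: W)
qed

text \<open>
  The definition of a vector field allows a different chart at every point. In a fixed chart the
  components arise from those in another chart by multiplication with the Jacobian of the transition
  map, which is smooth, followed by composition with the transition map.
\<close>

lemma vector_field_components_smooth:
  assumes "c \<in> M" "open W" "W \<subseteq> fst c" "vector_field_on M W X"
  shows "smooth_on (snd c ` W) (\<lambda>y. components c (X (chart_inv c y)))"
proof (rule smooth_on_local)
  show "open (snd c ` W)" using open_image assms by blast
  fix y assume "y \<in> snd c ` W"
  then obtain p where p: "p \<in> W" "y = snd c p" by blast
  then obtain d where d: "d \<in> M" "p \<in> fst d"
    "\<And>b. b \<in> Basis \<Longrightarrow> smooth_on (snd d ` (fst d \<inter> W)) (\<lambda>y. X (chart_inv d y) (\<lambda>q. snd d q \<bullet> b))"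
    using assms(4) unfolding vector_field_on_def by blast
  let ?T = "snd c ` (fst c \<inter> fst d \<inter> W)" and ?Td = "snd d ` (fst c \<inter> fst d \<inter> W)"
  let ?\<eta> = "\<lambda>z. components d (X (chart_inv d z))"
  let ?J = "\<lambda>z. frechet_derivative (snd c \<circ> chart_inv d) (at z)"
  let ?\<theta> = "\<lambda>z. \<Sum>b\<in>Basis. (?\<eta> z \<bullet> b) *\<^sub>R ?J z b"
  have T: "open ?T" by (intro open_image open_Int open_chart assms d) auto
  have Td: "open ?Td" by (intro open_image open_Int open_chart assms d) auto
  have comp: "smooth_on ?Td (\<lambda>z. ?\<eta> z \<bullet> b)" if "b \<in> Basis" for b
    unfolding components_inner[OF that] by (rule smooth_on_subset[OF d(3)[OF that]]) auto
  have tr: "smooth_on ?Td (\<lambda>z. ?J z b)" for b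
    by (rule smooth_on_derivative(2)[OF Td])
      (rule smooth_on_subset[OF smooth_transition[OF d(1) assms(1)]], auto)
  have \<theta>: "smooth_on ?Td ?\<theta>"
    by (intro smooth_on_sum[OF Td] smooth_on_bilinear[OF bounded_bilinear_scaleR Td] comp tr)
  have "smooth_on ?T (\<lambda>z. ?\<theta> ((snd d \<circ> chart_inv c) z))"
  proof (rule smooth_on_compose[OF T Td _ \<theta>, where f = "snd d \<circ> chart_inv c"])
    show "smooth_on ?T (snd d \<circ> chart_inv c)"
      by (rule smooth_on_subset[OF smooth_transition[OF assms(1) d(1)]]) auto
    show "(snd d \<circ> chart_inv c) ` ?T \<subseteq> ?Td"
      using chart_inv_left[OF assms(1)] by auto
  qed
  then have "smooth_on ?T (\<lambda>y. components c (X (chart_inv c y)))"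
  proof (rule smooth_on_cong)
    fix z assume "z \<in> ?T"
    then obtain q where q: "q \<in> fst c" "q \<in> fst d" "q \<in> W" "z = snd c q" by blast
    have "X q \<in> tangent_space M q" using assms(4) q(3) by (simp add: vector_field_on_def)
    then have "X q = tangent d q (?\<eta> (snd d q))"
      using tangent_components[OF d(1) q(2)] chart_inv_left[OF d(1) q(2)] by simp
    then have "X q = tangent c q (?J (snd d q) (?\<eta> (snd d q)))"
      using tangent_change_chart[OF d(1) assms(1) q(2,1)] by simp
    then have "components c (X q) = ?J (snd d q) (?\<eta> (snd d q))"
      using components_tangent[OF assms(1) q(1)] by simp
    also have "\<dots> = ?\<theta> (snd d q)"
      by (rule linear_sum_Basis, rule has_derivative_linear, rule has_derivative_transition)
        (use q d assms in auto)
    finally show "?\<theta> ((snd d \<circ> chart_inv c) z) = components c (X (chart_inv c z))"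
      using q chart_inv_left[OF assms(1) q(1)] by simp
  qed
  then show "\<exists>T. open T \<and> y \<in> T \<and> smooth_on T (\<lambda>y. components c (X (chart_inv c y)))"
    using T p d assms by (intro exI[of _ ?T]) auto
qed

end

context manifold
begin

text \<open>
  The restricted chart is compatible with the whole atlas, so it lies in the atlas by maximality.
\<close>

lemma restrict_chart:
  assumes "c \<in> M" "open W"
  shows "(fst c \<inter> W, snd c) \<in> M"
proof -
  let ?c = "(fst c \<inter> W, snd c)"
  have inv: "chart_inv ?c y = chart_inv c y" if "y \<in> snd c ` (fst c \<inter> W)" for y
  proof -
    have "inj_on (snd c) (fst c)" using chart_inv_left[OF assms(1)] by (metis inj_onI)
    then have "inj_on (snd c) (fst c \<inter> W)" by (rule inj_on_subset) simp
    then have "chart_inv ?c (snd c p) = p" if "p \<in> fst c \<inter> W" for p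
      using that by (simp add: chart_inv_def)
    then show ?thesis using that chart_inv_left[OF assms(1)] by auto
  qed
  have op: "open (fst c \<inter> W)" using open_chart[OF assms(1)] assms(2) by blast
  have "is_chart c" using assms(1) smooth_structure by (simp add: smooth_structure_def)
  then obtain \<psi> where "homeomorphism (fst c) (snd c ` fst c) (snd c) \<psi>" unfolding is_chart_def by blast
  then have "homeomorphism (fst c \<inter> W) (snd c ` (fst c \<inter> W)) (snd c) \<psi>"
    by (rule homeomorphism_of_subsets) auto
  then have "is_chart ?c"
    unfolding is_chart_def using op open_image[OF assms(1) op] by auto
  moreover have "compatible_charts ?c d" if d: "d \<in> M" for d
  proof -
    have "smooth_on (snd c ` (fst c \<inter> W \<inter> fst d)) (snd d \<circ> chart_inv ?c)"
      by (rule smooth_on_cong[OF smooth_on_subset[OF smooth_transition[OF assms(1) d]]]) (auto simp: inv)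
    moreover have "smooth_on (snd d ` (fst c \<inter> W \<inter> fst d)) (snd c \<circ> chart_inv d)"
      by (rule smooth_on_subset[OF smooth_transition[OF d assms(1)]]) auto
    ultimately show ?thesis by (simp add: compatible_charts_def)
  qed
  ultimately show ?thesis using smooth_structure unfolding smooth_structure_def by blast
qed

lemma coord_field_is_vector_field:
  assumes "c \<in> M"
  shows "vector_field_on M (fst c) (coord_field c u)"
  by (rule vector_field_in_chart[OF assms open_chart[OF assms] subset_refl
        smooth_on_const[OF open_chart_image[OF assms]]]) (simp add: coord_field_def)

end

section \<open>Connections and Ricci curvature in a chart\<close>

text \<open>
  The axioms are stated for fields on open subsets, so they pass to smaller domains. This allows the
  whole computation to take place inside one chart.
\<close>

lemma affine_connection_on_subset:
  assumes "affine_connection_on M S nab" "T \<subseteq> S"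
  shows "affine_connection_on M T nab"
  unfolding affine_connection_on_def
proof (rule allI, rule allI, rule impI)
  fix W X assume "open W \<and> W \<subseteq> T \<and> vector_field_on M W X"
  then have "open W \<and> W \<subseteq> S \<and> vector_field_on M W X" using assms(2) by blast
  then show "(\<forall>Y. vector_field_on M W Y \<longrightarrow> vector_field_on M W (\<lambda>p. nab p (Y p) X)) \<and>
        (\<forall>p\<in>W. \<forall>w\<in>tangent_space M p.
           nab p w X \<in> tangent_space M p \<and>
           (\<forall>a. \<forall>w'\<in>tangent_space M p.
              nab p (\<lambda>f. a * w f + w' f) X = (\<lambda>f. a * nab p w X f + nab p w' X f)) \<and>
           (\<forall>Y. vector_field_on M W Y \<longrightarrow>
              nab p w (\<lambda>q f. X q f + Y q f) = (\<lambda>f. nab p w X f + nab p w Y f)) \<and>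
           (\<forall>\<phi>. smooth_fun_on M W \<phi> \<longrightarrow>
              nab p w (\<lambda>q f. \<phi> q * X q f) = (\<lambda>f. w \<phi> * X p f + \<phi> p * nab p w X f)) \<and>
           (\<forall>Y. (\<forall>q\<in>W. Y q = X q) \<longrightarrow> nab p w Y = nab p w X))"
    by (rule assms(1)[unfolded affine_connection_on_def, THEN spec, THEN spec, THEN mp])
qed

lemma levi_civita_on_subset:
  assumes "levi_civita_on M S g nab" "T \<subseteq> S"
  shows "levi_civita_on M T g nab"
  unfolding levi_civita_on_def
proof (rule conjI, rule affine_connection_on_subset[OF _ assms(2)])
  show "affine_connection_on M S nab" using assms(1) unfolding levi_civita_on_def by (rule conjunct1)
  show "\<forall>W X Y. open W \<and> W \<subseteq> T \<and> vector_field_on M W X \<and> vector_field_on M W Y \<longrightarrow>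
        (\<forall>p\<in>W.
           (\<forall>f. smooth_fun_on M W f \<longrightarrow>
              nab p (X p) Y f - nab p (Y p) X f = X p (\<lambda>q. Y q f) - Y p (\<lambda>q. X q f)) \<and>
           (\<forall>w\<in>tangent_space M p.
              w (\<lambda>q. g q (X q) (Y q)) = g p (nab p w X) (Y p) + g p (X p) (nab p w Y)))"
  proof (rule allI, rule allI, rule allI, rule impI)
    fix W X Y assume "open W \<and> W \<subseteq> T \<and> vector_field_on M W X \<and> vector_field_on M W Y"
    then have "open W \<and> W \<subseteq> S \<and> vector_field_on M W X \<and> vector_field_on M W Y" using assms(2) by blast
    then show "\<forall>p\<in>W.
           (\<forall>f. smooth_fun_on M W f \<longrightarrow>
              nab p (X p) Y f - nab p (Y p) X f = X p (\<lambda>q. Y q f) - Y p (\<lambda>q. X q f)) \<and>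
           (\<forall>w\<in>tangent_space M p.
              w (\<lambda>q. g q (X q) (Y q)) = g p (nab p w X) (Y p) + g p (X p) (nab p w Y))"
      by (rule conjunct2[OF assms(1)[unfolded levi_civita_on_def], THEN spec, THEN spec, THEN spec, THEN mp])
  qed
qed

text \<open>
  A connection on an open set \<open>S\<close> contained in the domain of a single chart, so that every vector field
  on \<open>S\<close> is given by one smooth map.
\<close>

locale chart_connection = manifold M
  for M :: "('p::{t2_space, second_countable_topology}, 'v::euclidean_space) chart set" +
  fixes c :: "('p, 'v) chart" and S :: "'p set"
    and nab :: "'p \<Rightarrow> 'p tvec \<Rightarrow> ('p \<Rightarrow> 'p tvec) \<Rightarrow> 'p tvec"
  assumes c: "c \<in> M" and open_S: "open S" and S_subset: "S \<subseteq> fst c"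
    and connection: "affine_connection_on M S nab"
begin

lemma in_chart: "p \<in> S \<Longrightarrow> p \<in> fst c"
  using S_subset by blast

lemma open_coords: "open (snd c ` S)"
  by (rule open_image[OF c open_S S_subset])

lemma inv_coords: "p \<in> S \<Longrightarrow> chart_inv c (snd c p) = p"
  by (rule chart_inv_left[OF c in_chart])

lemma vector_fieldI:
  assumes "smooth_on (snd c ` S) \<xi>" "\<And>p. p \<in> S \<Longrightarrow> X p = tangent c p (\<xi> (snd c p))"
  shows "vector_field_on M S X"
  by (rule vector_field_in_chart[OF c open_S S_subset assms])

lemma coord_field_vector_field: "vector_field_on M S (coord_field c v)"
  by (rule vector_fieldI[OF smooth_on_const[OF open_coords]]) (simp add: coord_field_def)

lemma has_derivative_germ:
  assumes "p \<in> S" "(\<phi> has_derivative \<phi>') (at (snd c p))" "\<And>q. q \<in> S \<Longrightarrow> f q = \<phi> (snd c q)"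
  shows "(f \<circ> chart_inv c has_derivative \<phi>') (at (snd c p))"
  by (rule has_derivative_transform_within_open[OF assms(2) open_coords])
    (use assms(1,3) inv_coords in auto)

lemma tangent_germ:
  assumes "p \<in> S" "(\<phi> has_derivative \<phi>') (at (snd c p))" "\<And>q. q \<in> S \<Longrightarrow> f q = \<phi> (snd c q)"
  shows "tangent c p a f = \<phi>' a"
  by (rule tangent_eqI[OF has_derivative_germ[OF assms]])

lemma
  assumes "vector_field_on M S X"
  shows nab_vector_field: "vector_field_on M S Y \<Longrightarrow> vector_field_on M S (\<lambda>p. nab p (Y p) X)"
    and nab_in_tangent_space: "p \<in> S \<Longrightarrow> w \<in> tangent_space M p \<Longrightarrow> nab p w X \<in> tangent_space M p"
    and nab_add: "p \<in> S \<Longrightarrow> w \<in> tangent_space M p \<Longrightarrow> vector_field_on M S Y \<Longrightarrow>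
      nab p w (\<lambda>q f. X q f + Y q f) = (\<lambda>f. nab p w X f + nab p w Y f)"
    and nab_leibniz: "p \<in> S \<Longrightarrow> w \<in> tangent_space M p \<Longrightarrow> smooth_fun_on M S \<phi> \<Longrightarrow>
      nab p w (\<lambda>q f. \<phi> q * X q f) = (\<lambda>f. w \<phi> * X p f + \<phi> p * nab p w X f)"
    and nab_cong: "p \<in> S \<Longrightarrow> w \<in> tangent_space M p \<Longrightarrow> (\<And>q. q \<in> S \<Longrightarrow> Y q = X q) \<Longrightarrow>
      nab p w Y = nab p w X"
proof -
  have *: "(\<forall>Y. vector_field_on M S Y \<longrightarrow> vector_field_on M S (\<lambda>p. nab p (Y p) X)) \<and>
        (\<forall>p\<in>S. \<forall>w\<in>tangent_space M p.
           nab p w X \<in> tangent_space M p \<and>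
           (\<forall>a. \<forall>w'\<in>tangent_space M p.
              nab p (\<lambda>f. a * w f + w' f) X = (\<lambda>f. a * nab p w X f + nab p w' X f)) \<and>
           (\<forall>Y. vector_field_on M S Y \<longrightarrow>
              nab p w (\<lambda>q f. X q f + Y q f) = (\<lambda>f. nab p w X f + nab p w Y f)) \<and>
           (\<forall>\<phi>. smooth_fun_on M S \<phi> \<longrightarrow>
              nab p w (\<lambda>q f. \<phi> q * X q f) = (\<lambda>f. w \<phi> * X p f + \<phi> p * nab p w X f)) \<and>
           (\<forall>Y. (\<forall>q\<in>S. Y q = X q) \<longrightarrow> nab p w Y = nab p w X))"
    using connection[unfolded affine_connection_on_def, rule_format, of S X] open_S assms by blast
  show "vector_field_on M S Y \<Longrightarrow> vector_field_on M S (\<lambda>p. nab p (Y p) X)"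
    using * by blast
  assume p: "p \<in> S" "w \<in> tangent_space M p"
  note ** = bspec[OF bspec[OF conjunct2[OF *] p(1)] p(2)]
  show "nab p w X \<in> tangent_space M p"
    using ** by blast
  show "vector_field_on M S Y \<Longrightarrow> nab p w (\<lambda>q f. X q f + Y q f) = (\<lambda>f. nab p w X f + nab p w Y f)"
    using ** by blast
  show "smooth_fun_on M S \<phi> \<Longrightarrow>
      nab p w (\<lambda>q f. \<phi> q * X q f) = (\<lambda>f. w \<phi> * X p f + \<phi> p * nab p w X f)"
    using ** by blast
  show "(\<And>q. q \<in> S \<Longrightarrow> Y q = X q) \<Longrightarrow> nab p w Y = nab p w X"
    using ** by blast
qed

definition christoffel :: "'v \<Rightarrow> 'v \<Rightarrow> 'v \<Rightarrow> 'v" where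
  "christoffel y a v =
     components c (nab (chart_inv c y) (tangent c (chart_inv c y) a) (coord_field c v))"

lemma tangent_in_tangent_space: "p \<in> S \<Longrightarrow> tangent c p v \<in> tangent_space M p"
  by (rule tangent_in_space[OF c in_chart])

lemma nab_coord_field:
  assumes "p \<in> S"
  shows "nab p (tangent c p a) (coord_field c v) = tangent c p (christoffel (snd c p) a v)"
  unfolding christoffel_def inv_coords[OF assms]
  by (rule tangent_components[OF c in_chart[OF assms], symmetric])
    (rule nab_in_tangent_space[OF coord_field_vector_field assms tangent_in_tangent_space[OF assms]])

text \<open>
  Additivity and the Leibniz rule, applied term by term to a combination of coordinate fields. The
  empty sum uses the Leibniz rule with the zero function.
\<close>

lemma nab_coord_sum:
  fixes \<phi> :: "'v \<Rightarrow> 'v \<Rightarrow> real"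
  assumes p: "p \<in> S" and "finite I" and \<phi>: "\<And>b. b \<in> I \<Longrightarrow> smooth_on (snd c ` S) (\<phi> b)"
  shows "nab p (tangent c p a) (\<lambda>q. tangent c q (\<Sum>b\<in>I. \<phi> b (snd c q) *\<^sub>R b)) =
    tangent c p (\<Sum>b\<in>I. frechet_derivative (\<phi> b) (at (snd c p)) a *\<^sub>R b +
      \<phi> b (snd c p) *\<^sub>R christoffel (snd c p) a b)"
  using assms(2) \<phi>
proof (induction I rule: finite_induct)
  case empty
  have "smooth_fun_on M S (\<lambda>q. 0)"
    unfolding smooth_fun_on_chart_iff[OF c open_S S_subset] o_def
    by (rule smooth_on_const[OF open_coords])
  note nab_leibniz[OF coord_field_vector_field p tangent_in_tangent_space[OF p] this, of a 0]
  moreover have "tangent c p a (\<lambda>q. 0) = 0"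
    by (rule tangent_germ[OF p, where \<phi> = "\<lambda>y. 0" and \<phi>' = "\<lambda>y. 0"]) auto
  ultimately show ?case by (simp add: tangent_zero)
next
  case (insert b I)
  let ?X = "\<lambda>q f. \<phi> b (snd c q) * coord_field c b q f"
  let ?Y = "\<lambda>q. tangent c q (\<Sum>b\<in>I. \<phi> b (snd c q) *\<^sub>R b)"
  have sm: "smooth_on (snd c ` S) (\<phi> b)" using insert by simp
  have sf: "smooth_fun_on M S (\<lambda>q. \<phi> b (snd c q))"
    unfolding smooth_fun_on_chart_iff[OF c open_S S_subset]
    by (rule smooth_on_cong[OF sm]) (use inv_coords in auto)
  have X: "vector_field_on M S ?X"
  proof (rule vector_fieldI)
    show "smooth_on (snd c ` S) (\<lambda>y. \<phi> b y *\<^sub>R b)"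
      by (rule smooth_on_bilinear[OF bounded_bilinear_scaleR open_coords sm smooth_on_const[OF open_coords]])
  qed (simp add: coord_field_def tangent_scale)
  have Y: "vector_field_on M S ?Y"
  proof (rule vector_fieldI)
    show "smooth_on (snd c ` S) (\<lambda>y. \<Sum>b\<in>I. \<phi> b y *\<^sub>R b)"
      by (rule smooth_on_sum[OF open_coords], rule smooth_on_bilinear[OF bounded_bilinear_scaleR open_coords])
        (use insert.prems smooth_on_const[OF open_coords] in blast)+
  qed simp
  have D: "tangent c p a (\<lambda>q. \<phi> b (snd c q)) = frechet_derivative (\<phi> b) (at (snd c p)) a"
    by (rule tangent_germ[OF p smooth_on_derivative(1)[OF open_coords sm]]) (use p in auto)
  have "(\<lambda>q. tangent c q (\<Sum>b\<in>insert b I. \<phi> b (snd c q) *\<^sub>R b)) = (\<lambda>q f. ?X q f + ?Y q f)"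
    using insert.hyps by (simp add: tangent_add tangent_scale coord_field_def)
  then have "nab p (tangent c p a) (\<lambda>q. tangent c q (\<Sum>b\<in>insert b I. \<phi> b (snd c q) *\<^sub>R b)) =
      (\<lambda>f. nab p (tangent c p a) ?X f + nab p (tangent c p a) ?Y f)"
    using nab_add[OF X p tangent_in_tangent_space[OF p] Y] by simp
  moreover have "nab p (tangent c p a) ?Y = tangent c p (\<Sum>b\<in>I. frechet_derivative (\<phi> b) (at (snd c p)) a *\<^sub>R b +
      \<phi> b (snd c p) *\<^sub>R christoffel (snd c p) a b)"
    using insert by simp
  moreover have "nab p (tangent c p a) ?X = tangent c p (frechet_derivative (\<phi> b) (at (snd c p)) a *\<^sub>R b +
      \<phi> b (snd c p) *\<^sub>R christoffel (snd c p) a b)"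
    unfolding nab_leibniz[OF coord_field_vector_field p tangent_in_tangent_space[OF p] sf] D
      nab_coord_field[OF p] by (simp add: tangent_add tangent_scale coord_field_def)
  ultimately show ?case using insert.hyps by (simp add: tangent_add)
qed

lemma christoffel_sum:
  assumes "p \<in> S"
  shows "christoffel (snd c p) a v = (\<Sum>b\<in>Basis. (v \<bullet> b) *\<^sub>R christoffel (snd c p) a b)"
proof -
  have "tangent c p (christoffel (snd c p) a v) = tangent c p (\<Sum>b\<in>Basis. (v \<bullet> b) *\<^sub>R christoffel (snd c p) a b)"
    using nab_coord_sum[where \<phi> = "\<lambda>b y. v \<bullet> b" and a = a,
        OF assms finite_Basis smooth_on_const[OF open_coords]] nab_coord_field[OF assms, of a v]
    by (simp add: euclidean_representation coord_field_def[abs_def])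
  then show ?thesis using tangent_inject[OF c in_chart[OF assms]] by blast
qed

lemma christoffel_linear_right:
  assumes "p \<in> S"
  shows "linear (christoffel (snd c p) a)"
proof -
  have "linear (\<lambda>v. \<Sum>b\<in>Basis. (v \<bullet> b) *\<^sub>R christoffel (snd c p) a b)"
    by (intro linearI) (simp_all add: inner_add_left scaleR_add_left sum.distrib scaleR_sum_right)
  moreover have "christoffel (snd c p) a = (\<lambda>v. \<Sum>b\<in>Basis. (v \<bullet> b) *\<^sub>R christoffel (snd c p) a b)"
    by (rule ext) (rule christoffel_sum[OF assms])
  ultimately show ?thesis by (rule ssubst[rotated])
qed

text \<open>
  A connection maps smooth fields to smooth fields.
\<close>

lemma christoffel_smooth: "smooth_on (snd c ` S) (\<lambda>y. christoffel y a v)"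
proof -
  have "vector_field_on M S (\<lambda>p. nab p (coord_field c a p) (coord_field c v))"
    by (rule nab_vector_field[OF coord_field_vector_field coord_field_vector_field])
  from vector_field_components_smooth[OF c open_S S_subset this]
  show ?thesis by (simp add: christoffel_def coord_field_def)
qed

text \<open>
  The classical formula \<open>\<nabla>\<^sub>a \<xi> = D\<xi>(a) + \<Gamma>(a,\<xi>)\<close>.
\<close>

lemma nab_in_chart:
  assumes p: "p \<in> S" and \<xi>: "smooth_on (snd c ` S) \<xi>"
    and X: "\<And>q. q \<in> S \<Longrightarrow> X q = tangent c q (\<xi> (snd c q))"
  shows "nab p (tangent c p a) X =
    tangent c p (frechet_derivative \<xi> (at (snd c p)) a + christoffel (snd c p) a (\<xi> (snd c p)))"
proof -
  have d\<xi>: "(\<xi> has_derivative frechet_derivative \<xi> (at (snd c p))) (at (snd c p))"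
    by (rule smooth_on_derivative(1)[OF open_coords \<xi>]) (use p in auto)
  have "frechet_derivative (\<lambda>y. \<xi> y \<bullet> b) (at (snd c p)) a = frechet_derivative \<xi> (at (snd c p)) a \<bullet> b" for b
    using frechet_derivative_at[OF has_derivative_inner_left[OF d\<xi>, of b]] by metis
  then have "nab p (tangent c p a) (\<lambda>q. tangent c q (\<xi> (snd c q))) =
    tangent c p (frechet_derivative \<xi> (at (snd c p)) a +
      (\<Sum>b\<in>Basis. (\<xi> (snd c p) \<bullet> b) *\<^sub>R christoffel (snd c p) a b))"
    using nab_coord_sum[OF p finite_Basis, of "\<lambda>b y. \<xi> y \<bullet> b" a] smooth_on_component[OF open_coords \<xi>]
    by (simp add: euclidean_representation sum.distrib)
  moreover have "nab p (tangent c p a) X = nab p (tangent c p a) (\<lambda>q. tangent c q (\<xi> (snd c q)))"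
    by (rule nab_cong[OF vector_fieldI[OF \<xi>]]) (use X p tangent_in_tangent_space in auto)
  ultimately show ?thesis
    by (simp only: christoffel_sum[OF p, of a "\<xi> (snd c p)", symmetric])
qed

lemma ricci_in_chart:
  assumes "p \<in> S"
  shows "ricci c nab p u v = (\<Sum>b\<in>Basis.
    (frechet_derivative (\<lambda>y. christoffel y u v) (at (snd c p)) b
      + christoffel (snd c p) b (christoffel (snd c p) u v)
      - frechet_derivative (\<lambda>y. christoffel y b v) (at (snd c p)) u
      - christoffel (snd c p) u (christoffel (snd c p) b v)) \<bullet> b)"
proof -
  have "nab p (tangent c p a) (\<lambda>q. nab q (tangent c q u) (coord_field c v)) =
    tangent c p (frechet_derivative (\<lambda>y. christoffel y u v) (at (snd c p)) a
      + christoffel (snd c p) a (christoffel (snd c p) u v))" for a u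
    by (rule nab_in_chart[OF assms christoffel_smooth nab_coord_field])
  then show ?thesis
    unfolding ricci_def curvature_def
    by (simp add: tangent_coordinate[OF c in_chart[OF assms]] inner_diff_left inner_add_left algebra_simps)
qed

end

locale chart_levi_civita = chart_connection M c S nab
  for M :: "('p::{t2_space, second_countable_topology}, 'v::euclidean_space) chart set"
    and c S nab +
  fixes g :: "'p \<Rightarrow> 'p tvec \<Rightarrow> 'p tvec \<Rightarrow> real"
  assumes levi_civita: "levi_civita_on M S g nab"
begin

definition gram :: "'v \<Rightarrow> 'v \<Rightarrow> 'v \<Rightarrow> real" where
  "gram y u v = g (chart_inv c y) (tangent c (chart_inv c y) u) (tangent c (chart_inv c y) v)"

lemma
  assumes "vector_field_on M S X" "vector_field_on M S Y" "p \<in> S"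
  shows torsion_free: "smooth_fun_on M S f \<Longrightarrow>
      nab p (X p) Y f - nab p (Y p) X f = X p (\<lambda>q. Y q f) - Y p (\<lambda>q. X q f)"
    and compatible: "w \<in> tangent_space M p \<Longrightarrow>
      w (\<lambda>q. g q (X q) (Y q)) = g p (nab p w X) (Y p) + g p (X p) (nab p w Y)"
proof -
  have *: "\<forall>p\<in>S.
           (\<forall>f. smooth_fun_on M S f \<longrightarrow>
              nab p (X p) Y f - nab p (Y p) X f = X p (\<lambda>q. Y q f) - Y p (\<lambda>q. X q f)) \<and>
           (\<forall>w\<in>tangent_space M p.
              w (\<lambda>q. g q (X q) (Y q)) = g p (nab p w X) (Y p) + g p (X p) (nab p w Y))"
    using conjunct2[OF levi_civita[unfolded levi_civita_on_def], rule_format, of S X Y] assms open_S by blast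
  show "smooth_fun_on M S f \<Longrightarrow>
      nab p (X p) Y f - nab p (Y p) X f = X p (\<lambda>q. Y q f) - Y p (\<lambda>q. X q f)"
    using * assms(3) by blast
  show "w \<in> tangent_space M p \<Longrightarrow>
      w (\<lambda>q. g q (X q) (Y q)) = g p (nab p w X) (Y p) + g p (X p) (nab p w Y)"
    using * assms(3) by blast
qed

text \<open>
  Coordinate fields commute, so the absence of torsion means symmetry of the Christoffel symbols.
\<close>

lemma christoffel_symmetric:
  assumes p: "p \<in> S"
  shows "christoffel (snd c p) u v = christoffel (snd c p) v u"
proof (rule euclidean_eqI)
  fix b :: 'v
  let ?f = "\<lambda>q. snd c q \<bullet> b"
  have f: "smooth_fun_on M S ?f"
    unfolding smooth_fun_on_chart_iff[OF c open_S S_subset]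
    by (rule smooth_on_cong[OF smooth_on_bounded_linear[OF open_coords bounded_linear_inner_left[of b]]])
      (use inv_coords in auto)
  have "tangent c p a (\<lambda>q. coord_field c v q ?f) = 0" for a v
    by (rule tangent_germ[OF p has_derivative_const[where c = "v \<bullet> b"]])
      (simp add: coord_field_def tangent_coordinate[OF c in_chart])
  then have "nab p (tangent c p u) (coord_field c v) ?f = nab p (tangent c p v) (coord_field c u) ?f"
    using torsion_free[OF coord_field_vector_field coord_field_vector_field p f, of u v]
    by (simp add: coord_field_def)
  then show "christoffel (snd c p) u v \<bullet> b = christoffel (snd c p) v u \<bullet> b"
    by (simp add: nab_coord_field[OF p] tangent_coordinate[OF c in_chart[OF p]])
qed

text \<open>
  Metric compatibility in coordinates. Differentiability of the inner product is a hypothesis because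
  tangent vectors are \<open>0\<close> on functions that are not differentiable.
\<close>

lemma gram_derivative:
  assumes p: "p \<in> S" and \<xi>: "smooth_on (snd c ` S) \<xi>" and \<eta>: "smooth_on (snd c ` S) \<eta>"
    and G: "((\<lambda>y. gram y (\<xi> y) (\<eta> y)) has_derivative G') (at (snd c p))"
  shows "G' a =
    gram (snd c p) (frechet_derivative \<xi> (at (snd c p)) a + christoffel (snd c p) a (\<xi> (snd c p))) (\<eta> (snd c p)) +
    gram (snd c p) (\<xi> (snd c p)) (frechet_derivative \<eta> (at (snd c p)) a + christoffel (snd c p) a (\<eta> (snd c p)))"
proof -
  let ?X = "\<lambda>q. tangent c q (\<xi> (snd c q))" and ?Y = "\<lambda>q. tangent c q (\<eta> (snd c q))"
  have "tangent c p a (\<lambda>q. g q (?X q) (?Y q)) = G' a"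
    by (rule tangent_germ[OF p G]) (simp add: gram_def inv_coords)
  then show ?thesis
    using compatible[OF vector_fieldI[OF \<xi> refl] vector_fieldI[OF \<eta> refl] p tangent_in_tangent_space[OF p], of a]
    by (simp add: nab_in_chart[OF p \<xi> refl] nab_in_chart[OF p \<eta> refl] gram_def inv_coords[OF p])
qed

end

section \<open>The radially warped metric in coordinates\<close>

text \<open>
  The derivative of a function in the direction of the Euler field \<open>(0,x)\<close> at \<open>z = (y,x)\<close> is a
  derivative in one real variable, along the ray \<open>t \<mapsto> (y, t x)\<close>.
\<close>

lemma fibre_ray_derivative:
  fixes F :: "'a::real_normed_vector \<times> 'b::real_normed_vector \<Rightarrow> 'c::real_normed_vector"
  assumes "(F has_derivative F') (at z)" "(f has_vector_derivative D) (at 1)"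
    and "\<And>t. 0 < t \<Longrightarrow> F (fst z, t *\<^sub>R snd z) = f t"
  shows "F' (0, snd z) = D"
proof -
  have "((\<lambda>t. (fst z, t *\<^sub>R snd z)) has_derivative (\<lambda>t. (0, t *\<^sub>R snd z))) (at (1::real))"
    by (auto intro!: derivative_eq_intros)
  moreover have "(F has_derivative F') (at ((\<lambda>t. (fst z, t *\<^sub>R snd z)) (1::real)))"
    using assms(1) by simp
  ultimately have "(F \<circ> (\<lambda>t. (fst z, t *\<^sub>R snd z)) has_derivative F' \<circ> (\<lambda>t. (0, t *\<^sub>R snd z))) (at (1::real))"
    by (rule diff_chain_at)
  then have "(f has_derivative F' \<circ> (\<lambda>t. (0, t *\<^sub>R snd z))) (at 1)"
    by (rule has_derivative_transform_within_open[of _ _ _ _ "{0<..}"]) (auto simp: assms(3))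
  moreover have "F' \<circ> (\<lambda>t. (0, t *\<^sub>R snd z)) = (\<lambda>t. t *\<^sub>R F' (0, snd z))"
    using linear_scale[OF has_derivative_linear[OF assms(1)], of _ "(0, snd z)"]
    by (simp add: fun_eq_iff)
  ultimately have "(f has_vector_derivative F' (0, snd z)) (at 1)"
    by (simp add: has_vector_derivative_def)
  then show ?thesis using assms(2) by (rule vector_derivative_unique_at)
qed

text \<open>
  The metric \<open>h\<^sup>2 \<beta> + k\<^sup>2 \<Sum>\<^sub>\<alpha> \<zeta>\<^sub>\<alpha>\<^sup>2\<close> in coordinates: \<open>\<beta> y\<close> is the base metric at \<open>y\<close>, and
  \<open>\<omega> y u x\<close> has components \<open>\<Sum>\<^sub>\<gamma> x\<^sub>\<gamma> \<omega>\<^sub>\<alpha>\<^sub>\<gamma>(u)\<close>, so it is skew in \<open>x\<close> for an orthonormal frame.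
  The region \<open>Z\<close> avoids the zero section.
\<close>

locale radial_metric =
  fixes h k :: "real \<Rightarrow> real"
    and \<beta> :: "real ^ 'n::finite \<Rightarrow> real ^ 'n \<Rightarrow> real ^ 'n \<Rightarrow> real"
    and \<omega> :: "real ^ 'n \<Rightarrow> real ^ 'n \<Rightarrow> real ^ 'm::finite \<Rightarrow> real ^ 'm"
    and Z :: "((real ^ 'n) \<times> (real ^ 'm)) set"
  assumes h_smooth: "smooth_on {0<..} h" and k_smooth: "smooth_on {0<..} k"
    and h_pos: "\<And>t. 0 < t \<Longrightarrow> 0 < h t" and k_pos: "\<And>t. 0 < t \<Longrightarrow> 0 < k t"
    and open_Z: "open Z" and Z_nonzero: "\<And>z. z \<in> Z \<Longrightarrow> snd z \<noteq> 0"
    and \<beta>_bilinear: "\<And>z. z \<in> Z \<Longrightarrow> bilinear (\<beta> (fst z))"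
    and \<beta>_symmetric: "\<And>z u v. z \<in> Z \<Longrightarrow> \<beta> (fst z) u v = \<beta> (fst z) v u"
    and \<beta>_positive: "\<And>z u. z \<in> Z \<Longrightarrow> u \<noteq> 0 \<Longrightarrow> 0 < \<beta> (fst z) u u"
    and \<omega>_linear: "\<And>z x. z \<in> Z \<Longrightarrow> linear (\<lambda>u. \<omega> (fst z) u x)"
    and \<omega>_linear_fibre: "\<And>z u. z \<in> Z \<Longrightarrow> linear (\<omega> (fst z) u)"
    and \<omega>_skew: "\<And>z u x. z \<in> Z \<Longrightarrow> \<omega> (fst z) u x \<bullet> x = 0"
begin

definition \<zeta> :: "(real ^ 'n) \<times> (real ^ 'm) \<Rightarrow> (real ^ 'n) \<times> (real ^ 'm) \<Rightarrow> real ^ 'm" where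
  "\<zeta> z u = snd u + \<omega> (fst z) (fst u) (snd z)"

definition G :: "(real ^ 'n) \<times> (real ^ 'm) \<Rightarrow> (real ^ 'n) \<times> (real ^ 'm) \<Rightarrow> (real ^ 'n) \<times> (real ^ 'm) \<Rightarrow> real" where
  "G z u v = (h (norm (snd z)))\<^sup>2 * \<beta> (fst z) (fst u) (fst v) + (k (norm (snd z)))\<^sup>2 * (\<zeta> z u \<bullet> \<zeta> z v)"

text \<open>
  The eigenvalues of \<open>\<nabla>R\<close> on horizontal vectors (\<open>\<mu>\<close>) and on vertical vectors (\<open>lam\<close>).
\<close>

definition \<mu> :: "real \<Rightarrow> real" where "\<mu> t = t * deriv h t / h t"
definition lam :: "real \<Rightarrow> real" where "lam t = 1 + t * deriv k t / k t"

abbreviation "\<nu> t \<equiv> lam t - \<mu> t"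

text \<open>
  This is \<open>\<mu> H + \<lambda> V\<close>, written as \<open>\<mu> + (\<lambda> - \<mu>) V\<close> because \<open>V u = (0, \<zeta> u)\<close> is the simpler of the two
  projections.
\<close>

definition A :: "(real ^ 'n) \<times> (real ^ 'm) \<Rightarrow> (real ^ 'n) \<times> (real ^ 'm) \<Rightarrow> (real ^ 'n) \<times> (real ^ 'm)" where
  "A z u = \<mu> (norm (snd z)) *\<^sub>R u + \<nu> (norm (snd z)) *\<^sub>R (0, \<zeta> z u)"

lemma \<zeta>_linear: "z \<in> Z \<Longrightarrow> linear (\<zeta> z)"
  unfolding \<zeta>_def
  by (intro linearI) (simp_all add: linear_add[OF \<omega>_linear] linear_scale[OF \<omega>_linear] algebra_simps)

lemma \<zeta>_vertical: "z \<in> Z \<Longrightarrow> \<zeta> z (0, x) = x"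
  unfolding \<zeta>_def using linear_0[OF \<omega>_linear] by simp

lemma inner_\<zeta>_fibre: "z \<in> Z \<Longrightarrow> snd z \<bullet> \<zeta> z u = snd z \<bullet> snd u"
  unfolding \<zeta>_def using \<omega>_skew by (simp add: inner_add_right inner_commute)

lemma G_linear: "z \<in> Z \<Longrightarrow> linear (\<lambda>u. G z u v)"
  unfolding G_def
  by (intro linearI) (simp_all add: linear_add[OF \<zeta>_linear] linear_scale[OF \<zeta>_linear]
      bilinear_ladd[OF \<beta>_bilinear] bilinear_lmul[OF \<beta>_bilinear] algebra_simps)

lemma G_symmetric: "z \<in> Z \<Longrightarrow> G z u v = G z v u"
  unfolding G_def using \<beta>_symmetric by (simp add: inner_commute)

lemma G_positive:
  assumes "z \<in> Z" "u \<noteq> 0"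
  shows "0 < G z u u"
proof -
  have r: "0 < norm (snd z)" using Z_nonzero assms by simp
  then have hk: "0 < (h (norm (snd z)))\<^sup>2" "0 < (k (norm (snd z)))\<^sup>2"
    using h_pos[OF r] k_pos[OF r] by auto
  show ?thesis
  proof (cases "fst u = 0")
    case True
    then have "\<zeta> z u \<noteq> 0" using \<zeta>_vertical[OF assms(1), of "snd u"] assms(2) by (metis prod.collapse zero_prod_def)
    then show ?thesis
      using True hk bilinear_lzero[OF \<beta>_bilinear[OF assms(1)]] by (simp add: G_def)
  next
    case False
    then have "0 < (h (norm (snd z)))\<^sup>2 * \<beta> (fst z) (fst u) (fst u)"
      using hk \<beta>_positive[OF assms(1)] by simp
    then show ?thesis unfolding G_def using hk by (simp add: add_pos_nonneg)
  qed
qed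

text \<open>
  Used to read off \<open>\<nabla>R\<close> from its inner products.
\<close>

lemma G_nondegenerate:
  assumes "z \<in> Z" "\<And>v. G z u v = G z w v"
  shows "u = w"
proof -
  have "G z (u - w) (u - w) = 0"
    using linear_diff[OF G_linear[OF assms(1), of "u - w"], of u w] assms(2) by simp
  then show ?thesis using G_positive[OF assms(1), of "u - w"] by force
qed

lemma G_A:
  assumes "z \<in> Z" and r: "r = norm (snd z)"
  shows "G z (A z u) v = h r * deriv h r * r * \<beta> (fst z) (fst u) (fst v)
    + (k r * deriv k r * r + (k r)\<^sup>2) * (\<zeta> z u \<bullet> \<zeta> z v)"
proof -
  have "0 < r" using Z_nonzero assms by simp
  then have *: "h r \<noteq> 0" "k r \<noteq> 0" using h_pos k_pos by force+
  have "\<zeta> z (A z u) = lam r *\<^sub>R \<zeta> z u" "fst (A z u) = \<mu> r *\<^sub>R fst u"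
    unfolding A_def r[symmetric]
    by (simp_all add: linear_add[OF \<zeta>_linear[OF assms(1)]] linear_scale[OF \<zeta>_linear[OF assms(1)]]
        linear_diff[OF \<zeta>_linear[OF assms(1)]] \<zeta>_vertical[OF assms(1)] algebra_simps)
  then have "G z (A z u) v = (h r)\<^sup>2 * \<mu> r * \<beta> (fst z) (fst u) (fst v) + (k r)\<^sup>2 * lam r * (\<zeta> z u \<bullet> \<zeta> z v)"
    by (simp add: G_def r[symmetric] bilinear_lmul[OF \<beta>_bilinear[OF assms(1)]])
  moreover have "(h r)\<^sup>2 * \<mu> r = h r * deriv h r * r" "(k r)\<^sup>2 * lam r = k r * deriv k r * r + (k r)\<^sup>2"
    using * by (simp_all add: \<mu>_def lam_def power2_eq_square field_simps)
  ultimately show ?thesis by simp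
qed

text \<open>
  Since \<open>\<omega>\<close> is skew, the 1-form dual to the Euler field is \<open>k\<^sup>2 r dr\<close>: the connection form drops out.
\<close>

lemma G_radial:
  assumes "z \<in> Z"
  shows "G z (0, snd z) v = (k (norm (snd z)))\<^sup>2 * (snd z \<bullet> snd v)"
  unfolding G_def using \<zeta>_vertical[OF assms] inner_\<zeta>_fibre[OF assms]
    bilinear_lzero[OF \<beta>_bilinear[OF assms]] by simp

lemma trace_vertical:
  assumes "z \<in> Z"
  shows "endo_trace (\<lambda>b. (0, \<zeta> z b)) = real CARD('m)"
    and "endo_trace (\<lambda>b. (0, snd b) :: (real ^ 'n) \<times> (real ^ 'm)) = real CARD('m)"
    and "endo_trace (\<lambda>b. (0, \<omega> (fst z) (fst b) (snd z))) = 0"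
  using linear_0[OF \<omega>_linear[OF assms]]
  by (simp_all add: sum_Basis_prod \<zeta>_def inner_add_left)

lemma \<mu>_smooth: "smooth_on {0<..} \<mu>" and lam_smooth: "smooth_on {0<..} lam"
proof -
  have o: "open {0::real<..}" by simp
  have quot: "smooth_on {0<..} (\<lambda>t. t * deriv f t / f t)"
    if "smooth_on {0<..} f" "\<And>t. 0 < t \<Longrightarrow> 0 < f t" for f :: "real \<Rightarrow> real"
  proof -
    have "smooth_on {0<..} (\<lambda>t. inverse (f t))"
      by (rule smooth_on_compose[OF o _ that(1) smooth_onI[OF _ Ck_on_inverse]]) (use that(2) in force)+
    then have "smooth_on {0<..} (\<lambda>t. t * deriv f t * inverse (f t))"
      by (intro smooth_on_bilinear[OF bounded_bilinear_mult o] smooth_on_real_deriv(2)[OF o that(1)]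
          smooth_on_bounded_linear[OF o bounded_linear_ident])
    then show ?thesis by (simp add: divide_inverse)
  qed
  show "smooth_on {0<..} \<mu>" unfolding \<mu>_def by (rule quot[OF h_smooth h_pos])
  have "smooth_on {0<..} (\<lambda>t. 1 + t * deriv k t / k t)"
    by (rule smooth_onI[OF o], rule Ck_on_add[OF o Ck_on_const[OF o]], rule smooth_onD[OF o quot[OF k_smooth k_pos]])
  then show "smooth_on {0<..} lam" unfolding lam_def .
qed

end

text \<open>
  The Levi-Civita axioms as they appear in coordinates: symmetry of \<open>\<Gamma>\<close> is the absence of torsion, and
  \<open>G_derivative\<close> is metric compatibility, for moving fields because it is applied to the Euler field.
\<close>

locale radial_levi_civita = radial_metric h k \<beta> \<omega> Z
  for h k :: "real \<Rightarrow> real"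
    and \<beta> :: "real ^ 'n::finite \<Rightarrow> real ^ 'n \<Rightarrow> real ^ 'n \<Rightarrow> real"
    and \<omega> :: "real ^ 'n \<Rightarrow> real ^ 'n \<Rightarrow> real ^ 'm::finite \<Rightarrow> real ^ 'm"
    and Z +
  fixes \<Gamma> :: "(real ^ 'n) \<times> (real ^ 'm) \<Rightarrow> (real ^ 'n) \<times> (real ^ 'm) \<Rightarrow>
    (real ^ 'n) \<times> (real ^ 'm) \<Rightarrow> (real ^ 'n) \<times> (real ^ 'm)"
  assumes \<Gamma>_symmetric: "\<And>z u v. z \<in> Z \<Longrightarrow> \<Gamma> z u v = \<Gamma> z v u"
    and \<Gamma>_linear: "\<And>z u. z \<in> Z \<Longrightarrow> linear (\<Gamma> z u)"
    and \<Gamma>_smooth: "\<And>u v. smooth_on Z (\<lambda>z. \<Gamma> z u v)"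
    and G_differentiable: "\<And>z u v. z \<in> Z \<Longrightarrow> (\<lambda>z. G z u v) differentiable (at z)"
    and G_derivative: "\<And>\<xi> \<eta> G' z a. z \<in> Z \<Longrightarrow> smooth_on Z \<xi> \<Longrightarrow> smooth_on Z \<eta> \<Longrightarrow>
      ((\<lambda>z. G z (\<xi> z) (\<eta> z)) has_derivative G') (at z) \<Longrightarrow>
      G' a = G z (frechet_derivative \<xi> (at z) a + \<Gamma> z a (\<xi> z)) (\<eta> z)
        + G z (\<xi> z) (frechet_derivative \<eta> (at z) a + \<Gamma> z a (\<eta> z))"
begin

lemma bounded_linear_radial: "bounded_linear (\<lambda>z::(real ^ 'n) \<times> (real ^ 'm). (0 :: real ^ 'n, snd z))"
  by (intro bounded_linear_Pair bounded_linear_zero bounded_linear_snd)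

lemma frechet_derivative_radial:
  "frechet_derivative (\<lambda>z::(real ^ 'n) \<times> (real ^ 'm). (0 :: real ^ 'n, snd z)) (at z) a = (0, snd a)"
  using frechet_derivative_at[OF bounded_linear_imp_has_derivative[OF bounded_linear_radial], of z] by metis

text \<open>
  The antisymmetric part of \<open>\<nabla>R\<close> is half the exterior derivative of \<open>k\<^sup>2 r dr\<close>, hence zero.
\<close>

lemma nabla_radial_alternating:
  assumes "z \<in> Z"
  shows "G z ((0, snd u) + \<Gamma> z u (0, snd z)) v = G z ((0, snd v) + \<Gamma> z v (0, snd z)) u"
proof -
  let ?R = "\<lambda>z::(real ^ 'n) \<times> (real ^ 'm). (0 :: real ^ 'n, snd z)" and ?r = "norm (snd z)"
  have r: "0 < ?r" using Z_nonzero assms by simp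
  have *: "2 * k ?r * deriv k ?r * (snd a \<bullet> sgn (snd z)) * (snd z \<bullet> snd w) + (k ?r)\<^sup>2 * (snd a \<bullet> snd w) =
    G z ((0, snd a) + \<Gamma> z a (?R z)) w + G z (?R z) (\<Gamma> z a w)" for a w
  proof -
    have "(norm has_derivative (\<lambda>v. v \<bullet> sgn (snd z))) (at (snd z))"
      using has_derivative_norm Z_nonzero[OF assms] by blast
    then have "((\<lambda>z::(real ^ 'n) \<times> (real ^ 'm). norm (snd z)) has_derivative (\<lambda>a. snd a \<bullet> sgn (snd z))) (at z)"
      using has_derivative_compose[OF has_derivative_snd[OF has_derivative_ident]] by fastforce
    moreover have "(k has_derivative (*) (deriv k ?r)) (at ?r)"
      using smooth_on_real_deriv(1)[OF _ k_smooth, of ?r] r by (simp add: has_field_derivative_def)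
    ultimately have k: "((\<lambda>z::(real ^ 'n) \<times> (real ^ 'm). k (norm (snd z))) has_derivative
        (\<lambda>a. deriv k ?r * (snd a \<bullet> sgn (snd z)))) (at z)"
      by (rule has_derivative_compose)
    have "((\<lambda>z. (k (norm (snd z)))\<^sup>2 * (snd z \<bullet> snd w)) has_derivative
      (\<lambda>a. 2 * k ?r * deriv k ?r * (snd a \<bullet> sgn (snd z)) * (snd z \<bullet> snd w) + (k ?r)\<^sup>2 * (snd a \<bullet> snd w))) (at z)"
      by (auto intro!: derivative_eq_intros k simp: algebra_simps power2_eq_square)
    then have "((\<lambda>z. G z (?R z) w) has_derivative
      (\<lambda>a. 2 * k ?r * deriv k ?r * (snd a \<bullet> sgn (snd z)) * (snd z \<bullet> snd w) + (k ?r)\<^sup>2 * (snd a \<bullet> snd w))) (at z)"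
      by (rule has_derivative_transform_within_open[OF _ open_Z assms]) (simp add: G_radial)
    from G_derivative[OF assms smooth_on_bounded_linear[OF open_Z bounded_linear_radial]
        smooth_on_const[OF open_Z] this, of a]
    show ?thesis by (simp add: frechet_derivative_radial)
  qed
  have "(snd a \<bullet> sgn (snd z)) * (snd z \<bullet> snd w) = (snd w \<bullet> sgn (snd z)) * (snd z \<bullet> snd a)" for a w
    by (simp add: sgn_div_norm inner_commute)
  from arg_cong[OF this[of u v], of "(*) (2 * k ?r * deriv k ?r)"]
  have "2 * k ?r * deriv k ?r * (snd u \<bullet> sgn (snd z)) * (snd z \<bullet> snd v) =
      2 * k ?r * deriv k ?r * (snd v \<bullet> sgn (snd z)) * (snd z \<bullet> snd u)"
    by (simp only: mult.assoc)
  then show ?thesis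
    by (metis (no_types) * add_right_cancel \<Gamma>_symmetric[OF assms] inner_commute)
qed

text \<open>
  The symmetric part of \<open>\<nabla>R\<close>: the last two terms come from the brackets of \<open>R\<close> with constant fields;
  moved to the left-hand side, they complete it to the Lie derivative of the metric along \<open>R\<close>.
\<close>

lemma G_ray_derivative:
  assumes "z \<in> Z" and r: "r = norm (snd z)"
    and "((\<lambda>z. G z u v) has_derivative G') (at z)"
  shows "G' (0, snd z) = 2 * G z (A z u) v - G z (0, snd u) v - G z u (0, snd v)"
proof -
  have "0 < r" using Z_nonzero assms by simp
  let ?a = "\<omega> (fst z) (fst u) (snd z)" and ?b = "\<omega> (fst z) (fst v) (snd z)"
  let ?f = "\<lambda>t. (h (t * r))\<^sup>2 * \<beta> (fst z) (fst u) (fst v) +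
    (k (t * r))\<^sup>2 * (snd u \<bullet> snd v + t * (snd u \<bullet> ?b + ?a \<bullet> snd v) + t\<^sup>2 * (?a \<bullet> ?b))"
  let ?D = "2 * h r * (deriv h r * r) * \<beta> (fst z) (fst u) (fst v) +
    2 * k r * (deriv k r * r) * (\<zeta> z u \<bullet> \<zeta> z v) + (k r)\<^sup>2 * (?a \<bullet> \<zeta> z v + \<zeta> z u \<bullet> ?b)"
  have "((\<lambda>t. f (t * r)) has_real_derivative deriv f r * r) (at 1)"
    if "smooth_on {0<..} f" for f :: "real \<Rightarrow> real"
  proof -
    have "(f has_real_derivative deriv f r) (at (1 * r))"
      using smooth_on_real_deriv(1)[OF _ that] \<open>0 < r\<close> by simp
    moreover have "((\<lambda>t. t * r) has_real_derivative r) (at 1)" by (auto intro!: derivative_eq_intros)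
    ultimately show ?thesis by (rule DERIV_chain2)
  qed
  note hk = this[OF h_smooth] this[OF k_smooth]
  have f: "(?f has_real_derivative ?D) (at 1)"
    by (rule derivative_eq_intros hk refl)+ (simp add: \<zeta>_def inner_add_left inner_add_right algebra_simps power2_eq_square)
  have "G' (0, snd z) = ?D"
  proof (rule fibre_ray_derivative[OF assms(3)])
    show "(?f has_vector_derivative ?D) (at 1)"
      using f by (simp add: has_real_derivative_iff_has_vector_derivative)
    show "G (fst z, t *\<^sub>R snd z) u v = ?f t" if "0 < t" for t
      using that by (simp add: G_def \<zeta>_def r linear_scale[OF \<omega>_linear_fibre[OF assms(1)]]
          inner_add_left inner_add_right algebra_simps power2_eq_square)
  qed
  also have "\<dots> = 2 * G z (A z u) v - G z (0, snd u) v - G z u (0, snd v)"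
    unfolding G_A[OF assms(1,2)]
    by (simp add: G_def r[symmetric] \<zeta>_vertical[OF assms(1)] bilinear_lzero[OF \<beta>_bilinear[OF assms(1)]]
        bilinear_rzero[OF \<beta>_bilinear[OF assms(1)]])
      (simp add: \<zeta>_def inner_add_left inner_add_right algebra_simps power2_eq_square)
  finally show ?thesis .
qed

text \<open>
  The left-hand side is the covariant derivative of \<open>R = (0,x)\<close> in the direction \<open>u\<close>. Its symmetric part
  is \<open>A\<close> by \<open>G_ray_derivative\<close> and its antisymmetric part vanishes.
\<close>

lemma nabla_radial:
  assumes "z \<in> Z"
  shows "(0, snd u) + \<Gamma> z u (0, snd z) = A z u"
proof (rule G_nondegenerate[OF assms])
  fix v
  let ?T = "\<lambda>u. (0, snd u) + \<Gamma> z u (0, snd z)"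
  obtain G' where G': "((\<lambda>z. G z u v) has_derivative G') (at z)"
    using G_differentiable[OF assms] unfolding differentiable_def by blast
  have const: "smooth_on Z (\<lambda>z. w)" for w :: "(real ^ 'n) \<times> (real ^ 'm)"
    by (rule smooth_on_const[OF open_Z])
  have "G z (\<Gamma> z w (0, snd z)) v = G z (?T w) v - G z (0, snd w) v" for w v
    using linear_add[OF G_linear[OF assms]] by simp
  moreover have "G' (0, snd z) = G z (\<Gamma> z u (0, snd z)) v + G z (\<Gamma> z v (0, snd z)) u"
    using G_derivative[OF assms const const G', of "(0, snd z)"] G_symmetric[OF assms, of u]
      \<Gamma>_symmetric[OF assms, of "(0, snd z)"] by simp
  ultimately have "2 * G z (A z u) v = G z (?T u) v + G z (?T v) u"
    using G_ray_derivative[OF assms refl G'] G_symmetric[OF assms, of u "(0, snd v)"] by simp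
  then show "G z (?T u) v = G z (A z u) v" using nabla_radial_alternating[OF assms, of u v] by simp
qed

text \<open>
  The Ricci tensor \<open>Ric(p,p)\<close> at \<open>z\<close> in terms of Christoffel symbols.
\<close>

definition ricci_radial :: "(real ^ 'n) \<times> (real ^ 'm) \<Rightarrow> (real ^ 'n) \<times> (real ^ 'm) \<Rightarrow> real" where
  "ricci_radial z p = endo_trace (\<lambda>b. frechet_derivative (\<lambda>y. \<Gamma> y p p) (at z) b + \<Gamma> z b (\<Gamma> z p p)
    - frechet_derivative (\<lambda>y. \<Gamma> y b p) (at z) p - \<Gamma> z p (\<Gamma> z b p))"

lemma A_radial:
  assumes "z \<in> Z"
  shows "A z (0, x) = lam (norm (snd z)) *\<^sub>R (0, x)"
  unfolding A_def \<zeta>_vertical[OF assms] by (simp add: algebra_simps)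

text \<open>
  Differentiating \<open>\<Gamma>(u,R) = A u - (0, u\<^sub>2)\<close> also differentiates \<open>R\<close>; subtracting that contribution
  leaves the derivative of \<open>\<Gamma>\<close> with both arguments frozen. The auxiliary function \<open>\<Theta>\<close> is
  \<open>\<Gamma>\<^sub>y(u, R\<^sub>y - R\<^sub>z)\<close>, expanded in a basis so that its derivative at \<open>z\<close> is visible.
\<close>

lemma \<Gamma>_radial_derivative:
  assumes z: "z \<in> Z"
    and A: "((\<lambda>y. A y u) has_derivative A') (at z)"
  shows "frechet_derivative (\<lambda>y. \<Gamma> y u (0, snd z)) (at z) a = A' a - \<Gamma> z u (0, snd a)"
proof -
  let ?p = "(0 :: real ^ 'n, snd z)"
  define \<Theta> where "\<Theta> = (\<lambda>y. \<Sum>b\<in>Basis. ((0, snd (y - z)) \<bullet> b) *\<^sub>R \<Gamma> y u b)"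
  have \<Gamma>: "((\<lambda>y. \<Gamma> y u b) has_derivative frechet_derivative (\<lambda>y. \<Gamma> y u b) (at z)) (at z)" for b
    by (rule smooth_on_derivative(1)[OF open_Z \<Gamma>_smooth z])
  have lin: "((\<lambda>y. (0 :: real ^ 'n, snd (y - z)) \<bullet> b) has_derivative (\<lambda>a. (0, snd a) \<bullet> b)) (at z)" for b :: "(real ^ 'n) \<times> (real ^ 'm)"
    by (rule has_derivative_eq_rhs, (rule derivative_intros)+) (simp add: fun_eq_iff)
  have "(\<Theta> has_derivative (\<lambda>a. \<Sum>b\<in>Basis. ((0, snd (z - z)) \<bullet> b) *\<^sub>R frechet_derivative (\<lambda>y. \<Gamma> y u b) (at z) a +
      ((0, snd a) \<bullet> b) *\<^sub>R \<Gamma> z u b)) (at z)"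
    unfolding \<Theta>_def by (rule has_derivative_sum, rule has_derivative_scaleR[OF lin \<Gamma>])
  moreover have "(\<lambda>a. \<Sum>b\<in>Basis. ((0 :: real ^ 'n, snd (z - z)) \<bullet> b) *\<^sub>R frechet_derivative (\<lambda>y. \<Gamma> y u b) (at z) a +
      ((0, snd a) \<bullet> b) *\<^sub>R \<Gamma> z u b) = (\<lambda>a. \<Gamma> z u (0, snd a))"
  proof
    fix a :: "(real ^ 'n) \<times> (real ^ 'm)"
    have "(0 :: real ^ 'n, snd (z - z)) = 0" by (simp add: zero_prod_def)
    then show "(\<Sum>b\<in>Basis. ((0 :: real ^ 'n, snd (z - z)) \<bullet> b) *\<^sub>R frechet_derivative (\<lambda>y. \<Gamma> y u b) (at z) a +
      ((0, snd a) \<bullet> b) *\<^sub>R \<Gamma> z u b) = \<Gamma> z u (0, snd a)"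
      by (simp only: inner_zero_left scaleR_zero_left add_0 linear_sum_Basis[OF \<Gamma>_linear[OF z], of u "(0, snd a)", symmetric])
  qed
  ultimately have \<Theta>: "(\<Theta> has_derivative (\<lambda>a. \<Gamma> z u (0, snd a))) (at z)" by simp
  have "((\<lambda>y. (A y u - (0, snd u)) - \<Theta> y) has_derivative (\<lambda>a. (A' a - 0) - \<Gamma> z u (0, snd a))) (at z)"
    by (intro has_derivative_diff A \<Theta> has_derivative_const)
  then have "((\<lambda>y. \<Gamma> y u ?p) has_derivative (\<lambda>a. (A' a - 0) - \<Gamma> z u (0, snd a))) (at z)"
  proof (rule has_derivative_transform_within_open[OF _ open_Z z])
    fix y assume y: "y \<in> Z"
    have "\<Theta> y = \<Gamma> y u (0, snd (y - z))"
      unfolding \<Theta>_def by (rule linear_sum_Basis[OF \<Gamma>_linear[OF y], symmetric])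
    also have "(0, snd (y - z)) = (0 :: real ^ 'n, snd y) - ?p" by simp
    finally have "\<Theta> y = \<Gamma> y u (0, snd y) - \<Gamma> y u ?p"
      by (simp only: linear_diff[OF \<Gamma>_linear[OF y]])
    moreover have "\<Gamma> y u (0, snd y) = A y u - (0, snd u)"
      using nabla_radial[OF y, of u] by (simp add: algebra_simps)
    ultimately show "A y u - (0, snd u) - \<Theta> y = \<Gamma> y u ?p" by simp
  qed
  from fun_cong[OF frechet_derivative_at[OF this], of a] show ?thesis by simp
qed

lemma A_ray_derivative:
  assumes "z \<in> Z" and r: "r = norm (snd z)" and "((\<lambda>y. A y u) has_derivative A') (at z)"
  shows "A' (0, snd z) = (r * deriv \<mu> r) *\<^sub>R u + (r * (deriv lam r - deriv \<mu> r)) *\<^sub>R (0, \<zeta> z u)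
    + \<nu> r *\<^sub>R (0, \<omega> (fst z) (fst u) (snd z))"
proof (rule fibre_ray_derivative[OF assms(3)])
  have "0 < r" using Z_nonzero assms by simp
  let ?a = "\<omega> (fst z) (fst u) (snd z)"
  let ?f = "\<lambda>t. \<mu> (t * r) *\<^sub>R u + \<nu> (t * r) *\<^sub>R (0, snd u + t *\<^sub>R ?a)"
  have "((\<lambda>t. f (t * r)) has_real_derivative deriv f r * r) (at 1)"
    if "smooth_on {0<..} f" for f :: "real \<Rightarrow> real"
  proof -
    have "(f has_real_derivative deriv f r) (at (1 * r))"
      using smooth_on_real_deriv(1)[OF _ that] \<open>0 < r\<close> by simp
    moreover have "((\<lambda>t. t * r) has_real_derivative r) (at 1)" by (auto intro!: derivative_eq_intros)
    ultimately show ?thesis by (rule DERIV_chain2)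
  qed
  note d = this[OF \<mu>_smooth] this[OF lam_smooth]
  have d\<mu>: "((\<lambda>t. \<mu> (t * r)) has_derivative (\<lambda>x. x * (deriv \<mu> r * r))) (at 1)"
    and dl: "((\<lambda>t. lam (t * r)) has_derivative (\<lambda>x. x * (deriv lam r * r))) (at 1)"
    using d by (simp_all add: has_field_derivative_def mult_commute_abs)
  have dray: "((\<lambda>t. (0 :: real ^ 'n, snd u + t *\<^sub>R ?a)) has_derivative (\<lambda>x. (0, x *\<^sub>R ?a))) (at (1 :: real))"
    by (auto intro!: derivative_eq_intros)
  have "(?f has_derivative (\<lambda>x. (\<mu> (1 * r) *\<^sub>R 0 + (x * (deriv \<mu> r * r)) *\<^sub>R u) +
      (\<nu> (1 * r) *\<^sub>R (0, x *\<^sub>R ?a) + (x * (deriv lam r * r) - x * (deriv \<mu> r * r)) *\<^sub>R (0, snd u + 1 *\<^sub>R ?a)))) (at 1)"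
    by (intro has_derivative_add has_derivative_scaleR has_derivative_diff d\<mu> dl dray has_derivative_const)
  then show "(?f has_vector_derivative (r * deriv \<mu> r) *\<^sub>R u + (r * (deriv lam r - deriv \<mu> r)) *\<^sub>R (0, \<zeta> z u)
    + \<nu> r *\<^sub>R (0, ?a)) (at 1)"
    unfolding has_vector_derivative_def
    by (rule has_derivative_eq_rhs) (auto simp: fun_eq_iff \<zeta>_def algebra_simps prod_eq_iff)
  show "A (fst z, t *\<^sub>R snd z) u = ?f t" if "0 < t" for t
    using that by (simp add: A_def \<zeta>_def r linear_scale[OF \<omega>_linear_fibre[OF assms(1)]])
qed

text \<open>
  By \<open>nabla_radial\<close>, \<open>A\<close> inherits differentiability from the Christoffel symbols.
\<close>

lemma A_differentiable:
  assumes "z \<in> Z"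
  shows "(\<lambda>y. A y u) differentiable (at z)"
proof -
  have "(\<lambda>y. \<Sum>b\<in>Basis. ((0, snd y) \<bullet> b) *\<^sub>R \<Gamma> y u b) differentiable (at z)"
  proof (rule differentiable_sum[OF finite_Basis], rule ballI, rule differentiable_scaleR)
    show "(\<lambda>y. (0 :: real ^ 'n, snd y) \<bullet> b) differentiable (at z)" for b :: "(real ^ 'n) \<times> (real ^ 'm)"
      by (rule bounded_linear_imp_differentiable[OF
            bounded_linear_compose[OF bounded_linear_inner_left bounded_linear_radial]])
    show "(\<lambda>y. \<Gamma> y u b) differentiable (at z)" for b
      by (rule smooth_on_differentiable[OF open_Z \<Gamma>_smooth assms])
  qed
  then have "(\<lambda>y. (0, snd u) + (\<Sum>b\<in>Basis. ((0, snd y) \<bullet> b) *\<^sub>R \<Gamma> y u b)) differentiable (at z)"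
    by (intro differentiable_add differentiable_const)
  then show ?thesis
  proof (subst differentiable_eq_on_open[OF open_Z assms, symmetric])
    show "(0, snd u) + (\<Sum>b\<in>Basis. ((0, snd y) \<bullet> b) *\<^sub>R \<Gamma> y u b) = A y u" if "y \<in> Z" for y
      unfolding linear_sum_Basis[OF \<Gamma>_linear[OF that], of u "(0, snd y)", symmetric] by (rule nabla_radial[OF that])
  qed
qed

text \<open>
  By \<open>nabla_radial\<close>, all Christoffel symbols with one argument \<open>R\<close> are explicit, and so are the two
  derivatives in the Ricci tensor: \<open>A R = \<lambda> R\<close> makes the first one a multiple of \<open>R\<close>, and the second
  one is taken along a ray. The remaining terms \<open>\<Gamma>(R, (0, b\<^sub>2))\<close> cancel. What is left is
  a combination of the identity, the vertical projections \<open>V\<close> (orthogonal) and \<open>P\<close> (in coordinates),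
  the off-diagonal map \<open>W\<close>, and a rank-one map, whose traces are known.
\<close>

lemma ricci_radial_eq:
  assumes z: "z \<in> Z" and r: "r = norm (snd z)"
  shows "ricci_radial z (0, snd z) = r * deriv \<mu> r * (1 - real CARD('n) - real CARD('m))
    + r * (deriv lam r - deriv \<mu> r) * (1 - real CARD('m)) + real CARD('n) * \<nu> r * \<mu> r"
proof -
  have "0 < r" using Z_nonzero assms by simp
  define p where "p = (0 :: real ^ 'n, snd z)"
  define V where "V = (\<lambda>u. (0 :: real ^ 'n, \<zeta> z u))"
  define P where "P = (\<lambda>u :: (real ^ 'n) \<times> (real ^ 'm). (0 :: real ^ 'n, snd u))"
  define W where "W = (\<lambda>u :: (real ^ 'n) \<times> (real ^ 'm). (0 :: real ^ 'n, \<omega> (fst z) (fst u) (snd z)))"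
  have [simp]: "P p = p" "V p = p" "\<And>u. P (V u) = V u" "\<And>u. V (V u) = V u" "\<And>u. V (P u) = P u"
    using \<zeta>_vertical[OF z] by (simp_all add: P_def V_def p_def)
  have Au: "A z u = \<mu> r *\<^sub>R u + \<nu> r *\<^sub>R V u" for u by (simp add: A_def V_def r)
  have \<Gamma>p: "\<Gamma> z u p = A z u - P u" for u
    using nabla_radial[OF z, of u] by (simp add: p_def P_def algebra_simps)
  have \<Gamma>p': "\<Gamma> z p u = A z u - P u" for u by (rule trans[OF \<Gamma>_symmetric[OF z] \<Gamma>p])
  have Ap: "A z p = lam r *\<^sub>R p" using A_radial[OF z] by (simp add: p_def r)
  define l where "l = frechet_derivative (\<lambda>y::(real ^ 'n) \<times> (real ^ 'm). lam (norm (snd y))) (at z)"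
  have "(\<lambda>y::(real ^ 'n) \<times> (real ^ 'm). norm (snd y)) differentiable (at z)"
    by (rule differentiable_compose[of norm snd])
      (use Z_nonzero[OF z] in \<open>auto intro!: differentiable_norm_at bounded_linear_imp_differentiable bounded_linear_snd\<close>)
  moreover have "lam differentiable (at (norm (snd z)))"
    by (rule smooth_on_differentiable[OF _ lam_smooth]) (use \<open>0 < r\<close> r in auto)
  ultimately have "(\<lambda>y::(real ^ 'n) \<times> (real ^ 'm). lam (norm (snd y))) differentiable (at z)"
    by (rule differentiable_compose[rotated])
  then have l: "((\<lambda>y::(real ^ 'n) \<times> (real ^ 'm). lam (norm (snd y))) has_derivative l) (at z)"
    by (simp add: frechet_derivative_works l_def)
  have lp: "l p = r * deriv lam r"
    unfolding p_def
  proof (rule fibre_ray_derivative[OF l])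
    have "(lam has_real_derivative deriv lam r) (at (1 * r))"
      using smooth_on_real_deriv(1)[OF _ lam_smooth] \<open>0 < r\<close> by simp
    moreover have "((\<lambda>t. t * r) has_real_derivative r) (at 1)" by (auto intro!: derivative_eq_intros)
    ultimately have "((\<lambda>t. lam (t * r)) has_real_derivative deriv lam r * r) (at 1)" by (rule DERIV_chain2)
    then show "((\<lambda>t. lam (t * r)) has_vector_derivative r * deriv lam r) (at 1)"
      by (simp add: has_real_derivative_iff_has_vector_derivative mult.commute)
  qed (simp add: r)
  \<comment> \<open>Only \<open>\<lambda>\<close> varies, because \<open>A\<^sub>y (0,x) = \<lambda>(y) (0,x)\<close> for every \<open>x\<close> in the fibre.\<close>
  have "((\<lambda>y. A y p) has_derivative (\<lambda>b. l b *\<^sub>R p)) (at z)"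
    by (rule has_derivative_transform_within_open[OF has_derivative_scaleR_left[OF l] open_Z z])
      (simp add: p_def A_radial)
  from \<Gamma>_radial_derivative[OF z this]
  have D1: "frechet_derivative (\<lambda>y. \<Gamma> y p p) (at z) b = l b *\<^sub>R p - \<Gamma> z p (P b)" for b
    by (simp add: p_def P_def)
  have D2: "frechet_derivative (\<lambda>y. \<Gamma> y b p) (at z) p =
    (r * deriv \<mu> r) *\<^sub>R b + (r * (deriv lam r - deriv \<mu> r)) *\<^sub>R V b + \<nu> r *\<^sub>R W b - \<Gamma> z b p" for b
  proof -
    obtain A' where A': "((\<lambda>y. A y b) has_derivative A') (at z)"
      using A_differentiable[OF z] unfolding differentiable_def by blast
    show ?thesis
      using \<Gamma>_radial_derivative[OF z A', of p] A_ray_derivative[OF z r A'] by (simp add: p_def V_def W_def)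
  qed
  have "frechet_derivative (\<lambda>y. \<Gamma> y p p) (at z) b + \<Gamma> z b (\<Gamma> z p p)
    - frechet_derivative (\<lambda>y. \<Gamma> y b p) (at z) p - \<Gamma> z p (\<Gamma> z b p) =
    l b *\<^sub>R p + (\<nu> r * \<mu> r - r * deriv \<mu> r) *\<^sub>R b
      + (\<nu> r * \<nu> r - r * (deriv lam r - deriv \<mu> r) - \<nu> r * (lam r - 1)) *\<^sub>R V b
      - \<nu> r *\<^sub>R P b - \<nu> r *\<^sub>R W b" for b
  proof -
    \<comment> \<open>The terms quadratic in the Christoffel symbols, reduced with \<open>\<Gamma>(b,R) = A b - P b\<close>.\<close>
    have "\<Gamma> z p p = (lam r - 1) *\<^sub>R p" by (simp add: \<Gamma>p Ap algebra_simps)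
    then have pp: "\<Gamma> z b (\<Gamma> z p p) = (lam r - 1) *\<^sub>R (A z b - P b)"
      by (simp only: linear_scale[OF \<Gamma>_linear[OF z]] \<Gamma>p)
    have "\<Gamma> z p (V b) = (lam r - 1) *\<^sub>R V b" by (simp add: \<Gamma>p' Au algebra_simps)
    then have "\<Gamma> z p (A z b) = \<mu> r *\<^sub>R (A z b - P b) + \<nu> r *\<^sub>R (lam r - 1) *\<^sub>R V b"
      by (simp only: Au[of b] linear_add[OF \<Gamma>_linear[OF z]] linear_scale[OF \<Gamma>_linear[OF z]])
        (simp only: \<Gamma>p' Au)
    then have bp: "\<Gamma> z p (\<Gamma> z b p) = \<mu> r *\<^sub>R (A z b - P b) + \<nu> r *\<^sub>R (lam r - 1) *\<^sub>R V b - \<Gamma> z p (P b)"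
      by (simp only: \<Gamma>p linear_diff[OF \<Gamma>_linear[OF z]])
    show ?thesis
      unfolding pp bp D1 D2 unfolding \<Gamma>p Au by (simp add: algebra_simps)
  qed
  then have "ricci_radial z p = endo_trace (\<lambda>b. l b *\<^sub>R p) + (\<nu> r * \<mu> r - r * deriv \<mu> r) * endo_trace (\<lambda>b :: (real ^ 'n) \<times> (real ^ 'm). b)
      + (\<nu> r * \<nu> r - r * (deriv lam r - deriv \<mu> r) - \<nu> r * (lam r - 1)) * endo_trace V
      - \<nu> r * endo_trace P - \<nu> r * endo_trace W"
    unfolding ricci_radial_def
    by (simp add: inner_add_left inner_diff_left sum.distrib sum_subtractf sum_distrib_left)
  also have "endo_trace (\<lambda>b. l b *\<^sub>R p) = r * deriv lam r"
    using trace_rank_one[OF has_derivative_linear[OF l], of p] lp by simp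
  also have "endo_trace (\<lambda>b :: (real ^ 'n) \<times> (real ^ 'm). b) = real CARD('n) + real CARD('m)"
    by (simp add: sum_Basis_prod)
  also have "endo_trace V = real CARD('m)" unfolding V_def by (rule trace_vertical(1)[OF z])
  also have "endo_trace P = real CARD('m)" unfolding P_def by (rule trace_vertical(2)[OF z])
  also have "endo_trace W = 0" unfolding W_def by (rule trace_vertical(3)[OF z])
  finally show ?thesis unfolding p_def by (simp add: algebra_simps)
qed

end

context radial_metric
begin

lemma A_linear: "z \<in> Z \<Longrightarrow> linear (A z)"
  unfolding A_def by (intro linearI) (auto simp: linear_add[OF \<zeta>_linear] linear_scale[OF \<zeta>_linear] algebra_simps)

text \<open>
  The endomorphism \<open>T\<close> is self-adjoint because \<open>A\<close> is and because \<open>snd z \<bullet> snd w\<close> is a multiple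
  of the inner product of \<open>w\<close> with \<open>R\<close>. Hence the sum of the squared norms is the trace of \<open>T \<circ> T\<close>.
\<close>

lemma sum_norm_rank_one_plus_A:
  assumes z: "z \<in> Z" and r: "r = norm (snd z)"
    and T: "\<And>w. T w = (c * (snd z \<bullet> snd w)) *\<^sub>R (0, snd z) + \<sigma> *\<^sub>R A z w"
    and F: "card F = DIM((real ^ 'n) \<times> (real ^ 'm))"
      "\<And>v w. v \<in> F \<Longrightarrow> w \<in> F \<Longrightarrow> G z v w = (if v = w then 1 else 0)"
  shows "(\<Sum>w\<in>F. G z (T w) (T w)) = c\<^sup>2 * r ^ 4 + 2 * c * \<sigma> * lam r * r\<^sup>2
    + \<sigma>\<^sup>2 * (real CARD('n) * (\<mu> r)\<^sup>2 + real CARD('m) * (lam r)\<^sup>2)"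
proof -
  define p where "p = (0 :: real ^ 'n, snd z)"
  define V where "V = (\<lambda>u. (0 :: real ^ 'n, \<zeta> z u))"
  have Au: "A z u = \<mu> r *\<^sub>R u + \<nu> r *\<^sub>R V u" for u by (simp add: A_def V_def r)
  have VV: "V (V u) = V u" for u
    unfolding V_def \<zeta>_vertical[OF z] ..
  have Vlin: "linear V"
    unfolding V_def by (intro linearI) (simp_all add: linear_add[OF \<zeta>_linear[OF z]] linear_scale[OF \<zeta>_linear[OF z]])
  have T_linear: "linear T"
    unfolding T by (intro linearI) (auto simp: linear_add[OF A_linear[OF z]] linear_scale[OF A_linear[OF z]] algebra_simps)
  have "G z (T u) v = G z (T v) u" for u v
  proof -
    have "G z (T u) v = c * (snd z \<bullet> snd u) * G z p v + \<sigma> * G z (A z u) v" for u v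
      unfolding T p_def[symmetric] by (simp add: linear_add[OF G_linear[OF z]] linear_scale[OF G_linear[OF z]])
    then show ?thesis
      unfolding G_A[OF z refl] p_def G_radial[OF z] using \<beta>_symmetric[OF z] by (simp add: inner_commute)
  qed
  then have "(\<Sum>w\<in>F. G z (T w) (T w)) = (\<Sum>w\<in>F. G z ((T \<circ> T) w) w)" by simp
  also have "\<dots> = endo_trace (T \<circ> T)"
    by (rule sum_orthonormal_eq_trace[OF G_linear[OF z] F linear_compose[OF T_linear T_linear]])
  also have "T \<circ> T = (\<lambda>b. ((c\<^sup>2 * r\<^sup>2 + 2 * c * \<sigma> * lam r) * (snd z \<bullet> snd b)) *\<^sub>R p +
      (\<sigma>\<^sup>2 * (\<mu> r)\<^sup>2) *\<^sub>R b + (\<sigma>\<^sup>2 * ((lam r)\<^sup>2 - (\<mu> r)\<^sup>2)) *\<^sub>R V b)"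
  proof
    fix b
    have "snd z \<bullet> snd (A z b) = lam r * (snd z \<bullet> snd b)"
      unfolding Au using inner_\<zeta>_fibre[OF z, of b] by (simp add: V_def inner_add_right algebra_simps)
    moreover have "snd z \<bullet> snd z = r\<^sup>2" by (simp add: r power2_norm_eq_inner)
    ultimately have rad: "snd z \<bullet> snd (T b) = (c * r\<^sup>2 + \<sigma> * lam r) * (snd z \<bullet> snd b)"
      unfolding T by (simp add: inner_add_right algebra_simps)
    have Ap: "A z p = lam r *\<^sub>R p"
      unfolding p_def A_def \<zeta>_vertical[OF z] by (simp add: r algebra_simps)
    have AA: "A z (A z b) = (\<mu> r)\<^sup>2 *\<^sub>R b + ((lam r)\<^sup>2 - (\<mu> r)\<^sup>2) *\<^sub>R V b"
      unfolding Au[of "A z b"] unfolding Au[of b]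
      by (simp add: linear_add[OF Vlin] linear_diff[OF Vlin] linear_scale[OF Vlin] VV algebra_simps power2_eq_square)
    have AT: "A z (T b) = (c * (snd z \<bullet> snd b) * lam r) *\<^sub>R p
        + (\<sigma> * (\<mu> r)\<^sup>2) *\<^sub>R b + (\<sigma> * ((lam r)\<^sup>2 - (\<mu> r)\<^sup>2)) *\<^sub>R V b"
      unfolding T p_def[symmetric] linear_add[OF A_linear[OF z]] linear_scale[OF A_linear[OF z]] Ap AA
      by (simp add: algebra_simps)
    have coeff: "(c\<^sup>2 * r\<^sup>2 + 2 * c * \<sigma> * lam r) * (snd z \<bullet> snd b) =
        c * ((c * r\<^sup>2 + \<sigma> * lam r) * (snd z \<bullet> snd b)) + \<sigma> * (c * (snd z \<bullet> snd b) * lam r)"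
      by (simp add: algebra_simps power2_eq_square)
    show "(T \<circ> T) b = ((c\<^sup>2 * r\<^sup>2 + 2 * c * \<sigma> * lam r) * (snd z \<bullet> snd b)) *\<^sub>R p +
      (\<sigma>\<^sup>2 * (\<mu> r)\<^sup>2) *\<^sub>R b + (\<sigma>\<^sup>2 * ((lam r)\<^sup>2 - (\<mu> r)\<^sup>2)) *\<^sub>R V b"
      unfolding o_def T[of "T b"] rad p_def[symmetric] AT coeff scaleR_add_left scaleR_add_right
      by (simp add: power2_eq_square mult.assoc)
  qed
  also have "endo_trace \<dots> = endo_trace (\<lambda>b. ((c\<^sup>2 * r\<^sup>2 + 2 * c * \<sigma> * lam r) * (snd z \<bullet> snd b)) *\<^sub>R p)
      + \<sigma>\<^sup>2 * (\<mu> r)\<^sup>2 * endo_trace (\<lambda>b :: (real ^ 'n) \<times> (real ^ 'm). b)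
      + \<sigma>\<^sup>2 * ((lam r)\<^sup>2 - (\<mu> r)\<^sup>2) * endo_trace V"
    by (simp add: inner_add_left sum.distrib sum_distrib_left)
  also have "endo_trace (\<lambda>b. ((c\<^sup>2 * r\<^sup>2 + 2 * c * \<sigma> * lam r) * (snd z \<bullet> snd b)) *\<^sub>R p) =
      (c\<^sup>2 * r\<^sup>2 + 2 * c * \<sigma> * lam r) * r\<^sup>2"
    by (subst trace_rank_one) (auto intro!: linearI simp: algebra_simps p_def r power2_norm_eq_inner)
  also have "endo_trace (\<lambda>b :: (real ^ 'n) \<times> (real ^ 'm). b) = real CARD('n) + real CARD('m)"
    by (simp add: sum_Basis_prod)
  also have "endo_trace V = real CARD('m)" unfolding V_def by (rule trace_vertical(1)[OF z])
  finally show ?thesis by (simp add: algebra_simps power2_eq_square power4_eq_xxxx)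
qed

definition radial :: "(real \<Rightarrow> real) \<Rightarrow> (real ^ 'n) \<times> (real ^ 'm) \<Rightarrow> (real ^ 'n) \<times> (real ^ 'm)" where
  "radial s z = (s (norm (snd z)) / norm (snd z)) *\<^sub>R (0, snd z)"

lemma fibre_norm_smooth: "smooth_on Z (\<lambda>z. norm (snd z))"
  by (rule smooth_on_compose[OF open_Z _ smooth_on_bounded_linear[OF open_Z bounded_linear_snd]
        smooth_onI[OF _ Ck_on_norm]]) (use Z_nonzero in auto)

lemma radial_smooth:
  assumes "smooth_on {0<..} s"
  shows "smooth_on Z (radial s)"
proof -
  have o: "open {0::real<..}" by simp
  have "smooth_on {0<..} (inverse :: real \<Rightarrow> real)"
    by (rule smooth_on_subset[OF smooth_onI[OF _ Ck_on_inverse]]) auto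
  then have "smooth_on {0<..} (\<lambda>t. s t / t)"
    unfolding divide_inverse by (rule smooth_on_bilinear[OF bounded_bilinear_mult o assms])
  from smooth_on_compose[OF open_Z o fibre_norm_smooth this]
  have "smooth_on Z (\<lambda>z. s (norm (snd z)) / norm (snd z))" using Z_nonzero by force
  then show ?thesis
    unfolding radial_def[abs_def]
    by (rule smooth_on_bilinear[OF bounded_bilinear_scaleR open_Z _ smooth_on_bounded_linear[OF open_Z]])
      (intro bounded_linear_Pair bounded_linear_zero bounded_linear_snd)
qed

end

context radial_levi_civita
begin

definition nabla :: "(real \<Rightarrow> real) \<Rightarrow> (real ^ 'n) \<times> (real ^ 'm) \<Rightarrow> (real ^ 'n) \<times> (real ^ 'm) \<Rightarrow>
    (real ^ 'n) \<times> (real ^ 'm)" where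
  "nabla s z w = frechet_derivative (radial s) (at z) w + \<Gamma> z w (radial s z)"

text \<open>
  The coefficient of the rank-one part is \<open>\<sigma>'/r\<close> with \<open>\<sigma> = s/r\<close>, since \<open>d\<sigma>(w) = \<sigma>' \<langle>x, w\<^sub>2\<rangle> / r\<close>.
\<close>

lemma nabla_eq:
  assumes z: "z \<in> Z" and r: "r = norm (snd z)" and s: "smooth_on {0<..} s"
  shows "nabla s z w = ((deriv s r / r - s r / r\<^sup>2) / r * (snd z \<bullet> snd w)) *\<^sub>R (0, snd z) + (s r / r) *\<^sub>R A z w"
proof -
  have r0: "0 < r" using Z_nonzero[OF z] r by simp
  have "(s has_real_derivative deriv s r) (at r)"
    using smooth_on_real_deriv(1)[OF _ s, of r] r0 by simp
  then have "((\<lambda>t. s t / t) has_real_derivative (deriv s r / r - s r / r\<^sup>2)) (at r)"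
    using r0 by (auto intro!: derivative_eq_intros simp: field_simps power2_eq_square)
  then have st: "((\<lambda>t. s t / t) has_derivative (*) (deriv s r / r - s r / r\<^sup>2)) (at (norm (snd z)))"
    by (simp add: has_field_derivative_def r)
  have "(norm has_derivative (\<lambda>v. v \<bullet> sgn (snd z))) (at (snd z))"
    using has_derivative_norm Z_nonzero[OF z] by blast
  then have "((\<lambda>z::(real ^ 'n) \<times> (real ^ 'm). norm (snd z)) has_derivative (\<lambda>a. snd a \<bullet> sgn (snd z))) (at z)"
    using has_derivative_compose[OF has_derivative_snd[OF has_derivative_ident]] by fastforce
  from has_derivative_compose[OF this st]
  have "((\<lambda>z::(real ^ 'n) \<times> (real ^ 'm). s (norm (snd z)) / norm (snd z)) has_derivative
      (\<lambda>a. (deriv s r / r - s r / r\<^sup>2) * (snd a \<bullet> sgn (snd z)))) (at z)" .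
  from has_derivative_scaleR[OF this bounded_linear_imp_has_derivative[OF bounded_linear_radial]]
  have "(radial s has_derivative (\<lambda>a. (s r / r) *\<^sub>R (0, snd a) +
      ((deriv s r / r - s r / r\<^sup>2) * (snd a \<bullet> sgn (snd z))) *\<^sub>R (0, snd z))) (at z)"
    by (simp add: radial_def[abs_def] r)
  from fun_cong[OF frechet_derivative_at[OF this], of w]
  have "frechet_derivative (radial s) (at z) w = (s r / r) *\<^sub>R (0, snd w) +
      ((deriv s r / r - s r / r\<^sup>2) * (snd w \<bullet> sgn (snd z))) *\<^sub>R (0, snd z)" by (rule sym)
  moreover have "\<Gamma> z w (radial s z) = (s r / r) *\<^sub>R \<Gamma> z w (0, snd z)"
    unfolding radial_def r by (rule linear_scale[OF \<Gamma>_linear[OF z]])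
  moreover have "snd w \<bullet> sgn (snd z) = (snd z \<bullet> snd w) / r"
    by (simp add: sgn_div_norm r inner_commute field_simps)
  moreover have "(s r / r) *\<^sub>R A z w = (s r / r) *\<^sub>R (0, snd w) + (s r / r) *\<^sub>R \<Gamma> z w (0, snd z)"
    unfolding nabla_radial[OF z, of w, symmetric] by (rule scaleR_add_right)
  ultimately show ?thesis unfolding nabla_def by simp
qed

lemma deriv_\<mu>_lam:
  assumes "0 < t"
  shows "deriv \<mu> t = deriv h t / h t + t * deriv (deriv h) t / h t - t * (deriv h t)\<^sup>2 / (h t)\<^sup>2"
    and "deriv lam t = deriv k t / k t + t * deriv (deriv k) t / k t - t * (deriv k t)\<^sup>2 / (k t)\<^sup>2"
proof -
  have d: "((\<lambda>t. t * deriv f t / f t) has_real_derivative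
      deriv f t / f t + t * deriv (deriv f) t / f t - t * (deriv f t)\<^sup>2 / (f t)\<^sup>2) (at t)"
    if "smooth_on {0<..} f" "0 < f t" for f :: "real \<Rightarrow> real"
  proof -
    have "open {0::real<..}" "t \<in> {0<..}" using assms by auto
    then have "(f has_real_derivative deriv f t) (at t)"
      "(deriv f has_real_derivative deriv (deriv f) t) (at t)"
      using smooth_on_real_deriv that(1) by blast+
    then show ?thesis
      using that(2) by (auto intro!: derivative_eq_intros simp: field_simps power2_eq_square)
  qed
  show "deriv \<mu> t = deriv h t / h t + t * deriv (deriv h) t / h t - t * (deriv h t)\<^sup>2 / (h t)\<^sup>2"
    unfolding \<mu>_def[abs_def] by (rule DERIV_imp_deriv[OF d[OF h_smooth h_pos[OF assms]]])
  have "(lam has_real_derivative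
      0 + (deriv k t / k t + t * deriv (deriv k) t / k t - t * (deriv k t)\<^sup>2 / (k t)\<^sup>2)) (at t)"
    unfolding lam_def[abs_def] by (intro DERIV_add DERIV_const d[OF k_smooth k_pos[OF assms]])
  then show "deriv lam t = deriv k t / k t + t * deriv (deriv k) t / k t - t * (deriv k t)\<^sup>2 / (k t)\<^sup>2"
    by (simp add: DERIV_imp_deriv)
qed

text \<open>
  The value of \<open>|\<nabla>X|\<^sup>2\<close> from \<open>sum_norm_rank_one_plus_A\<close> contains no second derivatives; they appear in
  the stated form after \<open>\<sigma>\<^sup>2 Ric(R,R) = 0\<close> is added.
\<close>

lemma sum_norm_nabla_eq:
  assumes z: "z \<in> Z" and r: "r = norm (snd z)" and s: "smooth_on {0<..} s"
    and ric: "ricci_radial z (0, snd z) = 0"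
    and F: "card F = DIM((real ^ 'n) \<times> (real ^ 'm))"
      "\<And>v w. v \<in> F \<Longrightarrow> w \<in> F \<Longrightarrow> G z v w = (if v = w then 1 else 0)"
    and n: "n = real CARD('n)" and m: "m = real CARD('m)"
  shows "(\<Sum>w\<in>F. G z (nabla s z w) (nabla s z w)) =
             - ((m - 1) * (s r)\<^sup>2 * deriv (deriv k) r / k r)
             + (deriv s r)\<^sup>2
             + 2 * s r * deriv s r * deriv k r / k r
             + (2 * m - 1) * (s r)\<^sup>2 * (deriv k r)\<^sup>2 / (k r)\<^sup>2
             + (m - 1) * (s r)\<^sup>2 * deriv k r / (k r * r)
             + n * (s r)\<^sup>2 * deriv h r * deriv k r / (h r * k r)
             + (m - 1) * (s r)\<^sup>2 / r\<^sup>2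
             - n * (s r)\<^sup>2 * deriv (deriv h) r / h r
             + n * (s r)\<^sup>2 * (deriv h r)\<^sup>2 / (h r)\<^sup>2"
proof -
  have r0: "0 < r" using Z_nonzero[OF z] r by simp
  define a b a' b' where "a = deriv h r / h r" and "b = deriv k r / k r"
    and "a' = deriv (deriv h) r / h r" and "b' = deriv (deriv k) r / k r"
  define \<sigma> \<tau> where "\<sigma> = s r / r" and "\<tau> = deriv s r"
  have sr: "s r = \<sigma> * r" using r0 by (simp add: \<sigma>_def)
  have \<mu>: "\<mu> r = r * a" "deriv \<mu> r = a + r * a' - r * a\<^sup>2"
    and lam: "lam r = 1 + r * b" "deriv lam r = b + r * b' - r * b\<^sup>2"
    using r0 by (simp_all add: \<mu>_def lam_def deriv_\<mu>_lam a_def a'_def b_def b'_def power_divide)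
  have "0 = r * deriv \<mu> r * (1 - n - m) + r * (deriv lam r - deriv \<mu> r) * (1 - m) + n * \<nu> r * \<mu> r"
    using ricci_radial_eq[OF z r] ric by (simp add: n m)
  then have ric': "0 = r * ((1 - m) * (b + r * b' - r * b\<^sup>2) + n * r * (a * b - a'))"
    unfolding \<mu> lam by (simp add: algebra_simps power2_eq_square)
  then have "(1 - m) * (b + r * b' - r * b\<^sup>2) + n * r * (a * b - a') = 0" using r0 by simp
  then have ric'': "\<sigma>\<^sup>2 * r * ((1 - m) * (b + r * b' - r * b\<^sup>2) + n * r * (a * b - a')) = 0" by simp
  \<comment> \<open>The derivative of \<open>\<sigma>\<close> at \<open>r\<close> is \<open>(\<tau> - \<sigma>) / r\<close>; one more factor \<open>1/r\<close> comes from \<open>dr\<close>.\<close>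
  have c: "(deriv s r / r - s r / r\<^sup>2) / r = (\<tau> - \<sigma>) / r\<^sup>2"
    using r0 by (simp add: \<sigma>_def \<tau>_def field_simps power2_eq_square)
  \<comment> \<open>The squared norm, before the Ricci equation is used.\<close>
  have "(\<Sum>w\<in>F. G z (nabla s z w) (nabla s z w)) = ((\<tau> - \<sigma>) / r\<^sup>2)\<^sup>2 * r ^ 4 + 2 * ((\<tau> - \<sigma>) / r\<^sup>2) * \<sigma> * lam r * r\<^sup>2
    + \<sigma>\<^sup>2 * (n * (\<mu> r)\<^sup>2 + m * (lam r)\<^sup>2)"
    unfolding n m by (rule sum_norm_rank_one_plus_A[OF z r _ F]) (simp only: nabla_eq[OF z r s] c \<sigma>_def)
  also have "\<dots> = (\<tau> - \<sigma>)\<^sup>2 + 2 * (\<tau> - \<sigma>) * \<sigma> * (1 + r * b) + \<sigma>\<^sup>2 * (n * (r * a)\<^sup>2 + m * (1 + r * b)\<^sup>2)"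
    unfolding \<mu> lam using r0 by (simp add: power2_eq_square power4_eq_xxxx)
  also have "\<dots> = (\<tau> - \<sigma>)\<^sup>2 + 2 * (\<tau> - \<sigma>) * \<sigma> * (1 + r * b) + \<sigma>\<^sup>2 * (n * (r * a)\<^sup>2 + m * (1 + r * b)\<^sup>2)
      + \<sigma>\<^sup>2 * r * ((1 - m) * (b + r * b' - r * b\<^sup>2) + n * r * (a * b - a'))"
    using ric'' by simp
  also have "\<dots> = - ((m - 1) * (\<sigma> * r)\<^sup>2 * b') + \<tau>\<^sup>2 + 2 * (\<sigma> * r) * \<tau> * b
      + (2 * m - 1) * (\<sigma> * r)\<^sup>2 * b\<^sup>2 + (m - 1) * (\<sigma>\<^sup>2 * r) * b + n * (\<sigma> * r)\<^sup>2 * (a * b)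
      + (m - 1) * \<sigma>\<^sup>2 - n * (\<sigma> * r)\<^sup>2 * a' + n * (\<sigma> * r)\<^sup>2 * a\<^sup>2"
    by (simp add: algebra_simps power2_eq_square)
  also have "\<dots> = - ((m - 1) * (s r)\<^sup>2 * deriv (deriv k) r / k r)
             + (deriv s r)\<^sup>2
             + 2 * s r * deriv s r * deriv k r / k r
             + (2 * m - 1) * (s r)\<^sup>2 * (deriv k r)\<^sup>2 / (k r)\<^sup>2
             + (m - 1) * (s r)\<^sup>2 * deriv k r / (k r * r)
             + n * (s r)\<^sup>2 * deriv h r * deriv k r / (h r * k r)
             + (m - 1) * (s r)\<^sup>2 / r\<^sup>2
             - n * (s r)\<^sup>2 * deriv (deriv h) r / h r
             + n * (s r)\<^sup>2 * (deriv h r)\<^sup>2 / (h r)\<^sup>2"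
    unfolding sr using r0
    by (simp add: a_def a'_def b_def b'_def \<tau>_def power_divide power_mult_distrib)
      (simp add: power2_eq_square)
  finally show ?thesis .
qed

end

section \<open>The vector bundle in adapted coordinates\<close>

text \<open>
  A base chart \<open>c\<close> over which an orthonormal frame is defined. Together they give the chart \<open>C\<close> of the
  total space in which the metric takes the form of \<open>radial_metric\<close>.
\<close>

locale local_bundle =
  fixes B :: "('b::{t2_space, second_countable_topology}, 'e::{t2_space, second_countable_topology},
               'n::finite, 'm::finite) vbundle"
    and gB :: "'b \<Rightarrow> 'b tvec \<Rightarrow> 'b tvec \<Rightarrow> real"
    and ip :: "'e \<Rightarrow> 'e \<Rightarrow> real"
    and D :: "'b \<Rightarrow> 'b tvec \<Rightarrow> ('b \<Rightarrow> 'e) \<Rightarrow> 'e"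
    and U :: "'b set" and \<psi> :: "'e \<Rightarrow> real ^ 'm" and c :: "('b, real ^ 'n) chart"
  assumes is_bundle: "vector_bundle B"
    and base_metric: "riemannian_metric (base B) gB"
    and fibre_metric: "fibre_metric B ip"
    and connection: "bundle_connection B D" and compatible: "metric_compatible B ip D"
    and orthonormal: "orthonormal_triv B ip U \<psi>"
    and c: "c \<in> base B" and c_subset: "fst c \<subseteq> U"
begin

sublocale base: manifold "base B"
  by unfold_locales (use is_bundle in \<open>simp add: vector_bundle_def\<close>)

sublocale total: manifold "total B"
  by unfold_locales (use is_bundle in \<open>simp add: vector_bundle_def\<close>)

abbreviation C :: "('e, (real ^ 'n) \<times> (real ^ 'm)) chart" where
  "C \<equiv> bundle_chart B c \<psi>"

lemma local_triv: "local_triv B U \<psi>"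
  using orthonormal by (simp add: orthonormal_triv_def)

lemma C: "C \<in> total B"
  using local_triv c c_subset by (simp add: local_triv_def)

lemma fst_C: "e \<in> fst C \<longleftrightarrow> proj B e \<in> fst c"
  and snd_C: "snd C e = (snd c (proj B e), \<psi> e)"
  by (simp_all add: bundle_chart_def)

lemma ip_eq: "proj B e \<in> fst c \<Longrightarrow> proj B e' = proj B e \<Longrightarrow> ip e e' = \<psi> e \<bullet> \<psi> e'"
  using orthonormal c_subset unfolding orthonormal_triv_def by (auto simp: inner_vec_def)

lemma fibre_radius_eq: "proj B e \<in> fst c \<Longrightarrow> fibre_radius ip e = norm (\<psi> e)"
  by (simp add: fibre_radius_def ip_eq norm_eq_sqrt_inner)

lemma frame: "p \<in> fst c \<Longrightarrow> proj B (frame B \<psi> \<alpha> p) = p \<and> \<psi> (frame B \<psi> \<alpha> p) = axis \<alpha> 1"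
proof -
  assume "p \<in> fst c"
  then have "bij_betw \<psi> (proj B -` {p}) UNIV" using local_triv c_subset by (auto simp: local_triv_def)
  then have "axis \<alpha> 1 \<in> \<psi> ` (proj B -` {p})" by (simp add: bij_betw_def)
  from inv_into_into[OF this] f_inv_into_f[OF this]
  show ?thesis by (simp add: frame_def)
qed

lemma frame_section: "section_on B (fst c) (frame B \<psi> \<alpha>)"
  unfolding section_on_def
proof (intro ballI conjI exI)
  fix p assume p: "p \<in> fst c"
  show "proj B (frame B \<psi> \<alpha> p) = p" using frame p by blast
  show "local_triv B U \<psi>" by (rule local_triv)
  show "p \<in> U" using p c_subset by blast
  show "c \<in> base B" by (rule c)
  show "p \<in> fst c" by (rule p)
  have "fst c \<inter> U \<inter> fst c = fst c" using c_subset by blast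
  moreover have "smooth_on (snd c ` fst c) (\<lambda>y. \<psi> (frame B \<psi> \<alpha> (chart_inv c y)))"
    by (rule smooth_on_cong[OF smooth_on_const[OF base.open_chart_image[OF c], of "axis \<alpha> 1"]])
      (use frame base.chart_inv_left[OF c] in auto)
  ultimately show "smooth_on (snd c ` (fst c \<inter> U \<inter> fst c)) (\<lambda>y. \<psi> (frame B \<psi> \<alpha> (chart_inv c y)))"
    by simp
qed

lemma D_frame:
  assumes "p \<in> fst c" "w \<in> tangent_space (base B) p"
  shows "proj B (D p w (frame B \<psi> \<beta>)) = p"
    and "w' \<in> tangent_space (base B) p \<Longrightarrow>
      D p (\<lambda>f. a * w f + w' f) (frame B \<psi> \<beta>) =
        add B (scale B a (D p w (frame B \<psi> \<beta>))) (D p w' (frame B \<psi> \<beta>))"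
proof -
  have *: "\<forall>p\<in>fst c. \<forall>w\<in>tangent_space (base B) p.
           proj B (D p w (frame B \<psi> \<beta>)) = p \<and>
           (\<forall>a. \<forall>w'\<in>tangent_space (base B) p.
              D p (\<lambda>f. a * w f + w' f) (frame B \<psi> \<beta>) =
                add B (scale B a (D p w (frame B \<psi> \<beta>))) (D p w' (frame B \<psi> \<beta>)))"
    using connection[unfolded bundle_connection_def, rule_format, of "fst c" "frame B \<psi> \<beta>"]
      frame_section base.open_chart[OF c] by blast
  show "proj B (D p w (frame B \<psi> \<beta>)) = p" using * assms by blast
  show "w' \<in> tangent_space (base B) p \<Longrightarrow>
      D p (\<lambda>f. a * w f + w' f) (frame B \<psi> \<beta>) =
        add B (scale B a (D p w (frame B \<psi> \<beta>))) (D p w' (frame B \<psi> \<beta>))"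
    using * assms by blast
qed

text \<open>
  In an orthonormal frame, inner products with frame sections are fibre coordinates; so linearity of the
  connection forms follows from linearity of the trivialisation.
\<close>

lemma conn_form_eq:
  assumes "p \<in> fst c" "w \<in> tangent_space (base B) p"
  shows "conn_form B ip D \<psi> \<alpha> \<beta> p w = \<psi> (D p w (frame B \<psi> \<beta>)) $ \<alpha>"
  unfolding conn_form_def using ip_eq[of "frame B \<psi> \<alpha> p"] frame[OF assms(1)] D_frame(1)[OF assms] assms
  by (simp add: inner_axis')

abbreviation \<omega>\<^sub>c :: "'m \<Rightarrow> 'm \<Rightarrow> real ^ 'n \<Rightarrow> real ^ 'n \<Rightarrow> real" where
  "\<omega>\<^sub>c \<alpha> \<beta> y u \<equiv> conn_form B ip D \<psi> \<alpha> \<beta> (chart_inv c y) (tangent c (chart_inv c y) u)"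

lemma conn_form_linear:
  assumes "p \<in> fst c"
  shows "linear (\<lambda>u. conn_form B ip D \<psi> \<alpha> \<beta> p (tangent c p u))"
proof -
  have T: "tangent c p u \<in> tangent_space (base B) p" for u by (rule base.tangent_in_space[OF c assms])
  let ?\<sigma> = "frame B \<psi> \<beta>"
  have *: "conn_form B ip D \<psi> \<alpha> \<beta> p (tangent c p (a *\<^sub>R u + v)) =
      a * conn_form B ip D \<psi> \<alpha> \<beta> p (tangent c p u) + conn_form B ip D \<psi> \<alpha> \<beta> p (tangent c p v)" for a u v
  proof -
    have pU: "p \<in> U" using assms c_subset by blast
    have "proj B (scale B a (D p (tangent c p u) ?\<sigma>)) = p"
      using is_bundle D_frame(1)[OF assms T] by (simp add: vector_bundle_def)
    then have "\<psi> (add B (scale B a (D p (tangent c p u) ?\<sigma>)) (D p (tangent c p v) ?\<sigma>)) =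
        a *\<^sub>R \<psi> (D p (tangent c p u) ?\<sigma>) + \<psi> (D p (tangent c p v) ?\<sigma>)"
      using local_triv pU D_frame(1)[OF assms T] by (simp add: local_triv_def)
    then show ?thesis
      unfolding conn_form_eq[OF assms T] unfolding tangent_linear D_frame(2)[OF assms T T] by simp
  qed
  have "conn_form B ip D \<psi> \<alpha> \<beta> p (tangent c p 0) = 0" using *[of "-1" 0 0] by simp
  then show ?thesis using *[of 1] *[of _ _ 0] by (intro linearI) auto
qed

text \<open>
  Differentiate the constant function \<open>\<langle>\<sigma>\<^sub>\<alpha>, \<sigma>\<^sub>\<beta>\<rangle>\<close>.
\<close>

lemma conn_form_skew:
  assumes "p \<in> fst c"
  shows "conn_form B ip D \<psi> \<alpha> \<beta> p (tangent c p u) = - conn_form B ip D \<psi> \<beta> \<alpha> p (tangent c p u)"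
proof -
  have T: "tangent c p u \<in> tangent_space (base B) p" by (rule base.tangent_in_space[OF c assms])
  let ?f = "\<lambda>q. ip (frame B \<psi> \<alpha> q) (frame B \<psi> \<beta> q)" and ?w = "tangent c p u"
  have "(?f \<circ> chart_inv c has_derivative (\<lambda>v. 0)) (at (snd c p))"
  proof (rule has_derivative_transform_within_open[OF _ base.open_chart_image[OF c]])
    show "((\<lambda>y. axis \<alpha> 1 \<bullet> (axis \<beta> 1 :: real ^ 'm)) has_derivative (\<lambda>v. 0)) (at (snd c p))"
      by (rule has_derivative_const)
    fix y assume "y \<in> snd c ` fst c"
    then have "chart_inv c y \<in> fst c" using base.chart_inv_right(1)[OF c subset_refl] by blast
    then show "axis \<alpha> 1 \<bullet> (axis \<beta> 1 :: real ^ 'm) = (?f \<circ> chart_inv c) y" using frame ip_eq by simp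
  qed (use assms in simp)
  then have "?w ?f = 0" by (rule tangent_eqI)
  moreover have "?w ?f = ip (D p ?w (frame B \<psi> \<alpha>)) (frame B \<psi> \<beta> p) + ip (frame B \<psi> \<alpha> p) (D p ?w (frame B \<psi> \<beta>))"
    using compatible[unfolded metric_compatible_def, rule_format, of "fst c" "frame B \<psi> \<alpha>" "frame B \<psi> \<beta>" p ?w]
      frame_section base.open_chart[OF c] assms T by blast
  moreover have "ip (D p ?w (frame B \<psi> \<alpha>)) (frame B \<psi> \<beta> p) = ip (frame B \<psi> \<beta> p) (D p ?w (frame B \<psi> \<alpha>))"
    using ip_eq frame[OF assms] D_frame(1)[OF assms T] assms by (simp add: inner_commute)
  ultimately show ?thesis by (simp add: conn_form_def)
qed

lemma conn_form_smooth: "smooth_on (snd c ` fst c) (\<lambda>y. \<omega>\<^sub>c \<alpha> \<beta> y u)"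
proof -
  have "section_on B (fst c) (\<lambda>p. D p (coord_field c u p) (frame B \<psi> \<beta>))"
    using connection[unfolded bundle_connection_def, rule_format, of "fst c" "frame B \<psi> \<beta>"]
      frame_section base.open_chart[OF c] base.coord_field_is_vector_field[OF c] by blast
  then have "smooth_fun_on (base B) (fst c) (\<lambda>p. ip (frame B \<psi> \<alpha> p) (D p (coord_field c u p) (frame B \<psi> \<beta>)))"
    using fibre_metric[unfolded fibre_metric_def] frame_section base.open_chart[OF c] by blast
  then have "smooth_on (snd c ` fst c) ((\<lambda>p. ip (frame B \<psi> \<alpha> p) (D p (coord_field c u p) (frame B \<psi> \<beta>))) \<circ> chart_inv c)"
    by (simp only: base.smooth_fun_on_chart_iff[OF c base.open_chart[OF c] subset_refl])
  then show ?thesis by (simp add: o_def conn_form_def coord_field_def)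
qed

definition \<beta> :: "real ^ 'n \<Rightarrow> real ^ 'n \<Rightarrow> real ^ 'n \<Rightarrow> real" where
  "\<beta> y u v = gB (chart_inv c y) (tangent c (chart_inv c y) u) (tangent c (chart_inv c y) v)"

definition \<omega> :: "real ^ 'n \<Rightarrow> real ^ 'n \<Rightarrow> real ^ 'm \<Rightarrow> real ^ 'm" where
  "\<omega> y u x = (\<chi> \<alpha>. \<Sum>\<gamma>\<in>UNIV. x $ \<gamma> * \<omega>\<^sub>c \<alpha> \<gamma> y u)"

lemma
  assumes "y \<in> snd c ` fst c"
  shows \<beta>_bilinear: "bilinear (\<beta> y)" and \<beta>_symmetric: "\<beta> y u v = \<beta> y v u"
    and \<beta>_positive: "u \<noteq> 0 \<Longrightarrow> 0 < \<beta> y u u"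
  using base_metric[unfolded riemannian_metric_def, rule_format, OF c]
    base.chart_inv_right(1)[OF c subset_refl assms]
  by (auto simp: \<beta>_def[abs_def])

lemma \<beta>_smooth: "smooth_on (snd c ` fst c) (\<lambda>y. \<beta> y u v)"
  using base_metric[unfolded riemannian_metric_def, rule_format, OF c] by (simp add: \<beta>_def)

lemma
  assumes "y \<in> snd c ` fst c"
  shows \<omega>_linear: "linear (\<lambda>u. \<omega> y u x)" and \<omega>_linear_fibre: "linear (\<omega> y u)"
    and \<omega>_skew: "\<omega> y u x \<bullet> x = 0"
proof -
  have p: "chart_inv c y \<in> fst c" by (rule base.chart_inv_right(1)[OF c subset_refl assms])
  note lin = conn_form_linear[OF p]
  show "linear (\<lambda>u. \<omega> y u x)"
    unfolding \<omega>_def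
    by (intro linearI)
      (simp_all add: vec_eq_iff linear_add[OF lin] linear_scale[OF lin] algebra_simps sum.distrib sum_distrib_left)
  show "linear (\<omega> y u)"
    unfolding \<omega>_def
    by (intro linearI) (simp_all add: vec_eq_iff algebra_simps sum.distrib sum_distrib_left)
  let ?S = "\<Sum>\<alpha>\<in>UNIV. \<Sum>\<gamma>\<in>UNIV. x $ \<alpha> * x $ \<gamma> * \<omega>\<^sub>c \<alpha> \<gamma> y u"
  have "?S = (\<Sum>\<gamma>\<in>UNIV. \<Sum>\<alpha>\<in>UNIV. x $ \<alpha> * x $ \<gamma> * \<omega>\<^sub>c \<alpha> \<gamma> y u)" by (rule sum.swap)
  also have "\<dots> = (\<Sum>\<gamma>\<in>UNIV. \<Sum>\<alpha>\<in>UNIV. - (x $ \<gamma> * x $ \<alpha> * \<omega>\<^sub>c \<gamma> \<alpha> y u))"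
  proof (intro sum.cong refl)
    fix \<alpha> \<gamma>
    show "x $ \<alpha> * x $ \<gamma> * \<omega>\<^sub>c \<alpha> \<gamma> y u = - (x $ \<gamma> * x $ \<alpha> * \<omega>\<^sub>c \<gamma> \<alpha> y u)"
      using conn_form_skew[OF p, of \<alpha> \<gamma> u] by simp
  qed
  also have "\<dots> = - ?S" by (simp add: sum_negf)
  finally have "?S = 0" by simp
  moreover have "\<omega> y u x \<bullet> x = ?S"
    by (simp add: \<omega>_def inner_vec_def sum_distrib_right sum_distrib_left mult_ac)
  ultimately show "\<omega> y u x \<bullet> x = 0" by simp
qed

text \<open>
  For functions that are differentiable at the base point this is the chain rule for the projection.
  If \<open>f\<close> is not differentiable there, then neither is its pullback, as restriction to a horizontal
  coordinate slice shows, and both sides take the default value \<open>0\<close>.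
\<close>

lemma pushforward_tangent:
  assumes "e \<in> fst C"
  shows "pushforward (proj B) (tangent C e u) = tangent c (proj B e) (fst u)"
proof
  fix f :: "'b \<Rightarrow> real"
  have p: "proj B e \<in> fst c" using assms fst_C by blast
  let ?F = "(f \<circ> proj B) \<circ> chart_inv C" and ?f = "f \<circ> chart_inv c"
  have F: "?F z = ?f (fst z)" if z: "z \<in> snd C ` fst C" for z
  proof -
    obtain q where q: "z = snd C q" "q \<in> fst C" using z by blast
    then have "fst z = snd c (proj B q)" "proj B q \<in> fst c" using snd_C fst_C by simp_all
    then show ?thesis using total.chart_inv_left[OF C q(2)] q(1) base.chart_inv_left[OF c] by simp
  qed
  have e: "snd C e \<in> snd C ` fst C" using assms by blast
  show "pushforward (proj B) (tangent C e u) f = tangent c (proj B e) (fst u) f"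
  proof (cases "?f differentiable (at (snd c (proj B e)))")
    case True
    then have f': "(?f has_derivative frechet_derivative ?f (at (snd c (proj B e)))) (at (snd c (proj B e)))"
      by (simp add: frechet_derivative_works)
    then have f'': "(?f has_derivative frechet_derivative ?f (at (snd c (proj B e)))) (at (fst (snd C e)))"
      by (simp add: snd_C)
    have "((\<lambda>z. ?f (fst z)) has_derivative (\<lambda>u. frechet_derivative ?f (at (snd c (proj B e))) (fst u))) (at (snd C e))"
      by (rule has_derivative_compose[OF has_derivative_fst[OF has_derivative_ident] f''])
    then have "(?F has_derivative (\<lambda>u. frechet_derivative ?f (at (snd c (proj B e))) (fst u))) (at (snd C e))"
      by (rule has_derivative_transform_within_open[OF _ total.open_chart_image[OF C] e]) (rule F[symmetric])
    then show ?thesis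
      using tangent_eqI[OF f'] tangent_eqI[of "f \<circ> proj B" C] by (simp add: pushforward_def)
  next
    case False
    have "\<not> ?F differentiable (at (snd C e))"
    proof
      assume "?F differentiable (at (snd C e))"
      then obtain F' where F': "(?F has_derivative F') (at (snd c (proj B e), \<psi> e))"
        unfolding differentiable_def by (auto simp: snd_C)
      \<comment> \<open>The coordinate slice through \<open>e\<close> with constant fibre coordinates.\<close>
      let ?V = "(\<lambda>y. (y, \<psi> e)) -` (snd C ` fst C)"
      have "open ?V"
        by (rule open_vimage[OF total.open_chart_image[OF C]]) (auto intro!: continuous_intros)
      have "((\<lambda>y. ?F (y, \<psi> e)) has_derivative (\<lambda>v. F' (v, 0))) (at (snd c (proj B e)))"
      proof (rule has_derivative_compose[where f = "\<lambda>y. (y, \<psi> e)" and f' = "\<lambda>v. (v, 0)" and g = ?F and g' = F'])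
        show "((\<lambda>y. (y, \<psi> e)) has_derivative (\<lambda>v. (v, 0))) (at (snd c (proj B e)))"
          by (auto intro!: derivative_eq_intros)
      qed (rule F')
      then have "(?f has_derivative (\<lambda>v. F' (v, 0))) (at (snd c (proj B e)))"
        by (rule has_derivative_transform_within_open[OF _ \<open>open ?V\<close>]) (use e F in \<open>auto simp: snd_C\<close>)
      then show False using False by (auto simp: differentiable_def)
    qed
    then show ?thesis using False by (simp add: pushforward_def tangent_def)
  qed
qed

lemma zeta_tangent:
  assumes "e \<in> fst C"
  shows "zeta B ip D \<psi> \<alpha> e (tangent C e u) = (snd u + \<omega> (snd c (proj B e)) (fst u) (\<psi> e)) $ \<alpha>"
proof -
  have p: "proj B e \<in> fst c" using assms fst_C by blast
  have "(\<lambda>q. \<psi> q $ \<alpha>) = (\<lambda>q. snd C q \<bullet> (0, axis \<alpha> 1))" by (simp add: snd_C inner_axis)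
  then have "tangent C e u (\<lambda>q. \<psi> q $ \<alpha>) = snd u $ \<alpha>"
    using total.tangent_coordinate[OF C assms, of u "(0, axis \<alpha> 1)"] by (simp add: inner_axis inner_Pair_0)
  then show ?thesis
    by (simp add: zeta_def pushforward_tangent[OF assms] \<omega>_def base.chart_inv_left[OF c p])
qed

lemma bundle_metric_tangent:
  assumes "bundle_metric B gB ip D h k g" "e \<in> fst C"
  shows "g e (tangent C e u) (tangent C e v) =
    (h (norm (\<psi> e)))\<^sup>2 * \<beta> (snd c (proj B e)) (fst u) (fst v) +
    (k (norm (\<psi> e)))\<^sup>2 * ((snd u + \<omega> (snd c (proj B e)) (fst u) (\<psi> e)) \<bullet> (snd v + \<omega> (snd c (proj B e)) (fst v) (\<psi> e)))"
proof -
  have p: "proj B e \<in> fst c" using assms fst_C by blast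
  note T = total.tangent_in_space[OF C assms(2)]
  have "g e (tangent C e u) (tangent C e v) =
      (h (fibre_radius ip e))\<^sup>2 * gB (proj B e) (pushforward (proj B) (tangent C e u)) (pushforward (proj B) (tangent C e v)) +
      (k (fibre_radius ip e))\<^sup>2 * (\<Sum>\<alpha>\<in>UNIV. zeta B ip D \<psi> \<alpha> e (tangent C e u) * zeta B ip D \<psi> \<alpha> e (tangent C e v))"
    using assms(1)[unfolded bundle_metric_def, rule_format, OF orthonormal, of e] p c_subset T by blast
  then show ?thesis
    by (simp only: pushforward_tangent[OF assms(2)] zeta_tangent[OF assms(2)] fibre_radius_eq[OF p]
        \<beta>_def base.chart_inv_left[OF c p] inner_vec_def inner_real_def)
qed

lemma radial_field_tangent:
  assumes "radial_field B ip s X" "e \<in> fst C" "\<psi> e \<noteq> 0"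
  shows "X e = tangent C e ((s (norm (\<psi> e)) / norm (\<psi> e)) *\<^sub>R (0, \<psi> e))"
proof
  fix f
  have p: "proj B e \<in> fst c" using assms fst_C by blast
  have lin: "linear (\<lambda>v. tangent C e v f)"
    by (intro linearI) (simp_all add: tangent_add tangent_scale)
  have x: "(0 :: real ^ 'n, \<psi> e) = (\<Sum>\<alpha>\<in>UNIV. \<psi> e $ \<alpha> *\<^sub>R (0, axis \<alpha> 1))"
  proof -
    have "(\<Sum>\<alpha>\<in>UNIV. \<psi> e $ \<alpha> *\<^sub>R (0 :: real ^ 'n, axis \<alpha> (1::real))) = (0, \<Sum>\<alpha>\<in>UNIV. \<psi> e $ \<alpha> *\<^sub>R axis \<alpha> 1)"
      by (simp add: prod_eq_iff fst_sum snd_sum)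
    then show ?thesis using basis_expansion[of "\<psi> e"] by (simp add: scalar_mult_eq_scaleR)
  qed
  have "X e = (\<lambda>f. s (fibre_radius ip e) *
          (\<Sum>\<alpha>\<in>UNIV. (\<psi> e $ \<alpha> / fibre_radius ip e) * tangent C e (0, axis \<alpha> 1) f))"
    using assms(1)[unfolded radial_field_def, rule_format, of U \<psi> c e] orthonormal c c_subset p
      fibre_radius_eq[OF p] assms(3) by simp
  then have "X e f = s (norm (\<psi> e)) / norm (\<psi> e) * (\<Sum>\<alpha>\<in>UNIV. \<psi> e $ \<alpha> * tangent C e (0, axis \<alpha> 1) f)"
    by (simp add: fibre_radius_eq[OF p] sum_divide_distrib[symmetric])
  also have "(\<Sum>\<alpha>\<in>UNIV. \<psi> e $ \<alpha> * tangent C e (0, axis \<alpha> 1) f) = tangent C e (0, \<psi> e) f"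
    unfolding x linear_sum[OF lin] linear_scale[OF lin] by simp
  finally show "X e f = tangent C e ((s (norm (\<psi> e)) / norm (\<psi> e)) *\<^sub>R (0, \<psi> e)) f"
    by (simp only: tangent_scale)
qed

definition S :: "'e set" where "S = {e \<in> fst C. \<psi> e \<noteq> 0}"

lemma open_S: "open S"
proof -
  have "open {z :: (real ^ 'n) \<times> (real ^ 'm). snd z \<noteq> 0}"
    by (rule open_Collect_neq) (auto intro!: continuous_intros)
  from total.open_chart_preimage[OF C this] show ?thesis by (simp add: S_def snd_C)
qed

lemma S_coords:
  assumes "z \<in> snd C ` S"
  shows "fst z \<in> snd c ` fst c" "snd z \<noteq> 0" "chart_inv C z \<in> S" "snd C (chart_inv C z) = z"
proof -
  have "S \<subseteq> fst C" by (auto simp: S_def)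
  from total.chart_inv_right[OF C this assms] show "chart_inv C z \<in> S" "snd C (chart_inv C z) = z" .
  obtain e where "e \<in> S" "z = snd C e" using assms by blast
  then show "fst z \<in> snd c ` fst c" "snd z \<noteq> 0" by (auto simp: S_def snd_C fst_C)
qed

text \<open>
  Smoothness of the base metric and of the connection forms makes the coefficients of the metric smooth;
  \<open>gram_derivative\<close> requires this.
\<close>

lemma G_model_differentiable:
  assumes "radial_metric h k \<beta> \<omega> (snd C ` S)" "z \<in> snd C ` S"
  shows "(\<lambda>z. radial_metric.G h k \<beta> \<omega> z u v) differentiable (at z)"
proof -
  interpret radial_metric h k \<beta> \<omega> "snd C ` S" by (rule assms(1))
  let ?Z = "snd C ` S" and ?Y = "snd c ` fst c"
  have Y: "open ?Y" by (rule base.open_chart_image[OF c])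
  have ZY: "fst ` ?Z \<subseteq> ?Y" using S_coords(1) by blast
  have fst: "smooth_on ?Z fst" and snd: "smooth_on ?Z snd"
    by (rule smooth_on_bounded_linear[OF open_Z bounded_linear_fst] smooth_on_bounded_linear[OF open_Z bounded_linear_snd])+
  have o: "open {0::real<..}" by simp
  have sq: "smooth_on ?Z (\<lambda>z. (f (norm (snd z)))\<^sup>2)" if "smooth_on {0<..} f" for f :: "real \<Rightarrow> real"
  proof -
    have "smooth_on ?Z (\<lambda>z. f (norm (snd z)))"
      by (rule smooth_on_compose[OF open_Z o fibre_norm_smooth that], rule image_subsetI) (use Z_nonzero in simp)
    then show ?thesis unfolding power2_eq_square by (intro smooth_on_bilinear[OF bounded_bilinear_mult open_Z])
  qed
  have zeta: "smooth_on ?Z (\<lambda>z. \<zeta> z u)" for u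
    unfolding \<zeta>_def
  proof (rule smooth_onI[OF open_Z], rule Ck_on_add[OF open_Z Ck_on_const[OF open_Z]], rule smooth_onD[OF open_Z],
      rule smooth_on_components[OF open_Z])
    fix b :: "real ^ 'm" assume "b \<in> Basis"
    then obtain \<alpha> where b: "b = axis \<alpha> 1" by (auto simp: Basis_vec_def)
    have "smooth_on ?Z (\<lambda>z. \<Sum>\<gamma>\<in>UNIV. (snd z \<bullet> axis \<gamma> 1) * \<omega>\<^sub>c \<alpha> \<gamma> (fst z) (fst u))"
      by (intro smooth_on_sum[OF open_Z] smooth_on_bilinear[OF bounded_bilinear_mult open_Z]
          smooth_on_component[OF open_Z snd] smooth_on_compose[OF open_Z Y fst conn_form_smooth ZY])
    then show "smooth_on ?Z (\<lambda>z. \<omega> (fst z) (fst u) (snd z) \<bullet> b)"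
      by (simp add: b inner_axis \<omega>_def)
  qed
  have "smooth_on ?Z (\<lambda>z. \<beta> (fst z) (fst u) (fst v))"
    by (rule smooth_on_compose[OF open_Z Y fst \<beta>_smooth ZY])
  then have "smooth_on ?Z (\<lambda>z. (h (norm (snd z)))\<^sup>2 * \<beta> (fst z) (fst u) (fst v))"
    by (intro smooth_on_bilinear[OF bounded_bilinear_mult open_Z] sq[OF h_smooth])
  moreover have "smooth_on ?Z (\<lambda>z. (k (norm (snd z)))\<^sup>2 * (\<zeta> z u \<bullet> \<zeta> z v))"
    by (intro smooth_on_bilinear[OF bounded_bilinear_mult open_Z] sq[OF k_smooth]
        smooth_on_bilinear[OF bounded_bilinear_inner open_Z] zeta)
  ultimately show ?thesis
    unfolding G_def using smooth_on_differentiable[OF open_Z _ assms(2)] by (intro differentiable_add)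
qed

text \<open>
  The chart \<open>C\<close> translates every ingredient into the coordinate model: the metric into
  \<open>radial_metric.G\<close>, the connection into its Christoffel symbols, \<open>X\<close> into the radial vector field, and the
  orthonormal basis into an orthonormal set of coordinate vectors.
\<close>

lemma sum_norm_nabla_radial_field:
  assumes h: "smooth_on {0<..} h" "\<And>t. 0 < t \<Longrightarrow> 0 < h t" and k: "smooth_on {0<..} k" "\<And>t. 0 < t \<Longrightarrow> 0 < k t"
    and s: "smooth_on {0<..} s"
    and g: "bundle_metric B gB ip D h k g"
    and nab: "levi_civita_on (total B) S g nab" and ricci: "ricci_flat_on (total B) S nab"
    and X: "radial_field B ip s X"
    and e: "e \<in> S" and F: "orthonormal_basis_at (total B) g e F"
    and r: "r = norm (\<psi> e)" and n: "n = real CARD('n)" and m: "m = real CARD('m)"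
  shows "(\<Sum>w\<in>F. g e (nab e w X) (nab e w X)) =
             - ((m - 1) * (s r)\<^sup>2 * deriv (deriv k) r / k r)
             + (deriv s r)\<^sup>2
             + 2 * s r * deriv s r * deriv k r / k r
             + (2 * m - 1) * (s r)\<^sup>2 * (deriv k r)\<^sup>2 / (k r)\<^sup>2
             + (m - 1) * (s r)\<^sup>2 * deriv k r / (k r * r)
             + n * (s r)\<^sup>2 * deriv h r * deriv k r / (h r * k r)
             + (m - 1) * (s r)\<^sup>2 / r\<^sup>2
             - n * (s r)\<^sup>2 * deriv (deriv h) r / h r
             + n * (s r)\<^sup>2 * (deriv h r)\<^sup>2 / (h r)\<^sup>2"
proof -
  have S_subset: "S \<subseteq> fst C" by (auto simp: S_def)
  have affine: "affine_connection_on (total B) S nab" using nab unfolding levi_civita_on_def by blast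
  interpret lc: chart_levi_civita "total B" C S nab g
    by unfold_locales (rule C open_S S_subset affine nab)+
  interpret rm: radial_metric h k \<beta> \<omega> "snd C ` S"
  proof (rule radial_metric.intro)
    show "smooth_on {0<..} h" "smooth_on {0<..} k" "open (snd C ` S)" by (rule h k lc.open_coords)+
    show "0 < h t" "0 < k t" if "0 < t" for t using h(2) k(2) that by simp_all
    fix z u v x assume "z \<in> snd C ` S"
    note y = S_coords(1)[OF this] and x = S_coords(2)[OF this]
    show "snd z \<noteq> 0" by (rule x)
    show "bilinear (\<beta> (fst z))" by (rule \<beta>_bilinear[OF y])
    show "\<beta> (fst z) u v = \<beta> (fst z) v u" by (rule \<beta>_symmetric[OF y])
    show "u \<noteq> 0 \<Longrightarrow> 0 < \<beta> (fst z) u u" by (rule \<beta>_positive[OF y])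
    show "linear (\<lambda>u. \<omega> (fst z) u x)" by (rule \<omega>_linear[OF y])
    show "linear (\<omega> (fst z) u)" by (rule \<omega>_linear_fibre[OF y])
    show "\<omega> (fst z) u x \<bullet> x = 0" by (rule \<omega>_skew[OF y])
  qed
  have gram: "lc.gram z u v = rm.G z u v" if z: "z \<in> snd C ` S" for z u v
  proof -
    have "chart_inv C z \<in> fst C" using S_coords(3)[OF z] S_subset by blast
    moreover have "snd c (proj B (chart_inv C z)) = fst z" "\<psi> (chart_inv C z) = snd z"
      using arg_cong[OF S_coords(4)[OF z], of fst] arg_cong[OF S_coords(4)[OF z], of snd]
      by (simp_all add: snd_C)
    ultimately show ?thesis
      by (simp add: lc.gram_def bundle_metric_tangent[OF g] rm.G_def rm.\<zeta>_def)
  qed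
  have coords: "\<exists>p. p \<in> S \<and> z = snd C p" if "z \<in> snd C ` S" for z using that by blast
  interpret rl: radial_levi_civita h k \<beta> \<omega> "snd C ` S" lc.christoffel
  proof (rule radial_levi_civita.intro[OF rm.radial_metric_axioms], rule radial_levi_civita_axioms.intro)
    fix z u v a assume z: "z \<in> snd C ` S"
    obtain p where p: "p \<in> S" "z = snd C p" using coords[OF z] by blast
    show "lc.christoffel z u v = lc.christoffel z v u" using lc.christoffel_symmetric[OF p(1)] p(2) by simp
    show "linear (lc.christoffel z u)" using lc.christoffel_linear_right[OF p(1)] p(2) by simp
    show "(\<lambda>z. rm.G z u v) differentiable (at z)" by (rule G_model_differentiable[OF rm.radial_metric_axioms z])
    fix \<xi> \<eta> G' assume \<xi>: "smooth_on (snd C ` S) \<xi>" and \<eta>: "smooth_on (snd C ` S) \<eta>"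
      and G': "((\<lambda>z. rm.G z (\<xi> z) (\<eta> z)) has_derivative G') (at z)"
    have "((\<lambda>z. lc.gram z (\<xi> z) (\<eta> z)) has_derivative G') (at z)"
      by (rule has_derivative_transform_within_open[OF G' lc.open_coords z]) (rule gram[symmetric])
    from lc.gram_derivative[OF p(1) \<xi> \<eta> this[unfolded p(2)], of a]
    show "G' a = rm.G z (frechet_derivative \<xi> (at z) a + lc.christoffel z a (\<xi> z)) (\<eta> z)
        + rm.G z (\<xi> z) (frechet_derivative \<eta> (at z) a + lc.christoffel z a (\<eta> z))"
      by (simp add: p(2)[symmetric] gram[OF z])
  qed (rule lc.christoffel_smooth)
  let ?z = "snd C e"
  have z: "?z \<in> snd C ` S" using e by blast
  have eC: "e \<in> fst C" using e S_subset by blast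
  have rz: "r = norm (snd ?z)" by (simp add: r snd_C)
  have Xeq: "X q = tangent C q (rm.radial s (snd C q))" if "q \<in> S" for q
    using radial_field_tangent[OF X, of q] that by (simp add: S_def rm.radial_def snd_C)
  have nabX: "nab e (tangent C e v) X = tangent C e (rl.nabla s ?z v)" for v
    unfolding rl.nabla_def by (rule lc.nab_in_chart[OF e rm.radial_smooth[OF s] Xeq])
  have gG: "g e (tangent C e u) (tangent C e v) = rm.G ?z u v" for u v
    using gram[OF z, of u v] by (simp add: lc.gram_def total.chart_inv_left[OF C eC])
  have ric: "rl.ricci_radial ?z (0, snd ?z) = 0"
    using ricci C e eC unfolding ricci_flat_on_def rl.ricci_radial_def lc.ricci_in_chart[OF e, symmetric] by blast
  have F_tangent: "tangent C e (total.components C w) = w" if "w \<in> F" for w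
    by (rule total.tangent_components[OF C eC]) (use F that in \<open>auto simp: orthonormal_basis_at_def\<close>)
  let ?F = "total.components C ` F"
  have inj: "inj_on (total.components C) F" using F_tangent by (metis inj_onI)
  have card: "card ?F = DIM((real ^ 'n) \<times> (real ^ 'm))"
    using F card_image[OF inj] by (simp add: orthonormal_basis_at_def)
  have ortho: "rm.G ?z u v = (if u = v then 1 else 0)" if "u \<in> ?F" "v \<in> ?F" for u v
  proof -
    obtain w w' where w: "w \<in> F" "w' \<in> F" "u = total.components C w" "v = total.components C w'"
      using \<open>u \<in> ?F\<close> \<open>v \<in> ?F\<close> by blast
    then have "rm.G ?z u v = g e w w'" using gG[of u v] F_tangent by simp
    also have "\<dots> = (if w = w' then 1 else 0)" using F w by (simp add: orthonormal_basis_at_def)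
    finally show ?thesis using inj w by (simp add: inj_on_eq_iff)
  qed
  have "(\<Sum>w\<in>F. g e (nab e w X) (nab e w X)) =
      (\<Sum>w\<in>F. rm.G ?z (rl.nabla s ?z (total.components C w)) (rl.nabla s ?z (total.components C w)))"
    by (rule sum.cong[OF refl]) (metis F_tangent nabX gG)
  also have "\<dots> = (\<Sum>v\<in>?F. rm.G ?z (rl.nabla s ?z v) (rl.nabla s ?z v))"
    by (simp add: sum.reindex[OF inj])
  finally show ?thesis using rl.sum_norm_nabla_eq[OF z rz s ric card ortho n m] by simp
qed

end

theorem corollary2p49:
  fixes B :: "('b::{t2_space, second_countable_topology}, 'e::{t2_space, second_countable_topology},
               'n::finite, 'm::finite) vbundle"
    and gB :: "'b \<Rightarrow> 'b tvec \<Rightarrow> 'b tvec \<Rightarrow> real"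
    and ip :: "'e \<Rightarrow> 'e \<Rightarrow> real"
    and D :: "'b \<Rightarrow> 'b tvec \<Rightarrow> ('b \<Rightarrow> 'e) \<Rightarrow> 'e"
    and h k s :: "real \<Rightarrow> real"
    and g :: "'e \<Rightarrow> 'e tvec \<Rightarrow> 'e tvec \<Rightarrow> real"
    and nab :: "'e \<Rightarrow> 'e tvec \<Rightarrow> ('e \<Rightarrow> 'e tvec) \<Rightarrow> 'e tvec"
    and X :: "'e \<Rightarrow> 'e tvec"
  defines "E\<^sub>0 \<equiv> {e. 0 < fibre_radius ip e}"
    and "n \<equiv> real CARD('n)" and "m \<equiv> real CARD('m)"
  assumes "vector_bundle B"
    and "riemannian_metric (base B) gB"
    and "fibre_metric B ip"
    and "bundle_connection B D" and "metric_compatible B ip D"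
    and "smooth_on {0..} h" and "smooth_on {0..} k" and "smooth_on {0..} s"
    and "\<And>t. 0 \<le> t \<Longrightarrow> 0 < h t" and "\<And>t. 0 \<le> t \<Longrightarrow> 0 < k t"
    and "bundle_metric B gB ip D h k g"
    and "levi_civita_on (total B) E\<^sub>0 g nab"
    and "ricci_flat_on (total B) E\<^sub>0 nab"
    and "radial_field B ip s X"
  shows "\<forall>U \<psi> e F r. orthonormal_triv B ip U \<psi> \<and> proj B e \<in> U \<and> r = fibre_radius ip e \<and> 0 < r \<and>
           orthonormal_basis_at (total B) g e F \<longrightarrow>
           (\<Sum>w\<in>F. g e (nab e w X) (nab e w X)) =
             - ((m - 1) * (s r)\<^sup>2 * deriv (deriv k) r / k r)
             + (deriv s r)\<^sup>2
             + 2 * s r * deriv s r * deriv k r / k r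
             + (2 * m - 1) * (s r)\<^sup>2 * (deriv k r)\<^sup>2 / (k r)\<^sup>2
             + (m - 1) * (s r)\<^sup>2 * deriv k r / (k r * r)
             + n * (s r)\<^sup>2 * deriv h r * deriv k r / (h r * k r)
             + (m - 1) * (s r)\<^sup>2 / r\<^sup>2
             - n * (s r)\<^sup>2 * deriv (deriv h) r / h r
             + n * (s r)\<^sup>2 * (deriv h r)\<^sup>2 / (h r)\<^sup>2"
proof (intro allI impI, elim conjE)
  fix U \<psi> e F r
  assume triv: "orthonormal_triv B ip U \<psi>" and eU: "proj B e \<in> U" and r: "r = fibre_radius ip e" "0 < r"
    and F: "orthonormal_basis_at (total B) g e F"
  interpret base: manifold "base B"
    by unfold_locales (use assms(4) in \<open>simp add: vector_bundle_def\<close>)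
  obtain c\<^sub>0 where c\<^sub>0: "c\<^sub>0 \<in> base B" "proj B e \<in> fst c\<^sub>0" using base.chart_covers by blast
  have "open U" using triv by (simp add: orthonormal_triv_def local_triv_def)
  define c where "c = (fst c\<^sub>0 \<inter> U, snd c\<^sub>0)"
  have c: "c \<in> base B" "fst c \<subseteq> U" and ec: "proj B e \<in> fst c"
    using base.restrict_chart[OF c\<^sub>0(1) \<open>open U\<close>] c\<^sub>0(2) eU by (auto simp: c_def)
  interpret local_bundle B gB ip D U \<psi> c
    by (rule local_bundle.intro[OF assms(4-8) triv c])
  have SE: "S \<subseteq> E\<^sub>0" by (auto simp: S_def E\<^sub>0_def fst_C fibre_radius_eq)
  have eS: "e \<in> S" using r ec by (auto simp: S_def fst_C fibre_radius_eq)
  have sub: "{0<..} \<subseteq> {0::real..}" by auto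
  have lc: "levi_civita_on (total B) S g nab"
    by (rule levi_civita_on_subset[OF assms(15) SE])
  have ric: "ricci_flat_on (total B) S nab"
    using assms(16) SE unfolding ricci_flat_on_def by blast
  show "(\<Sum>w\<in>F. g e (nab e w X) (nab e w X)) =
             - ((m - 1) * (s r)\<^sup>2 * deriv (deriv k) r / k r)
             + (deriv s r)\<^sup>2
             + 2 * s r * deriv s r * deriv k r / k r
             + (2 * m - 1) * (s r)\<^sup>2 * (deriv k r)\<^sup>2 / (k r)\<^sup>2
             + (m - 1) * (s r)\<^sup>2 * deriv k r / (k r * r)
             + n * (s r)\<^sup>2 * deriv h r * deriv k r / (h r * k r)
             + (m - 1) * (s r)\<^sup>2 / r\<^sup>2
             - n * (s r)\<^sup>2 * deriv (deriv h) r / h r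
             + n * (s r)\<^sup>2 * (deriv h r)\<^sup>2 / (h r)\<^sup>2"
    by (rule sum_norm_nabla_radial_field[OF smooth_on_subset[OF assms(9) sub] _ smooth_on_subset[OF assms(10) sub] _
          smooth_on_subset[OF assms(11) sub] assms(14) lc ric assms(17) eS F])
      (use assms(12,13) in \<open>auto simp: r(1) fibre_radius_eq[OF ec] n_def m_def\<close>)
qed

end
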